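(* Let $\psi(\vec X,x)$ be a formula whose free variables are among the individual variable $x$ and the predicate variables $\vec X = X_1,\dots,X_q$. If $\mathsf{MSO}\vdash \mathcal B^x_{\vec X}(\psi(\vec X,x))$, where \[\mathcal B^x_{\vec X}(\psi) := \forall z\forall\vec Z\forall\vec Z'\Big(\bigwedge_{1\leq i\leq q}\forall y\leq z\,(Z_i y\leftrightarrow Z'_i y)\ \to\ \big(\psi[\vec Z/\vec X,z/x]\leftrightarrow\psi[\vec Z'/\vec X,z/x]\big)\Big),\] then there is a uniformly bounded formula $\hat\varphi(\vec X,x)$, effectively computable from $\psi$, such that $\mathsf{MSO}\vdash\forall\vec X\forall x\big(\psi(\vec X,x)\leftrightarrow\hat\varphi(\vec X,x)\big)$.
   Context: \emph{Language.} Two-sorted: individual variables $x,y,z,\dots$, predicate variables $X,Y,Z,\dots$. Atomic formulae: $x\doteq y$, $x\leq y$, $\mathsf S(x,y)$, $\mathsf{Zero}(x)$, $x\in X$ (also written $Xx$), $\top$, $\bot$. Formulae: $\varphi ::= \alpha\mid\varphi\wedge\psi\mid\lnot\varphi\mid\exists x\varphi\mid\exists X\varphi$. Abbreviations: $\varphi\to\psi:=\lnot(\varphi\wedge\lnot\psi)$, $\varphi\leftrightarrow\psi:=(\varphi\to\psi)\wedge(\psi\to\varphi)$, $\forall x\varphi:=\lnot\exists x\lnot\varphi$, $\forall X\varphi:=\lnot\exists X\lnot\varphi$, $\forall y\leq z\,\varphi := \forall y(y\leq z\to\varphi)$. Relativization: $\alpha|\theta[y]:=\alpha$, commuting with $\wedge,\lnot,\exists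 X$, and $(\exists x\varphi)|\theta[y]:=\exists x(\theta[x/y]\wedge\varphi|\theta[y])$. A formula is \emph{uniformly bounded} (by $x$) if it has the form $\chi|(y\leq x)[y]$ and $x$ is its only free individual variable. \emph{$\mathsf{MSO}$} is the classical deduction system on sequents $\vec\varphi\vdash\varphi$ with: axiom, cut, $\lnot$-introduction ($\vec\varphi,\varphi\vdash\bot$ gives $\vec\varphi\vdash\lnot\varphi$) and elimination ($\vec\varphi\vdash\varphi$ and $\vec\varphi\vdash\lnot\varphi$ give $\vec\varphi\vdash\bot$), $\wedge$-rules, $\exists$-introduction and elimination (with eigenvariable conditions) for both sorts, double negation elimination; arithmetic rules: $\doteq$ reflexive with substitution of equals; $\leq$ reflexive, transitive, antisymmetric (yielding $\doteq$); $\vdash\exists y\mathsf{Zero}(y)$; $\mathsf{Zero}(x),\mathsf{Zero}(y)$ give $x\doteq y$; $\vdash\exists y\mathsf S(x,y)$; $\mathsf S(y,x),\mathsf S(z,x)$ give $y\doteq z$; $\mathsf S(x,y),\mathsf S(x,z)$ give $y\doteq z$; $\mathsf S(x,y),\mathsf{Zero}(y)$ give $\bot$; $\mathsf S(x,y)$ gives $x\leq y$; $\mathsf S(y,y'),x\leq y',\lnot(x\doteq y')$ give $x\leq y$; comprehension (from $\vec\varphi\vdash\varphi[\chi[y]/X]$ infer $\vec\varphi\vdash\exists X\varphi$, where $\varphi[\chi[y]/X]$ replaces each atom $t\in X$ by $\chi[t/y]$); induction (from $\vec\varphi,\mathsf{Zero}(z)\vdash\varphi[z/x]$ and $\vec\varphi,\mathsf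 S(y,z),\varphi[y/x]\vdash\varphi[z/x]$ infer $\vec\varphi\vdash\varphi$, $y,z$ not free in $\vec\varphi,\varphi$). *)

theory Defs
  imports Main "HOL-Library.Nat_Bijection"
begin

text \<open>
  Formulae are represented up to renaming of bound variables by de Bruijn indices, with separate
  index spaces for individual and predicate variables: an index \<open>n\<close> below \<open>k\<close> quantifiers of its
  sort denotes the free variable \<open>n - k\<close> if \<open>n \<ge> k\<close>, and otherwise is bound by the \<open>n\<close>-th
  enclosing quantifier of that sort. \<open>Mem x X\<close> is the atom \<open>x \<in> X\<close>.
\<close>

datatype fm =
    Eq nat nat
  | Le nat nat
  | Succ nat nat
  | Zero nat
  | Mem nat nat
  | Top
  | Bot
  | And fm fm
  | Neg fm
  | ExI fm
  | ExP fm

abbreviation Imp :: "fm \<Rightarrow> fm \<Rightarrow> fm" where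
  "Imp \<phi> \<psi> \<equiv> Neg (And \<phi> (Neg \<psi>))"

abbreviation Iff :: "fm \<Rightarrow> fm \<Rightarrow> fm" where
  "Iff \<phi> \<psi> \<equiv> And (Imp \<phi> \<psi>) (Imp \<psi> \<phi>)"

abbreviation AllI :: "fm \<Rightarrow> fm" where
  "AllI \<phi> \<equiv> Neg (ExI (Neg \<phi>))"

abbreviation AllP :: "fm \<Rightarrow> fm" where
  "AllP \<phi> \<equiv> Neg (ExP (Neg \<phi>))"

primrec fvi :: "fm \<Rightarrow> nat set" where
  "fvi (Eq x y) = {x, y}"
| "fvi (Le x y) = {x, y}"
| "fvi (Succ x y) = {x, y}"
| "fvi (Zero x) = {x}"
| "fvi (Mem x X) = {x}"
| "fvi Top = {}"
| "fvi Bot = {}"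
| "fvi (And \<phi> \<psi>) = fvi \<phi> \<union> fvi \<psi>"
| "fvi (Neg \<phi>) = fvi \<phi>"
| "fvi (ExI \<phi>) = {n. Suc n \<in> fvi \<phi>}"
| "fvi (ExP \<phi>) = fvi \<phi>"

primrec fvp :: "fm \<Rightarrow> nat set" where
  "fvp (Eq x y) = {}"
| "fvp (Le x y) = {}"
| "fvp (Succ x y) = {}"
| "fvp (Zero x) = {}"
| "fvp (Mem x X) = {X}"
| "fvp Top = {}"
| "fvp Bot = {}"
| "fvp (And \<phi> \<psi>) = fvp \<phi> \<union> fvp \<psi>"
| "fvp (Neg \<phi>) = fvp \<phi>"
| "fvp (ExI \<phi>) = fvp \<phi>"
| "fvp (ExP \<phi>) = {n. Suc n \<in> fvp \<phi>}"


subsection \<open>Substitution\<close>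

definition up :: "(nat \<Rightarrow> nat) \<Rightarrow> nat \<Rightarrow> nat" where
  "up r n = (case n of 0 \<Rightarrow> 0 | Suc m \<Rightarrow> Suc (r m))"

text \<open>
  The only individual terms are variables, so substituting for individual variables is
  (simultaneous, capture-avoiding) renaming. \<open>ren r s\<close> renames free individual variables by \<open>r\<close>
  and free predicate variables by \<open>s\<close>.
\<close>

primrec ren :: "(nat \<Rightarrow> nat) \<Rightarrow> (nat \<Rightarrow> nat) \<Rightarrow> fm \<Rightarrow> fm" where
  "ren r s (Eq x y) = Eq (r x) (r y)"
| "ren r s (Le x y) = Le (r x) (r y)"
| "ren r s (Succ x y) = Succ (r x) (r y)"
| "ren r s (Zero x) = Zero (r x)"
| "ren r s (Mem x X) = Mem (r x) (s X)"
| "ren r s Top = Top"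
| "ren r s Bot = Bot"
| "ren r s (And \<phi> \<psi>) = And (ren r s \<phi>) (ren r s \<psi>)"
| "ren r s (Neg \<phi>) = Neg (ren r s \<phi>)"
| "ren r s (ExI \<phi>) = ExI (ren (up r) s \<phi>)"
| "ren r s (ExP \<phi>) = ExP (ren r (up s) \<phi>)"

definition inst :: "nat \<Rightarrow> nat \<Rightarrow> nat" where
  "inst t n = (case n of 0 \<Rightarrow> t | Suc m \<Rightarrow> m)"

text \<open>
  A formula \<open>\<chi>[y]\<close> with a distinguished individual variable \<open>y\<close> is represented with \<open>y\<close> as index
  \<open>0\<close>, every other free individual variable \<open>n\<close> being \<open>Suc n\<close>. \<open>psub \<sigma> \<phi>\<close> replaces, for all
  predicate variables \<open>X\<close> simultaneously, each atom \<open>t \<in> X\<close> by \<open>\<chi>[t/y]\<close> where \<open>\<chi>[y] = \<sigma> X\<close>.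
\<close>

primrec psub :: "(nat \<Rightarrow> fm) \<Rightarrow> fm \<Rightarrow> fm" where
  "psub \<sigma> (Eq x y) = Eq x y"
| "psub \<sigma> (Le x y) = Le x y"
| "psub \<sigma> (Succ x y) = Succ x y"
| "psub \<sigma> (Zero x) = Zero x"
| "psub \<sigma> (Mem x X) = ren (inst x) id (\<sigma> X)"
| "psub \<sigma> Top = Top"
| "psub \<sigma> Bot = Bot"
| "psub \<sigma> (And \<phi> \<psi>) = And (psub \<sigma> \<phi>) (psub \<sigma> \<psi>)"
| "psub \<sigma> (Neg \<phi>) = Neg (psub \<sigma> \<phi>)"
| "psub \<sigma> (ExI \<phi>) = ExI (psub (\<lambda>X. ren (up Suc) id (\<sigma> X)) \<phi>)"
| "psub \<sigma> (ExP \<phi>) = ExP (psub (\<lambda>X. case X of 0 \<Rightarrow> Mem 0 0 | Suc Y \<Rightarrow> ren id Suc (\<sigma> Y)) \<phi>)"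

definition comp_inst :: "fm \<Rightarrow> fm \<Rightarrow> fm" where
  "comp_inst \<chi> \<phi> = psub (\<lambda>X. case X of 0 \<Rightarrow> \<chi> | Suc Y \<Rightarrow> Mem 0 Y) \<phi>"

abbreviation shiftI :: "fm \<Rightarrow> fm" where
  "shiftI \<equiv> ren Suc id"

abbreviation shiftP :: "fm \<Rightarrow> fm" where
  "shiftP \<equiv> ren id Suc"


subsection \<open>The deduction system\<close>

text \<open>
  Eigenvariables are the index \<open>0\<close> freed by going under a quantifier; shifting the other formulae
  of the sequent expresses that the eigenvariable is not free in them.

  In \<open>Induct\<close>, \<open>\<phi>\<close> has \<open>x\<close> as index \<open>0\<close>. The second premise is in the context \<open>z = 0\<close>, \<open>y = 1\<close>,
  so that \<open>\<phi>[y/x]\<close> is \<open>ren Suc id \<phi>\<close> and \<open>\<phi>[z/x]\<close> is \<open>ren (up Suc) id \<phi>\<close>.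
\<close>

inductive deriv :: "fm list \<Rightarrow> fm \<Rightarrow> bool" (infix "\<turnstile>" 50) where
  Axiom: "\<phi> \<in> set \<Gamma> \<Longrightarrow> \<Gamma> \<turnstile> \<phi>"
| Cut: "\<Gamma> \<turnstile> \<phi> \<Longrightarrow> \<phi> # \<Gamma> \<turnstile> \<psi> \<Longrightarrow> \<Gamma> \<turnstile> \<psi>"
| TopI: "\<Gamma> \<turnstile> Top"
| NegI: "\<phi> # \<Gamma> \<turnstile> Bot \<Longrightarrow> \<Gamma> \<turnstile> Neg \<phi>"
| NegE: "\<Gamma> \<turnstile> \<phi> \<Longrightarrow> \<Gamma> \<turnstile> Neg \<phi> \<Longrightarrow> \<Gamma> \<turnstile> Bot"
| AndI: "\<Gamma> \<turnstile> \<phi> \<Longrightarrow> \<Gamma> \<turnstile> \<psi> \<Longrightarrow> \<Gamma> \<turnstile> And \<phi> \<psi>"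
| AndE1: "\<Gamma> \<turnstile> And \<phi> \<psi> \<Longrightarrow> \<Gamma> \<turnstile> \<phi>"
| AndE2: "\<Gamma> \<turnstile> And \<phi> \<psi> \<Longrightarrow> \<Gamma> \<turnstile> \<psi>"
| ExI_I: "\<Gamma> \<turnstile> ren (inst t) id \<phi> \<Longrightarrow> \<Gamma> \<turnstile> ExI \<phi>"
| ExI_E: "\<Gamma> \<turnstile> ExI \<phi> \<Longrightarrow> \<phi> # map shiftI \<Gamma> \<turnstile> shiftI \<psi> \<Longrightarrow> \<Gamma> \<turnstile> \<psi>"
| ExP_I: "\<Gamma> \<turnstile> ren id (inst Y) \<phi> \<Longrightarrow> \<Gamma> \<turnstile> ExP \<phi>"
| ExP_E: "\<Gamma> \<turnstile> ExP \<phi> \<Longrightarrow> \<phi> # map shiftP \<Gamma> \<turnstile> shiftP \<psi> \<Longrightarrow> \<Gamma> \<turnstile> \<psi>"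
| DNegE: "\<Gamma> \<turnstile> Neg (Neg \<phi>) \<Longrightarrow> \<Gamma> \<turnstile> \<phi>"
| EqRefl: "\<Gamma> \<turnstile> Eq x x"
| EqSubst: "\<Gamma> \<turnstile> ren (inst x) id \<phi> \<Longrightarrow> \<Gamma> \<turnstile> Eq x y \<Longrightarrow> \<Gamma> \<turnstile> ren (inst y) id \<phi>"
| LeRefl: "\<Gamma> \<turnstile> Le x x"
| LeTrans: "\<Gamma> \<turnstile> Le x y \<Longrightarrow> \<Gamma> \<turnstile> Le y z \<Longrightarrow> \<Gamma> \<turnstile> Le x z"
| LeAntisym: "\<Gamma> \<turnstile> Le x y \<Longrightarrow> \<Gamma> \<turnstile> Le y x \<Longrightarrow> \<Gamma> \<turnstile> Eq x y"
| ZeroEx: "\<Gamma> \<turnstile> ExI (Zero 0)"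
| ZeroUnique: "\<Gamma> \<turnstile> Zero x \<Longrightarrow> \<Gamma> \<turnstile> Zero y \<Longrightarrow> \<Gamma> \<turnstile> Eq x y"
| SuccEx: "\<Gamma> \<turnstile> ExI (Succ (Suc x) 0)"
| SuccInj: "\<Gamma> \<turnstile> Succ y x \<Longrightarrow> \<Gamma> \<turnstile> Succ z x \<Longrightarrow> \<Gamma> \<turnstile> Eq y z"
| SuccFun: "\<Gamma> \<turnstile> Succ x y \<Longrightarrow> \<Gamma> \<turnstile> Succ x z \<Longrightarrow> \<Gamma> \<turnstile> Eq y z"
| SuccZero: "\<Gamma> \<turnstile> Succ x y \<Longrightarrow> \<Gamma> \<turnstile> Zero y \<Longrightarrow> \<Gamma> \<turnstile> Bot"
| SuccLe: "\<Gamma> \<turnstile> Succ x y \<Longrightarrow> \<Gamma> \<turnstile> Le x y"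
| LeSucc: "\<Gamma> \<turnstile> Succ y y' \<Longrightarrow> \<Gamma> \<turnstile> Le x y' \<Longrightarrow> \<Gamma> \<turnstile> Neg (Eq x y') \<Longrightarrow> \<Gamma> \<turnstile> Le x y"
| Compr: "\<Gamma> \<turnstile> comp_inst \<chi> \<phi> \<Longrightarrow> \<Gamma> \<turnstile> ExP \<phi>"
| Induct: "Zero 0 # map shiftI \<Gamma> \<turnstile> \<phi> \<Longrightarrow>
    Succ 1 0 # shiftI \<phi> # map (shiftI \<circ> shiftI) \<Gamma> \<turnstile> ren (up Suc) id \<phi> \<Longrightarrow>
    \<Gamma> \<turnstile> ren (inst x) id \<phi>"

abbreviation MSO :: "fm \<Rightarrow> bool" where
  "MSO \<phi> \<equiv> [] \<turnstile> \<phi>"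


subsection \<open>Uniformly bounded formulae and the hypothesis on \<open>\<psi>\<close>\<close>

text \<open>\<open>relativize \<theta> \<phi>\<close> is \<open>\<phi>|\<theta>[y]\<close>, where \<open>\<theta>\<close> has \<open>y\<close> as index \<open>0\<close>; directly under an individual
  quantifier binding \<open>x\<close>, the instance \<open>\<theta>[x/y]\<close> is therefore \<open>\<theta>\<close> itself.\<close>

primrec relativize :: "fm \<Rightarrow> fm \<Rightarrow> fm" where
  "relativize \<theta> (Eq x y) = Eq x y"
| "relativize \<theta> (Le x y) = Le x y"
| "relativize \<theta> (Succ x y) = Succ x y"
| "relativize \<theta> (Zero x) = Zero x"
| "relativize \<theta> (Mem x X) = Mem x X"
| "relativize \<theta> Top = Top"
| "relativize \<theta> Bot = Bot"
| "relativize \<theta> (And \<phi> \<psi>) = And (relativize \<theta> \<phi>) (relativize \<theta> \<psi>)"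
| "relativize \<theta> (Neg \<phi>) = Neg (relativize \<theta> \<phi>)"
| "relativize \<theta> (ExI \<phi>) = ExI (And \<theta> (relativize (ren (up Suc) id \<theta>) \<phi>))"
| "relativize \<theta> (ExP \<phi>) = ExP (relativize (shiftP \<theta>) \<phi>)"

definition uniformly_bounded :: "nat \<Rightarrow> fm \<Rightarrow> bool" where
  "uniformly_bounded x \<phi> \<longleftrightarrow> (\<exists>\<chi>. \<phi> = relativize (Le 0 (Suc x)) \<chi>) \<and> fvi \<phi> = {x}"

definition BigAnd :: "fm list \<Rightarrow> fm" where
  "BigAnd \<phi>s = foldr And \<phi>s Top"

text \<open>
  For \<open>\<psi>(X, x)\<close> with \<open>x\<close> as individual variable \<open>0\<close> and \<open>X\<close> as predicate variables \<open>0, \<dots>, q - 1\<close>,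
  \<open>causal q \<psi>\<close> is the formula expressing that the truth of \<open>\<psi>(X, x)\<close> depends only on \<open>X\<close> up to \<open>x\<close>.
  Under the \<open>2 * q\<close> predicate quantifiers the copy \<open>Z'\<close> of \<open>X\<close> occupies the indices
  \<open>0, \<dots>, q - 1\<close> and the copy \<open>Z\<close> the indices \<open>q, \<dots>, 2 * q - 1\<close>.
\<close>

definition causal :: "nat \<Rightarrow> fm \<Rightarrow> fm" where
  "causal q \<psi> = AllI ((AllP ^^ q) ((AllP ^^ q)
     (Imp
       (BigAnd (map (\<lambda>i. AllI (Imp (Le 0 1) (Iff (Mem 0 (q + i)) (Mem 0 i)))) [0..<q]))
       (Iff (ren id (\<lambda>i. q + i) \<psi>) (ren id (\<lambda>i. i) \<psi>)))))"


subsection \<open>Effective computability\<close>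

text \<open>
  Partial recursive functions: \<open>computes f xs y\<close> means that \<open>f\<close> is defined on \<open>xs\<close> with value \<open>y\<close>.
\<close>

datatype recf =
    Const0
  | SucF
  | Proj nat
  | Comp recf "recf list"
  | PrimRec recf recf
  | Mu recf

inductive computes :: "recf \<Rightarrow> nat list \<Rightarrow> nat \<Rightarrow> bool" where
  "computes Const0 xs 0"
| "computes SucF [x] (Suc x)"
| "i < length xs \<Longrightarrow> computes (Proj i) xs (xs ! i)"
| "length ys = length gs \<Longrightarrow> (\<forall>i < length gs. computes (gs ! i) xs (ys ! i)) \<Longrightarrow>
    computes f ys y \<Longrightarrow> computes (Comp f gs) xs y"
| "computes f xs y \<Longrightarrow> computes (PrimRec f g) (0 # xs) y"
| "computes (PrimRec f g) (n # xs) y \<Longrightarrow> computes g (n # y # xs) z \<Longrightarrow>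
    computes (PrimRec f g) (Suc n # xs) z"
| "computes f (n # xs) 0 \<Longrightarrow> (\<forall>m < n. \<exists>k. computes f (m # xs) (Suc k)) \<Longrightarrow>
    computes (Mu f) xs n"

primrec code :: "fm \<Rightarrow> nat" where
  "code (Eq x y) = prod_encode (0, prod_encode (x, y))"
| "code (Le x y) = prod_encode (1, prod_encode (x, y))"
| "code (Succ x y) = prod_encode (2, prod_encode (x, y))"
| "code (Zero x) = prod_encode (3, x)"
| "code (Mem x X) = prod_encode (4, prod_encode (x, X))"
| "code Top = prod_encode (5, 0)"
| "code Bot = prod_encode (6, 0)"
| "code (And \<phi> \<psi>) = prod_encode (7, prod_encode (code \<phi>, code \<psi>))"
| "code (Neg \<phi>) = prod_encode (8, code \<phi>)"
| "code (ExI \<phi>) = prod_encode (9, code \<phi>)"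
| "code (ExP \<phi>) = prod_encode (10, code \<phi>)"

lemma code_inject: "code \<phi> = code \<psi> \<Longrightarrow> \<phi> = \<psi>"
proof (induction \<phi> arbitrary: \<psi>)
qed (case_tac \<psi>; auto simp: prod_encode_eq)+

inductive_cases computes_elims:
  "computes Const0 xs z" "computes SucF xs z" "computes (Proj i) xs z" "computes (Comp f gs) xs z"
  "computes (PrimRec f g) (0 # xs) z" "computes (PrimRec f g) (Suc n # xs) z" "computes (Mu f) xs z"

lemma computes_deterministic: "computes f xs y \<Longrightarrow> computes f xs z \<Longrightarrow> y = z"
proof (induction arbitrary: z rule: computes.induct)
  case (1 xs)
  then show ?case by (rule computes_elims(1)) simp
next
  case (2 x)
  then show ?case by (rule computes_elims(2)) simp
next
  case (3 i xs)
  from 3(2) show ?case by (rule computes_elims(3)) simp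
next
  case (4 ys gs xs f y)
  from 4(5) obtain zs where zs: "length zs = length gs"
    "\<forall>i < length gs. computes (gs ! i) xs (zs ! i)" "computes f zs z"
    by (rule computes_elims(4))
  have "ys = zs"
    using 4(1,3) zs(1,2) by (simp add: list_eq_iff_nth_eq)
  with 4(4) zs(3) show ?case by blast
next
  case (5 f xs y g)
  from 5(3) show ?case by (rule computes_elims(5)) (rule 5(2))
next
  case (6 f g n xs y z')
  from 6(5) obtain w where "computes (PrimRec f g) (n # xs) w" "computes g (n # w # xs) z"
    by (rule computes_elims(6))
  with 6(3,4) show ?case by blast
next
  case (7 f n xs)
  from 7(4) have z: "computes f (z # xs) 0" "\<forall>m < z. \<exists>k. computes f (m # xs) (Suc k)"
    by (auto elim: computes_elims(7))
  have "\<not> n < z"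
    using 7(2) z(2) by (metis nat.distinct(1))
  moreover have "\<not> z < n"
    using 7(3) z(1) by (metis nat.distinct(1))
  ultimately show ?case by simp
qed

end

theory Submission
  imports Defs "HOL-Library.Countable_Set"
begin

text \<open>
  A sentence \<open>\<psi>\<close> is causal, and a bounded formula is decided by \<open>MSO\<close> at \<open>x = 0\<close>; hence the theorem
  contains both the completeness of \<open>MSO\<close> and the decidability of its theory. By Henkin's theorem
  it suffices to argue in models whose predicate variables range over a family of internal sets
  satisfying comprehension and induction.

  To a formula \<open>\<phi>\<close> and a segment of a model one assigns the type of the segment, an element of a finite
  semigroup built by recursion on \<open>\<phi>\<close>: a set quantifier corresponds to the power semigroup. Types are
  additive under concatenation and definable by formulae bounded by the end of the segment.
  Ramsey's theorem, proved internally, cuts the model into a prefix of type \<open>s\<close> and infinitely many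
  segments of the same idempotent type \<open>e\<close>, and the pair \<open>(s, e)\<close> determines the truth value of \<open>\<phi>\<close>.
  For a sentence \<open>s\<close> and \<open>e\<close> are powers of the type of a single letter, so that all Henkin models
  agree with the standard one.

  If \<open>\<psi>(X, x)\<close> is causal, one may empty \<open>X\<close> beyond \<open>x\<close>; the truth value of \<open>\<psi>\<close> is then a function of
  the type of the segment \<open>[0, x]\<close>, which is bounded-definable. The bounded formula is found by a
  search, the correctness of a candidate being certified by a finite table of values of types.
\<close>

subsection \<open>Renaming and environments\<close>

text \<open>The function that finds the bounded formula receives only \<open>code \<psi>\<close>,
  not \<open>q\<close>. Every bound must therefore be recovered from \<psi>: a candidate may use set
  variables only up to one that is free in \<psi>, and equivalence is tested under
  \<open>code \<psi>\<close> set quantifiers. Types are plain numbers, and \<open>mul\<close>,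
  \<open>hval\<close> and \<open>acc\<close> mention no model; this is what allows a value to be
  compared between a Henkin model and the standard one and to be certified by a table. The main
  obstacle is that a Henkin model may have nonstandard elements: inductions, recursions, homogeneous
  sets and choices of sets must all be internal, which is why definability of types with parameters
  precedes Ramsey's theorem. Causality is read off in the standard model by soundness; the
  equivalence is proved there, and becomes derivable because all Henkin models agree on sentences.
  Finally, uniform boundedness asks that x really be free, so every candidate is a conjunction whose
  first member is x = x.\<close>

definition scons :: "'a \<Rightarrow> (nat \<Rightarrow> 'a) \<Rightarrow> nat \<Rightarrow> 'a" (infixr "##" 65) where
  "(x ## e) n = (case n of 0 \<Rightarrow> x | Suc m \<Rightarrow> e m)"

lemma scons_simps [simp]: "(x ## e) 0 = x" "(x ## e) (Suc n) = e n"
  by (simp_all add: scons_def)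

lemma scons_tail [simp]: "(\<lambda>n. (x ## e) (Suc n)) = e"
  by simp

lemma scons_eta: "e 0 ## (\<lambda>n. e (Suc n)) = e"
  by (rule ext) (simp add: scons_def split: nat.split)

lemma scons_comp: "(\<lambda>n. f ((x ## e) n)) = f x ## (\<lambda>n. f (e n))"
  by (rule ext) (simp add: scons_def split: nat.split)

lemma range_scons: "range (x ## e) \<subseteq> A \<longleftrightarrow> x \<in> A \<and> range e \<subseteq> A"
  by (auto simp: scons_def image_subset_iff split: nat.split)

lemma up_simps [simp]: "up r 0 = 0" "up r (Suc n) = Suc (r n)"
  by (simp_all add: up_def)

lemma inst_simps [simp]: "inst t 0 = t" "inst t (Suc n) = n"
  by (simp_all add: inst_def)

lemma up_id [simp]: "up id = id" "up (\<lambda>n. n) = (\<lambda>n. n)"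
  by (auto simp: up_def fun_eq_iff split: nat.split)

lemma up_comp: "up r \<circ> up s = up (r \<circ> s)"
  by (auto simp: up_def fun_eq_iff split: nat.split)

lemma scons_up: "(x ## e) \<circ> up r = x ## (e \<circ> r)"
  by (auto simp: up_def scons_def fun_eq_iff split: nat.split)

lemma scons_inst: "e \<circ> inst t = e t ## e"
  by (auto simp: inst_def scons_def fun_eq_iff split: nat.split)

lemma inst_up: "inst t \<circ> up r = t ## r"
  by (auto simp: inst_def up_def scons_def fun_eq_iff split: nat.split)

lemma ren_ren: "ren r s (ren r' s' \<phi>) = ren (r \<circ> r') (s \<circ> s') \<phi>"
  by (induction \<phi> arbitrary: r s r' s') (simp_all add: up_comp)

lemma ren_id [simp]: "ren id id \<phi> = \<phi>"
  by (induction \<phi>) simp_all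

lemma ren_cong:
  assumes "\<And>n. n \<in> fvi \<phi> \<Longrightarrow> r n = r' n" "\<And>n. n \<in> fvp \<phi> \<Longrightarrow> s n = s' n"
  shows "ren r s \<phi> = ren r' s' \<phi>"
  using assms
proof (induction \<phi> arbitrary: r r' s s')
  case (ExI \<phi>)
  have "ren (up r) s \<phi> = ren (up r') s' \<phi>"
    by (rule ExI.IH) (use ExI.prems in \<open>auto simp: up_def split: nat.split\<close>)
  then show ?case by simp
next
  case (ExP \<phi>)
  have "ren r (up s) \<phi> = ren r' (up s') \<phi>"
    by (rule ExP.IH) (use ExP.prems in \<open>auto simp: up_def split: nat.split\<close>)
  then show ?case by simp
next
  case (And \<phi> \<psi>)
  then have "ren r s \<phi> = ren r' s' \<phi>" "ren r s \<psi> = ren r' s' \<psi>"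
    by (metis UnCI fvi.simps(8) fvp.simps(8))+
  then show ?case by simp
next
  case (Neg \<phi>)
  then have "ren r s \<phi> = ren r' s' \<phi>"
    by (metis fvi.simps(9) fvp.simps(9))
  then show ?case by simp
qed simp_all

lemma finite_Suc_vimage: "finite A \<Longrightarrow> finite {n. Suc n \<in> A}"
  using finite_vimageI[of A Suc] by (simp add: vimage_def)

lemma finite_fvi: "finite (fvi \<phi>)"
  by (induction \<phi>) (simp_all add: finite_Suc_vimage)

lemma finite_fvp: "finite (fvp \<phi>)"
  by (induction \<phi>) (simp_all add: finite_Suc_vimage)


subsection \<open>Henkin models\<close>

text \<open>\<open>Succ\<close> and \<open>Zero\<close> are interpreted by a total function and a
  constant, as the rules \<open>SuccEx\<close>, \<open>SuccFun\<close>, \<open>ZeroEx\<close> and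
  \<open>ZeroUnique\<close> justify. Individuals range over the whole type, sets only over
  \<open>P\<close>.\<close>

locale mstruct =
  fixes le :: "'d \<Rightarrow> 'd \<Rightarrow> bool" (infix "\<sqsubseteq>" 50)
    and zero :: 'd
    and suc :: "'d \<Rightarrow> 'd"
    and P :: "'d set set"
begin

primrec sat :: "(nat \<Rightarrow> 'd) \<Rightarrow> (nat \<Rightarrow> 'd set) \<Rightarrow> fm \<Rightarrow> bool" where
  "sat ei ep (Eq x y) \<longleftrightarrow> ei x = ei y"
| "sat ei ep (Le x y) \<longleftrightarrow> ei x \<sqsubseteq> ei y"
| "sat ei ep (Succ x y) \<longleftrightarrow> ei y = suc (ei x)"
| "sat ei ep (Zero x) \<longleftrightarrow> ei x = zero"
| "sat ei ep (Mem x X) \<longleftrightarrow> ei x \<in> ep X"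
| "sat ei ep Top \<longleftrightarrow> True"
| "sat ei ep Bot \<longleftrightarrow> False"
| "sat ei ep (And \<phi> \<psi>) \<longleftrightarrow> sat ei ep \<phi> \<and> sat ei ep \<psi>"
| "sat ei ep (Neg \<phi>) \<longleftrightarrow> \<not> sat ei ep \<phi>"
| "sat ei ep (ExI \<phi>) \<longleftrightarrow> (\<exists>x. sat (x ## ei) ep \<phi>)"
| "sat ei ep (ExP \<phi>) \<longleftrightarrow> (\<exists>Y\<in>P. sat ei (Y ## ep) \<phi>)"

lemma sat_ren: "sat ei ep (ren r s \<phi>) \<longleftrightarrow> sat (ei \<circ> r) (ep \<circ> s) \<phi>"
  by (induction \<phi> arbitrary: ei ep r s) (simp_all add: scons_up)

lemma sat_cong:
  assumes "\<And>n. n \<in> fvi \<phi> \<Longrightarrow> ei n = ei' n" "\<And>n. n \<in> fvp \<phi> \<Longrightarrow> ep n = ep' n"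
  shows "sat ei ep \<phi> \<longleftrightarrow> sat ei' ep' \<phi>"
  using assms
proof (induction \<phi> arbitrary: ei ei' ep ep')
  case (ExI \<phi>)
  have "sat (x ## ei) ep \<phi> = sat (x ## ei') ep' \<phi>" for x
    by (rule ExI.IH) (use ExI.prems in \<open>auto simp: scons_def split: nat.split\<close>)
  then show ?case by simp
next
  case (ExP \<phi>)
  have "sat ei (x ## ep) \<phi> = sat ei' (x ## ep') \<phi>" for x
    by (rule ExP.IH) (use ExP.prems in \<open>auto simp: scons_def split: nat.split\<close>)
  then show ?case by simp
next
  case (And \<phi> \<psi>)
  have "sat ei ep \<phi> = sat ei' ep' \<phi>" by (rule And.IH(1)) (use And.prems in auto)
  moreover have "sat ei ep \<psi> = sat ei' ep' \<psi>" by (rule And.IH(2)) (use And.prems in auto)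
  ultimately show ?case by simp
next
  case (Neg \<phi>)
  have "sat ei ep \<phi> = sat ei' ep' \<phi>" by (rule Neg.IH(1)) (use Neg.prems in auto)
  then show ?case by simp
qed simp_all

end

text \<open>Comprehension admits arbitrary parameters, but induction is granted only for members of
  \<open>P\<close>, so nonstandard elements are possible. Every induction in such a model must be
  over a definable set.\<close>

locale henkin = mstruct +
  assumes internal_nonempty: "P \<noteq> {}"
    and le_refl: "x \<sqsubseteq> x"
    and le_trans: "x \<sqsubseteq> y \<Longrightarrow> y \<sqsubseteq> z \<Longrightarrow> x \<sqsubseteq> z"
    and le_antisym: "x \<sqsubseteq> y \<Longrightarrow> y \<sqsubseteq> x \<Longrightarrow> x = y"
    and suc_inject: "suc x = suc y \<Longrightarrow> x = y"
    and suc_not_zero: "suc x \<noteq> zero"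
    and le_suc: "x \<sqsubseteq> suc x"
    and le_suc_cases: "x \<sqsubseteq> suc y \<Longrightarrow> x \<noteq> suc y \<Longrightarrow> x \<sqsubseteq> y"
    and comprehension: "range ep \<subseteq> P \<Longrightarrow> {d. sat (d ## ei) ep \<phi>} \<in> P"
    and internal_induct: "A \<in> P \<Longrightarrow> zero \<in> A \<Longrightarrow> (\<And>x. x \<in> A \<Longrightarrow> suc x \<in> A) \<Longrightarrow> A = UNIV"


subsection \<open>Types of words\<close>

abbreviation pe :: "nat \<Rightarrow> nat \<Rightarrow> nat" where
  "pe a b \<equiv> prod_encode (a, b)"

abbreviation pfst :: "nat \<Rightarrow> nat" where
  "pfst a \<equiv> fst (prod_decode a)"

abbreviation psnd :: "nat \<Rightarrow> nat" where
  "psnd a \<equiv> snd (prod_decode a)"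

lemma pe_eq_iff: "pe a b = s \<longleftrightarrow> a = pfst s \<and> b = psnd s"
  by (metis fst_conv snd_conv prod.collapse prod_decode_inverse prod_encode_inverse)

lemma set_encode_eq_iff: "finite A \<Longrightarrow> set_encode A = s \<longleftrightarrow> A = set_decode s"
  by (metis finite_set_decode set_decode_inverse set_encode_inverse)

text \<open>
  Types are coded by numbers, sets of types by \<open>set_encode\<close>; \<open>mul \<phi>\<close> is the type of a concatenation,
  \<open>hval \<phi> i j\<close> that of a single position carrying the individual variables in \<open>set_decode i\<close> and the
  predicate variables in \<open>set_decode j\<close>. The type for \<open>Le x y\<close> is \<open>1\<close> or \<open>2\<close> according to whether \<open>x\<close> or
  \<open>y\<close> occurs first, and \<open>0\<close> if neither occurs. The type for \<open>Succ x y\<close> records whether \<open>y\<close> is at the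
  first position, whether \<open>x\<close> is at the last one, and whether \<open>y\<close> has been seen right after \<open>x\<close>.
  For \<open>ExI \<phi>\<close> it is the type for \<open>\<phi>\<close> with the quantified variable absent, paired with the set of types
  for \<open>\<phi>\<close> with that variable placed in the segment.
\<close>

primrec mul :: "fm \<Rightarrow> nat \<Rightarrow> nat \<Rightarrow> nat" where
  "mul (Eq x y) a b = max a b"
| "mul (Le x y) a b = (if a = 0 then b else a)"
| "mul (Succ x y) a b = pe (pfst a) (pe (pfst (psnd b))
     (max (max (psnd (psnd a)) (psnd (psnd b))) (pfst (psnd a) * pfst b)))"
| "mul (Zero x) a b = a"
| "mul (Mem x X) a b = max a b"
| "mul Top a b = 0"
| "mul Bot a b = 0"
| "mul (And \<phi> \<psi>) a b = pe (mul \<phi> (pfst a) (pfst b)) (mul \<psi> (psnd a) (psnd b))"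
| "mul (Neg \<phi>) a b = mul \<phi> a b"
| "mul (ExI \<phi>) a b = pe (mul \<phi> (pfst a) (pfst b))
     (set_encode ((\<lambda>c. mul \<phi> c (pfst b)) ` set_decode (psnd a) \<union>
                  (\<lambda>c. mul \<phi> (pfst a) c) ` set_decode (psnd b)))"
| "mul (ExP \<phi>) a b = set_encode ((\<lambda>(c, d). mul \<phi> c d) ` (set_decode a \<times> set_decode b))"

primrec hval :: "fm \<Rightarrow> nat \<Rightarrow> nat \<Rightarrow> nat" where
  "hval (Eq x y) i j = of_bool (x \<in> set_decode i \<and> y \<in> set_decode i)"
| "hval (Le x y) i j = (if x \<in> set_decode i then 1 else if y \<in> set_decode i then 2 else 0)"
| "hval (Succ x y) i j = pe (of_bool (y \<in> set_decode i)) (pe (of_bool (x \<in> set_decode i)) 0)"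
| "hval (Zero x) i j = of_bool (x \<in> set_decode i)"
| "hval (Mem x X) i j = of_bool (x \<in> set_decode i \<and> X \<in> set_decode j)"
| "hval Top i j = 0"
| "hval Bot i j = 0"
| "hval (And \<phi> \<psi>) i j = pe (hval \<phi> i j) (hval \<psi> i j)"
| "hval (Neg \<phi>) i j = hval \<phi> i j"
| "hval (ExI \<phi>) i j = pe (hval \<phi> (2 * i) j) (set_encode {hval \<phi> (2 * i + 1) j})"
| "hval (ExP \<phi>) i j = set_encode {hval \<phi> i (2 * j), hval \<phi> i (2 * j + 1)}"

text \<open>\<open>acc \<phi> s e\<close> is the truth value of \<open>\<phi>\<close> on a word that splits into a prefix of type \<open>s\<close> and infinitely
  many segments of type \<open>e\<close>. A quantified individual can be placed in the prefix, by
  lengthening it.\<close>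

primrec acc :: "fm \<Rightarrow> nat \<Rightarrow> nat \<Rightarrow> bool" where
  "acc (Eq x y) s e \<longleftrightarrow> s = 1"
| "acc (Le x y) s e \<longleftrightarrow> s = 1"
| "acc (Succ x y) s e \<longleftrightarrow> psnd (psnd s) = 1"
| "acc (Zero x) s e \<longleftrightarrow> s = 1"
| "acc (Mem x X) s e \<longleftrightarrow> s = 1"
| "acc Top s e \<longleftrightarrow> True"
| "acc Bot s e \<longleftrightarrow> False"
| "acc (And \<phi> \<psi>) s e \<longleftrightarrow> acc \<phi> (pfst s) (pfst e) \<and> acc \<psi> (psnd s) (psnd e)"
| "acc (Neg \<phi>) s e \<longleftrightarrow> \<not> acc \<phi> s e"
| "acc (ExI \<phi>) s e \<longleftrightarrow> (\<exists>a\<in>set_decode (psnd s). acc \<phi> (mul \<phi> a (pfst e)) (pfst e))"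
| "acc (ExP \<phi>) s e \<longleftrightarrow>
     (\<exists>a\<in>set_decode s. \<exists>f\<in>set_decode e. mul \<phi> a f = a \<and> mul \<phi> f f = f \<and> acc \<phi> a f)"

text \<open>The type of a word of \<open>k + 1\<close> positions that carry no variable. Words are
  nonempty, so exponent 0 is the single letter.\<close>

primrec hpow :: "fm \<Rightarrow> nat \<Rightarrow> nat" where
  "hpow \<phi> 0 = hval \<phi> 0 0"
| "hpow \<phi> (Suc k) = mul \<phi> (hpow \<phi> k) (hval \<phi> 0 0)"


subsection \<open>Bounded formulae\<close>

text \<open>An inductive description of relativized formulae. Index \<open>k\<close> is the bounding
  variable seen from below \<open>k\<close> individual quantifiers, so smaller indices are bound and
  \<open>bnd 0 m\<close> leaves only individual variable 0 free. \<open>Le 0 (Suc k)\<close>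
  compares the new variable with the same bound after the shift.\<close>

inductive bnd :: "nat \<Rightarrow> nat \<Rightarrow> fm \<Rightarrow> bool" where
  bnd_Eq: "x \<le> k \<Longrightarrow> y \<le> k \<Longrightarrow> bnd k m (Eq x y)"
| bnd_Le: "x \<le> k \<Longrightarrow> y \<le> k \<Longrightarrow> bnd k m (Le x y)"
| bnd_Succ: "x \<le> k \<Longrightarrow> y \<le> k \<Longrightarrow> bnd k m (Succ x y)"
| bnd_Zero: "x \<le> k \<Longrightarrow> bnd k m (Zero x)"
| bnd_Mem: "x \<le> k \<Longrightarrow> X < m \<Longrightarrow> bnd k m (Mem x X)"
| bnd_Top: "bnd k m Top"
| bnd_Bot: "bnd k m Bot"
| bnd_And: "bnd k m \<phi> \<Longrightarrow> bnd k m \<psi> \<Longrightarrow> bnd k m (And \<phi> \<psi>)"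
| bnd_Neg: "bnd k m \<phi> \<Longrightarrow> bnd k m (Neg \<phi>)"
| bnd_ExI: "bnd (Suc k) m \<phi> \<Longrightarrow> bnd k m (ExI (And (Le 0 (Suc k)) \<phi>))"
| bnd_ExP: "bnd k (Suc m) \<phi> \<Longrightarrow> bnd k m (ExP \<phi>)"

lemma bnd_imp_relativize: "bnd k m \<phi> \<Longrightarrow> \<exists>\<chi>. \<phi> = relativize (Le 0 (Suc k)) \<chi>"
proof (induction rule: bnd.induct)
  case (bnd_Eq x k y m)
  show ?case by (rule exI[of _ "Eq x y"]) simp
next
  case (bnd_Le x k y m)
  show ?case by (rule exI[of _ "Le x y"]) simp
next
  case (bnd_Succ x k y m)
  show ?case by (rule exI[of _ "Succ x y"]) simp
next
  case (bnd_Zero x k m)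
  show ?case by (rule exI[of _ "Zero x"]) simp
next
  case (bnd_Mem x k X m)
  show ?case by (rule exI[of _ "Mem x X"]) simp
next
  case (bnd_Top k m)
  show ?case by (rule exI[of _ Top]) simp
next
  case (bnd_Bot k m)
  show ?case by (rule exI[of _ Bot]) simp
next
  case (bnd_And k m \<phi> \<psi>)
  then show ?case by (metis relativize.simps(8))
next
  case (bnd_Neg k m \<phi>)
  then show ?case by (metis relativize.simps(9))
next
  case (bnd_ExI k m \<phi>)
  then obtain \<chi> where "\<phi> = relativize (Le 0 (Suc (Suc k))) \<chi>" by blast
  then show ?case by (intro exI[of _ "ExI \<chi>"]) simp
next
  case (bnd_ExP k m \<phi>)
  then obtain \<chi> where "\<phi> = relativize (Le 0 (Suc k)) \<chi>" by blast
  then show ?case by (intro exI[of _ "ExP \<chi>"]) simp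
qed

lemma bnd_imp_fv: "bnd k m \<phi> \<Longrightarrow> fvi \<phi> \<subseteq> {..k} \<and> fvp \<phi> \<subseteq> {..<m}"
  by (induction rule: bnd.induct) auto

subsection \<open>Structural properties of derivations\<close>

lemma up_fun_comps: "up r \<circ> Suc = Suc \<circ> r" "inst (r t) \<circ> up r = r \<circ> inst t"
    "up (up r) \<circ> up Suc = up Suc \<circ> up r" "up r \<circ> (Suc \<circ> Suc) = Suc \<circ> (r \<circ> Suc)"
  by (auto simp: up_def inst_def fun_eq_iff split: nat.split)

text \<open>The renaming \<open>s'\<close> of the replaced variables is kept apart from the renaming
  \<open>s\<close> of the substituted formulae, because comprehension replaces variable 0, which
  only \<open>s' = up s\<close> sees. The hypothesis reproduces itself under each
  quantifier.\<close>

lemma ren_psub: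
  assumes "\<And>X. \<sigma>' (s' X) = ren (up r) s (\<sigma> X)"
  shows "ren r s (psub \<sigma> \<phi>) = psub \<sigma>' (ren r s' \<phi>)"
  using assms
proof (induction \<phi> arbitrary: \<sigma> \<sigma>' r s s')
  case (Mem x X)
  then show ?case by (simp add: ren_ren up_fun_comps)
next
  case (ExI \<phi>)
  have "ren (up r) s (psub (\<lambda>X. ren (up Suc) id (\<sigma> X)) \<phi>)
      = psub (\<lambda>X. ren (up Suc) id (\<sigma>' X)) (ren (up r) s' \<phi>)"
    by (rule ExI.IH) (simp add: ExI.prems ren_ren up_fun_comps)
  then show ?case by simp
next
  case (ExP \<phi>)
  have "ren r (up s) (psub (\<lambda>X. case X of 0 \<Rightarrow> Mem 0 0 | Suc Y \<Rightarrow> shiftP (\<sigma> Y)) \<phi>)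
      = psub (\<lambda>X. case X of 0 \<Rightarrow> Mem 0 0 | Suc Y \<Rightarrow> shiftP (\<sigma>' Y)) (ren r (up s') \<phi>)"
    by (rule ExP.IH) (simp add: ExP.prems ren_ren up_fun_comps split: nat.split)
  then show ?case by simp
next
  case (And \<phi> \<psi>)
  show ?case using And.IH(1)[of \<sigma>' s' r s \<sigma>] And.IH(2)[of \<sigma>' s' r s \<sigma>] And.prems by simp
next
  case (Neg \<phi>)
  show ?case using Neg.IH[of \<sigma>' s' r s \<sigma>] Neg.prems by simp
qed simp_all

lemma ren_comp_inst: "ren r s (comp_inst \<chi> \<phi>) = comp_inst (ren (up r) s \<chi>) (ren r (up s) \<phi>)"
  unfolding comp_inst_def by (rule ren_psub) (simp add: up_def split: nat.split)

lemma psub_ren: "psub \<sigma> (ren id s \<phi>) = psub (\<lambda>X. \<sigma> (s X)) \<phi>"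
proof (induction \<phi> arbitrary: \<sigma> s)
  case (ExP \<phi>)
  have eq: "(\<lambda>X. case up s X of 0 \<Rightarrow> Mem 0 0 | Suc Y \<Rightarrow> shiftP (\<sigma> Y))
      = (\<lambda>X. case X of 0 \<Rightarrow> Mem 0 0 | Suc Y \<Rightarrow> shiftP (\<sigma> (s Y)))"
    by (rule ext) (simp add: up_def split: nat.split)
  show ?case by (simp only: ren.simps psub.simps ExP.IH eq)
qed simp_all

lemma psub_Mem: "psub (Mem 0) \<phi> = \<phi>"
proof (induction \<phi>)
  case (ExP \<phi>)
  have "(\<lambda>X. case X of 0 \<Rightarrow> Mem 0 0 | Suc Y \<Rightarrow> shiftP (Mem 0 Y)) = Mem 0"
    by (rule ext) (simp split: nat.split)
  with ExP show ?case by simp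
qed simp_all

lemma deriv_mono: "\<Gamma> \<turnstile> \<phi> \<Longrightarrow> set \<Gamma> \<subseteq> set \<Delta> \<Longrightarrow> \<Delta> \<turnstile> \<phi>"
proof (induction arbitrary: \<Delta> rule: deriv.induct)
  case (Cut \<Gamma> \<phi> \<psi>)
  have "set (\<phi> # \<Gamma>) \<subseteq> set (\<phi> # \<Delta>)" using Cut.prems by auto
  with Cut show ?case by (meson deriv.Cut)
next
  case (NegI \<phi> \<Gamma>)
  have "set (\<phi> # \<Gamma>) \<subseteq> set (\<phi> # \<Delta>)" using NegI.prems by auto
  with NegI show ?case by (meson deriv.NegI)
next
  case (ExI_E \<Gamma> \<phi> \<psi>)
  have "set (\<phi> # map shiftI \<Gamma>) \<subseteq> set (\<phi> # map shiftI \<Delta>)" using ExI_E.prems by auto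
  with ExI_E show ?case by (meson deriv.ExI_E)
next
  case (ExP_E \<Gamma> \<phi> \<psi>)
  have "set (\<phi> # map shiftP \<Gamma>) \<subseteq> set (\<phi> # map shiftP \<Delta>)" using ExP_E.prems by auto
  with ExP_E show ?case by (meson deriv.ExP_E)
next
  case (Induct \<Gamma> \<phi> x)
  have "set (Zero 0 # map shiftI \<Gamma>) \<subseteq> set (Zero 0 # map shiftI \<Delta>)"
    "set (Succ 1 0 # shiftI \<phi> # map (shiftI \<circ> shiftI) \<Gamma>) \<subseteq> set (Succ 1 0 # shiftI \<phi> # map (shiftI \<circ> shiftI) \<Delta>)"
    using Induct.prems by auto
  with Induct show ?case by (meson deriv.Induct)
next
  case NegE
  then show ?case by (meson deriv.NegE)
next
  case AndI
  then show ?case by (meson deriv.AndI)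
next
  case AndE1
  then show ?case by (meson deriv.AndE1)
next
  case AndE2
  then show ?case by (meson deriv.AndE2)
next
  case ExI_I
  then show ?case by (meson deriv.ExI_I)
next
  case ExP_I
  then show ?case by (meson deriv.ExP_I)
next
  case DNegE
  then show ?case by (meson deriv.DNegE)
next
  case EqSubst
  then show ?case by (meson deriv.EqSubst)
next
  case LeTrans
  then show ?case by (meson deriv.LeTrans)
next
  case LeAntisym
  then show ?case by (meson deriv.LeAntisym)
next
  case ZeroUnique
  then show ?case by (meson deriv.ZeroUnique)
next
  case SuccInj
  then show ?case by (meson deriv.SuccInj)
next
  case SuccFun
  then show ?case by (meson deriv.SuccFun)
next
  case SuccZero
  then show ?case by (meson deriv.SuccZero)
next
  case SuccLe
  then show ?case by (meson deriv.SuccLe)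
next
  case LeSucc
  then show ?case by (meson deriv.LeSucc)
next
  case Compr
  then show ?case by (meson deriv.Compr)
qed (auto intro: deriv.Axiom deriv.TopI deriv.EqRefl deriv.LeRefl deriv.ZeroEx deriv.SuccEx)

text \<open>Holds for non-injective renamings too: eigenvariables are indices freed under a
  quantifier, and \<open>up\<close> keeps them apart from the renamed parameters. It later turns a
  fresh variable back into an eigenvariable.\<close>

lemma deriv_ren: "\<Gamma> \<turnstile> \<phi> \<Longrightarrow> map (ren r s) \<Gamma> \<turnstile> ren r s \<phi>"
proof (induction arbitrary: r s rule: deriv.induct)
  case (Cut \<Gamma> \<phi> \<psi>)
  from Cut.IH(1)[of r s] Cut.IH(2)[of r s, simplified list.map] show ?case by (rule deriv.Cut)
next
  case (NegI \<phi> \<Gamma>)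
  from NegI.IH[of r s, simplified list.map ren.simps] show ?case
    unfolding ren.simps by (rule deriv.NegI)
next
  case (NegE \<Gamma> \<phi>)
  from NegE.IH(1)[of r s] NegE.IH(2)[of r s, simplified ren.simps] show ?case
    unfolding ren.simps by (rule deriv.NegE)
next
  case (ExI_I \<Gamma> t \<phi>)
  have "ren r s (ren (inst t) id \<phi>) = ren (inst (r t)) id (ren (up r) s \<phi>)"
    by (simp add: ren_ren up_fun_comps)
  with ExI_I.IH[of r s] show ?case by (auto intro: deriv.ExI_I)
next
  case (ExI_E \<Gamma> \<phi> \<psi>)
  have "map (ren (up r) s) (map shiftI \<Gamma>) = map shiftI (map (ren r s) \<Gamma>)"
    "ren (up r) s (shiftI \<psi>) = shiftI (ren r s \<psi>)"
    by (simp_all add: ren_ren up_fun_comps)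
  with ExI_E.IH(2)[of "up r" s]
  have "ren (up r) s \<phi> # map shiftI (map (ren r s) \<Gamma>) \<turnstile> shiftI (ren r s \<psi>)" by (simp only: list.map)
  with ExI_E.IH(1)[of r s] show ?case by (simp only: ren.simps) (rule deriv.ExI_E)
next
  case (ExP_I \<Gamma> Y \<phi>)
  have "ren r s (ren id (inst Y) \<phi>) = ren id (inst (s Y)) (ren r (up s) \<phi>)"
    by (simp add: ren_ren up_fun_comps)
  with ExP_I.IH[of r s] show ?case by (auto intro: deriv.ExP_I)
next
  case (ExP_E \<Gamma> \<phi> \<psi>)
  have "map (ren r (up s)) (map shiftP \<Gamma>) = map shiftP (map (ren r s) \<Gamma>)"
    "ren r (up s) (shiftP \<psi>) = shiftP (ren r s \<psi>)"
    by (simp_all add: ren_ren up_fun_comps)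
  with ExP_E.IH(2)[of r "up s"]
  have "ren r (up s) \<phi> # map shiftP (map (ren r s) \<Gamma>) \<turnstile> shiftP (ren r s \<psi>)" by (simp only: list.map)
  with ExP_E.IH(1)[of r s] show ?case by (simp only: ren.simps) (rule deriv.ExP_E)
next
  case (DNegE \<Gamma> \<phi>)
  from DNegE.IH[of r s, simplified ren.simps] show ?case by (rule deriv.DNegE)
next
  case (EqSubst \<Gamma> x \<phi> y)
  have "ren r s (ren (inst t) id \<phi>) = ren (inst (r t)) id (ren (up r) s \<phi>)" for t
    by (simp add: ren_ren up_fun_comps)
  with EqSubst.IH(1)[of r s] EqSubst.IH(2)[of r s] show ?case
    by (metis deriv.EqSubst ren.simps(1))
next
  case (Compr \<Gamma> \<chi> \<phi>)
  from Compr.IH[of r s] show ?case by (auto simp: ren_comp_inst intro: deriv.Compr)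
next
  case (Induct \<Gamma> \<phi> x)
  have eqs: "map (ren (up r) s) (map shiftI \<Gamma>) = map shiftI (map (ren r s) \<Gamma>)"
    "map (ren (up (up r)) s) (map (shiftI \<circ> shiftI) \<Gamma>) = map (shiftI \<circ> shiftI) (map (ren r s) \<Gamma>)"
    "ren (up (up r)) s (shiftI \<phi>) = shiftI (ren (up r) s \<phi>)"
    "ren (up (up r)) s (ren (up Suc) id \<phi>) = ren (up Suc) id (ren (up r) s \<phi>)"
    "ren r s (ren (inst x) id \<phi>) = ren (inst (r x)) id (ren (up r) s \<phi>)"
    by (simp_all add: ren_ren up_fun_comps comp_assoc)
  have "Zero 0 # map shiftI (map (ren r s) \<Gamma>) \<turnstile> ren (up r) s \<phi>"
    using Induct.IH(1)[of "up r" s] unfolding list.map eqs(1) by simp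
  moreover have "Succ 1 0 # shiftI (ren (up r) s \<phi>) # map (shiftI \<circ> shiftI) (map (ren r s) \<Gamma>)
      \<turnstile> ren (up Suc) id (ren (up r) s \<phi>)"
    using Induct.IH(2)[of "up (up r)" s] unfolding list.map eqs(2-4) by simp
  ultimately show ?case unfolding eqs(5) by (rule deriv.Induct)
next
  case (SuccEx \<Gamma> x)
  show ?case using deriv.SuccEx[of _ "r x"] by simp
next
  case (AndE1 \<Gamma> \<phi> \<psi>)
  from AndE1.IH[of r s, simplified ren.simps] show ?case by (rule deriv.AndE1)
next
  case (AndE2 \<Gamma> \<phi> \<psi>)
  from AndE2.IH[of r s, simplified ren.simps] show ?case by (rule deriv.AndE2)
next
  case (LeSucc \<Gamma> y y' x)
  from LeSucc.IH(1-3)[of r s, simplified ren.simps] show ?case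
    unfolding ren.simps by (rule deriv.LeSucc)
next
  case (Axiom \<phi> \<Gamma>)
  then show ?case by (auto intro: deriv.Axiom)
next
  case (SuccZero \<Gamma> x y)
  from SuccZero.IH(1,2)[of r s, simplified ren.simps] show ?case
    unfolding ren.simps by (rule deriv.SuccZero)
next
  case (SuccInj \<Gamma> y x z)
  from SuccInj.IH(1,2)[of r s, simplified ren.simps] show ?case
    unfolding ren.simps by (rule deriv.SuccInj)
next
  case (SuccFun \<Gamma> x y z)
  from SuccFun.IH(1,2)[of r s, simplified ren.simps] show ?case
    unfolding ren.simps by (rule deriv.SuccFun)
next
  case (LeTrans \<Gamma> x y z)
  from LeTrans.IH(1,2)[of r s, simplified ren.simps] show ?case
    unfolding ren.simps by (rule deriv.LeTrans)
next
  case (ZeroUnique \<Gamma> x y)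
  from ZeroUnique.IH(1,2)[of r s, simplified ren.simps] show ?case
    unfolding ren.simps by (rule deriv.ZeroUnique)
next
  case (LeAntisym \<Gamma> x y)
  from LeAntisym.IH(1,2)[of r s, simplified ren.simps] show ?case
    unfolding ren.simps by (rule deriv.LeAntisym)
next
  case (SuccLe \<Gamma> x y)
  from SuccLe.IH[of r s, simplified ren.simps] show ?case
    unfolding ren.simps by (rule deriv.SuccLe)
qed (auto intro: deriv.TopI deriv.AndI deriv.EqRefl deriv.LeRefl deriv.ZeroEx)

section \<open>Derived rules for the Henkin construction\<close>

lemma deriv_AllI_inst: "\<Gamma> \<turnstile> AllI \<phi> \<Longrightarrow> \<Gamma> \<turnstile> ren (inst t) id \<phi>"
proof (rule DNegE, rule NegI)
  assume "\<Gamma> \<turnstile> AllI \<phi>"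
  then have 1: "Neg (ren (inst t) id \<phi>) # \<Gamma> \<turnstile> AllI \<phi>" by (rule deriv_mono) auto
  have "Neg (ren (inst t) id \<phi>) # \<Gamma> \<turnstile> ren (inst t) id (Neg \<phi>)" by (auto intro: Axiom)
  then have "Neg (ren (inst t) id \<phi>) # \<Gamma> \<turnstile> ExI (Neg \<phi>)" by (rule ExI_I)
  then show "Neg (ren (inst t) id \<phi>) # \<Gamma> \<turnstile> Bot" using 1 by (rule NegE)
qed

lemma deriv_mp: "\<Gamma> \<turnstile> Imp \<phi> \<psi> \<Longrightarrow> \<Gamma> \<turnstile> \<phi> \<Longrightarrow> \<Gamma> \<turnstile> \<psi>"
proof (rule DNegE, rule NegI)
  assume "\<Gamma> \<turnstile> Imp \<phi> \<psi>" "\<Gamma> \<turnstile> \<phi>"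
  then have "Neg \<psi> # \<Gamma> \<turnstile> Imp \<phi> \<psi>" "Neg \<psi> # \<Gamma> \<turnstile> \<phi>"
    by (auto elim: deriv_mono)
  then show "Neg \<psi> # \<Gamma> \<turnstile> Bot"
    by (meson AndI Axiom NegE list.set_intros(1))
qed

lemma deriv_Imp: "\<phi> # \<Gamma> \<turnstile> \<psi> \<Longrightarrow> \<Gamma> \<turnstile> Imp \<phi> \<psi>"
proof (rule NegI)
  assume a: "\<phi> # \<Gamma> \<turnstile> \<psi>"
  let ?\<Delta> = "And \<phi> (Neg \<psi>) # \<Gamma>"
  have and': "?\<Delta> \<turnstile> And \<phi> (Neg \<psi>)" by (simp add: Axiom)
  have "\<phi> # ?\<Delta> \<turnstile> \<psi>" using a by (rule deriv_mono) auto
  with and' have "?\<Delta> \<turnstile> \<psi>" by (meson AndE1 Cut)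
  then show "?\<Delta> \<turnstile> Bot" using and' by (meson AndE2 NegE)
qed

lemma deriv_AllI_refl: "\<Gamma> \<turnstile> AllI (Iff \<phi> \<phi>)"
proof (rule NegI)
  let ?\<Delta> = "ExI (Neg (Iff \<phi> \<phi>)) # \<Gamma>"
  have "Neg (Iff \<phi> \<phi>) # map shiftI ?\<Delta> \<turnstile> Bot"
    by (meson AndI Axiom NegE deriv_Imp list.set_intros(1))
  then show "?\<Delta> \<turnstile> Bot"
    using ExI_E[of ?\<Delta> "Neg (Iff \<phi> \<phi>)" Bot] by (simp add: Axiom)
qed

text \<open>Substituting \<phi> for the set variable turns the body into
  \<open>Iff \<phi> \<phi>\<close>: \<open>shiftP \<phi>\<close> does not contain that variable, and
  the remaining substitution \<open>Mem 0\<close> is the identity.\<close>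

lemma deriv_comprehension: "\<Gamma> \<turnstile> ExP (AllI (Iff (Mem 0 0) (shiftP \<phi>)))"
proof (rule Compr)
  have "inst 0 \<circ> up Suc = id"
    by (auto simp: up_def inst_def fun_eq_iff split: nat.split)
  moreover have "(\<lambda>X. ren (up Suc) id (case Suc X of 0 \<Rightarrow> \<phi> | Suc x \<Rightarrow> Mem 0 x)) = Mem 0"
    by (rule ext) simp
  ultimately have "comp_inst \<phi> (AllI (Iff (Mem 0 0) (shiftP \<phi>))) = AllI (Iff \<phi> \<phi>)"
    by (simp add: comp_inst_def psub_ren psub_Mem ren_ren)
  then show "\<Gamma> \<turnstile> comp_inst \<phi> (AllI (Iff (Mem 0 0) (shiftP \<phi>)))"
    by (simp only: deriv_AllI_refl)
qed

text \<open>In the term model induction concerns internal sets, which are named by set variables; so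
  the instance for the atom \<open>Mem 0 X\<close> is the one required.\<close>

lemma deriv_induction:
  assumes z: "\<Gamma> \<turnstile> AllI (Imp (Zero 0) (Mem 0 X))"
    and s: "\<Gamma> \<turnstile> AllI (AllI (Imp (Succ 1 0) (Imp (Mem 1 X) (Mem 0 X))))"
  shows "\<Gamma> \<turnstile> Mem x X"
proof -
  have "Zero 0 # map shiftI \<Gamma> \<turnstile> Mem 0 X"
  proof -
    have "map shiftI \<Gamma> \<turnstile> shiftI (AllI (Imp (Zero 0) (Mem 0 X)))" using z by (rule deriv_ren)
    then have "Zero 0 # map shiftI \<Gamma> \<turnstile> AllI (Imp (Zero 0) (Mem 0 X))"
      by (auto elim: deriv_mono)
    from deriv_AllI_inst[OF this, of 0] have "Zero 0 # map shiftI \<Gamma> \<turnstile> Imp (Zero 0) (Mem 0 X)"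
      by simp
    then show ?thesis by (rule deriv_mp) (simp add: Axiom)
  qed
  moreover have "Succ 1 0 # shiftI (Mem 0 X) # map (shiftI \<circ> shiftI) \<Gamma> \<turnstile> ren (up Suc) id (Mem 0 X)"
    (is "?\<Delta> \<turnstile> _")
  proof -
    have "map shiftI (map shiftI \<Gamma>) \<turnstile>
        shiftI (shiftI (AllI (AllI (Imp (Succ 1 0) (Imp (Mem 1 X) (Mem 0 X))))))"
      using deriv_ren[OF deriv_ren[OF s]] .
    then have "?\<Delta> \<turnstile> AllI (AllI (Imp (Succ 1 0) (Imp (Mem 1 X) (Mem 0 X))))"
      by (auto elim!: deriv_mono)
    from deriv_AllI_inst[OF this, of 1]
    have "?\<Delta> \<turnstile> AllI (Imp (Succ 2 0) (Imp (Mem 2 X) (Mem 0 X)))"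
      by (simp add: numeral_2_eq_2)
    from deriv_AllI_inst[OF this, of 0]
    have "?\<Delta> \<turnstile> Imp (Succ 1 0) (Imp (Mem 1 X) (Mem 0 X))"
      by (simp add: numeral_2_eq_2)
    then have "?\<Delta> \<turnstile> Imp (Mem 1 X) (Mem 0 X)" by (rule deriv_mp) (simp add: Axiom)
    then have "?\<Delta> \<turnstile> Mem 0 X" by (rule deriv_mp) (simp add: Axiom)
    then show ?thesis by simp
  qed
  ultimately have "\<Gamma> \<turnstile> ren (inst x) id (Mem 0 X)" by (rule Induct)
  then show ?thesis by simp
qed


subsection \<open>The Henkin construction\<close>

text \<open>An enumeration of all formulae. At numbers that are no codes its value is arbitrary,
  which only makes some formula be treated more than once.\<close>

definition fm_of :: "nat \<Rightarrow> fm" where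
  "fm_of n = (SOME \<phi>. code \<phi> = n)"

lemma fm_of_code [simp]: "fm_of (code \<phi>) = \<phi>"
  unfolding fm_of_def by (rule some_equality) (auto dest: code_inject)

definition freshI :: "fm list \<Rightarrow> nat" where
  "freshI \<Gamma> = (SOME t. \<forall>\<gamma>\<in>set \<Gamma>. t \<notin> fvi \<gamma>)"

definition freshP :: "fm list \<Rightarrow> nat" where
  "freshP \<Gamma> = (SOME t. \<forall>\<gamma>\<in>set \<Gamma>. t \<notin> fvp \<gamma>)"

lemma freshI: "\<gamma> \<in> set \<Gamma> \<Longrightarrow> freshI \<Gamma> \<notin> fvi \<gamma>"
proof -
  have "finite (\<Union>\<gamma>\<in>set \<Gamma>. fvi \<gamma>)" by (simp add: finite_fvi)
  from ex_new_if_finite[OF infinite_UNIV_nat this] have "\<exists>t. \<forall>\<gamma>\<in>set \<Gamma>. t \<notin> fvi \<gamma>" by blast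
  from someI_ex[OF this] show "\<gamma> \<in> set \<Gamma> \<Longrightarrow> freshI \<Gamma> \<notin> fvi \<gamma>"
    unfolding freshI_def by blast
qed

lemma freshP: "\<gamma> \<in> set \<Gamma> \<Longrightarrow> freshP \<Gamma> \<notin> fvp \<gamma>"
proof -
  have "finite (\<Union>\<gamma>\<in>set \<Gamma>. fvp \<gamma>)" by (simp add: finite_fvp)
  from ex_new_if_finite[OF infinite_UNIV_nat this] have "\<exists>t. \<forall>\<gamma>\<in>set \<Gamma>. t \<notin> fvp \<gamma>" by blast
  from someI_ex[OF this] show "\<gamma> \<in> set \<Gamma> \<Longrightarrow> freshP \<Gamma> \<notin> fvp \<gamma>"
    unfolding freshP_def by blast
qed

text \<open>Free variables of the language serve as Henkin constants: each stage is a finite list,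
  hence a fresh variable is always left.\<close>

definition witness :: "fm \<Rightarrow> fm list \<Rightarrow> fm list" where
  "witness \<phi> \<Gamma> = (case \<phi> of
      ExI \<chi> \<Rightarrow> ren (inst (freshI \<Gamma>)) id \<chi> # \<Gamma>
    | ExP \<chi> \<Rightarrow> ren id (inst (freshP \<Gamma>)) \<chi> # \<Gamma>
    | _ \<Rightarrow> \<Gamma>)"

lemma witness_subset: "set \<Gamma> \<subseteq> set (witness \<phi> \<Gamma>)"
  by (auto simp: witness_def split: fm.split)

text \<open>Renaming the fresh witness to index \<open>0\<close> turns a refutation of the witnessed context into
  an instance of existential elimination.\<close>

lemma witness_consistent:
  assumes "\<phi> \<in> set \<Gamma>" "witness \<phi> \<Gamma> \<turnstile> Bot"
  shows "\<Gamma> \<turnstile> Bot"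
proof (cases \<phi>)
  case (ExI \<chi>)
  define t where "t = freshI \<Gamma>"
  define r where "r n = (if n = t then 0 else Suc n)" for n
  have fr: "t \<notin> fvi \<gamma>" if "\<gamma> \<in> set \<Gamma>" for \<gamma> using freshI[OF that] by (simp add: t_def)
  have shift: "ren r id \<gamma> = shiftI \<gamma>" if "\<gamma> \<in> set \<Gamma>" for \<gamma>
    by (rule ren_cong) (use fr[OF that] in \<open>auto simp: r_def\<close>)
  have "Suc t \<notin> fvi \<chi>" using fr[OF assms(1)] ExI by simp
  then have "ren (r \<circ> inst t) id \<chi> = ren id id \<chi>"
    by (intro ren_cong) (auto simp: r_def inst_def split: nat.split)
  then have chi: "ren r id (ren (inst t) id \<chi>) = \<chi>" by (simp add: ren_ren)
  have "ren (inst t) id \<chi> # \<Gamma> \<turnstile> Bot"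
    using assms(2) ExI by (simp add: witness_def t_def)
  from deriv_ren[OF this, of r id] have "\<chi> # map shiftI \<Gamma> \<turnstile> shiftI Bot"
    using shift chi by (simp cong: map_cong)
  moreover have "\<Gamma> \<turnstile> ExI \<chi>" using assms(1) ExI by (simp add: Axiom)
  ultimately show ?thesis by (meson ExI_E)
next
  case (ExP \<chi>)
  define t where "t = freshP \<Gamma>"
  define r where "r n = (if n = t then 0 else Suc n)" for n
  have fr: "t \<notin> fvp \<gamma>" if "\<gamma> \<in> set \<Gamma>" for \<gamma> using freshP[OF that] by (simp add: t_def)
  have shift: "ren id r \<gamma> = shiftP \<gamma>" if "\<gamma> \<in> set \<Gamma>" for \<gamma>
    by (rule ren_cong) (use fr[OF that] in \<open>auto simp: r_def\<close>)
  have "Suc t \<notin> fvp \<chi>" using fr[OF assms(1)] ExP by simp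
  then have "ren id (r \<circ> inst t) \<chi> = ren id id \<chi>"
    by (intro ren_cong) (auto simp: r_def inst_def split: nat.split)
  then have chi: "ren id r (ren id (inst t) \<chi>) = \<chi>" by (simp add: ren_ren)
  have "ren id (inst t) \<chi> # \<Gamma> \<turnstile> Bot"
    using assms(2) ExP by (simp add: witness_def t_def)
  from deriv_ren[OF this, of id r] have "\<chi> # map shiftP \<Gamma> \<turnstile> shiftP Bot"
    using shift chi by (simp cong: map_cong)
  moreover have "\<Gamma> \<turnstile> ExP \<chi>" using assms(1) ExP by (simp add: Axiom)
  ultimately show ?thesis by (meson ExP_E)
qed (use assms(2) in \<open>simp_all add: witness_def\<close>)

primrec stage :: "fm list \<Rightarrow> nat \<Rightarrow> fm list" where
  "stage \<Gamma> 0 = \<Gamma>"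
| "stage \<Gamma> (Suc n) = (let \<phi> = fm_of n in
     if \<phi> # stage \<Gamma> n \<turnstile> Bot then stage \<Gamma> n else witness \<phi> (\<phi> # stage \<Gamma> n))"

locale henkin_theory =
  fixes \<Gamma>\<^sub>0 :: "fm list"
  assumes consistent: "\<not> \<Gamma>\<^sub>0 \<turnstile> Bot"
begin

definition T :: "fm \<Rightarrow> bool" where
  "T \<phi> \<longleftrightarrow> (\<exists>n. stage \<Gamma>\<^sub>0 n \<turnstile> \<phi>)"

lemma stage_consistent: "\<not> stage \<Gamma>\<^sub>0 n \<turnstile> Bot"
proof (induction n)
  case (Suc n)
  then show ?case
    using witness_consistent[of "fm_of n" "fm_of n # stage \<Gamma>\<^sub>0 n"] by (auto simp: Let_def)
qed (simp add: consistent)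

lemma stage_mono: "m \<le> n \<Longrightarrow> set (stage \<Gamma>\<^sub>0 m) \<subseteq> set (stage \<Gamma>\<^sub>0 n)"
proof (induction rule: dec_induct)
  case (step n)
  then show ?case
    using witness_subset[of "fm_of n # stage \<Gamma>\<^sub>0 n" "fm_of n"] by (auto simp: Let_def)
qed simp

lemma T_lift1: "T \<phi> \<Longrightarrow> (\<And>\<Gamma>. \<Gamma> \<turnstile> \<phi> \<Longrightarrow> \<Gamma> \<turnstile> \<psi>) \<Longrightarrow> T \<psi>"
  by (auto simp: T_def)

lemma T_lift2:
  assumes "T \<phi>" "T \<psi>" "\<And>\<Gamma>. \<Gamma> \<turnstile> \<phi> \<Longrightarrow> \<Gamma> \<turnstile> \<psi> \<Longrightarrow> \<Gamma> \<turnstile> \<chi>"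
  shows "T \<chi>"
proof -
  obtain m n where mn: "stage \<Gamma>\<^sub>0 m \<turnstile> \<phi>" "stage \<Gamma>\<^sub>0 n \<turnstile> \<psi>" using assms by (auto simp: T_def)
  have "stage \<Gamma>\<^sub>0 (max m n) \<turnstile> \<phi>" "stage \<Gamma>\<^sub>0 (max m n) \<turnstile> \<psi>"
    by (rule deriv_mono[OF mn(1)], rule stage_mono, simp)
      (rule deriv_mono[OF mn(2)], rule stage_mono, simp)
  with assms(3) show ?thesis by (auto simp: T_def)
qed

lemma T_lift0: "(\<And>\<Gamma>. \<Gamma> \<turnstile> \<phi>) \<Longrightarrow> T \<phi>"
  by (auto simp: T_def)

lemma T_base: "\<phi> \<in> set \<Gamma>\<^sub>0 \<Longrightarrow> T \<phi>"
  unfolding T_def by (rule exI[of _ 0]) (simp add: Axiom)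

lemma T_Bot: "\<not> T Bot"
  using stage_consistent by (auto simp: T_def)

text \<open>At stage \<open>code \<phi>\<close> the formula is either refuted by the list reached so
  far or added to it.\<close>

lemma T_Neg: "T (Neg \<phi>) \<longleftrightarrow> \<not> T \<phi>"
proof
  show "T (Neg \<phi>) \<Longrightarrow> \<not> T \<phi>"
    using T_lift2[of \<phi> "Neg \<phi>" Bot] T_Bot NegE by blast
  assume n: "\<not> T \<phi>"
  show "T (Neg \<phi>)"
  proof (cases "\<phi> # stage \<Gamma>\<^sub>0 (code \<phi>) \<turnstile> Bot")
    case True
    then show ?thesis unfolding T_def by (auto intro: NegI)
  next
    case False
    then have "\<phi> \<in> set (stage \<Gamma>\<^sub>0 (Suc (code \<phi>)))"
      using witness_subset[of "\<phi> # stage \<Gamma>\<^sub>0 (code \<phi>)" \<phi>] by auto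
    then have "T \<phi>" unfolding T_def by (blast intro: Axiom)
    with n show ?thesis by simp
  qed
qed

lemma T_And: "T (And \<phi> \<psi>) \<longleftrightarrow> T \<phi> \<and> T \<psi>"
proof
  assume "T (And \<phi> \<psi>)"
  then show "T \<phi> \<and> T \<psi>" by (auto elim!: T_lift1 intro: AndE1 AndE2)
next
  assume "T \<phi> \<and> T \<psi>"
  then show "T (And \<phi> \<psi>)" using T_lift2[of \<phi> \<psi>] AndI by blast
qed

text \<open>A theorem of the limit cannot be refuted at its own stage, so that stage has added it
  together with a witness.\<close>

lemma T_enters:
  assumes "T \<phi>"
  shows "set (witness \<phi> (\<phi> # stage \<Gamma>\<^sub>0 (code \<phi>))) \<subseteq> set (stage \<Gamma>\<^sub>0 (Suc (code \<phi>)))"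
proof -
  have "\<not> \<phi> # stage \<Gamma>\<^sub>0 (code \<phi>) \<turnstile> Bot"
  proof
    assume "\<phi> # stage \<Gamma>\<^sub>0 (code \<phi>) \<turnstile> Bot"
    then have "T (Neg \<phi>)" unfolding T_def by (auto intro: NegI)
    with assms show False by (simp add: T_Neg)
  qed
  then show ?thesis by (simp add: Let_def)
qed

lemma T_ExI: "T (ExI \<phi>) \<longleftrightarrow> (\<exists>t. T (ren (inst t) id \<phi>))"
proof
  assume "T (ExI \<phi>)"
  from T_enters[OF this]
  have "ren (inst (freshI (ExI \<phi> # stage \<Gamma>\<^sub>0 (code (ExI \<phi>))))) id \<phi> \<in> set (stage \<Gamma>\<^sub>0 (Suc (code (ExI \<phi>))))"
    by (simp add: witness_def)
  then show "\<exists>t. T (ren (inst t) id \<phi>)" unfolding T_def by (blast intro: Axiom)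
qed (auto intro: T_lift1 ExI_I)

lemma T_ExP: "T (ExP \<phi>) \<longleftrightarrow> (\<exists>t. T (ren id (inst t) \<phi>))"
proof
  assume "T (ExP \<phi>)"
  from T_enters[OF this]
  have "ren id (inst (freshP (ExP \<phi> # stage \<Gamma>\<^sub>0 (code (ExP \<phi>))))) \<phi> \<in> set (stage \<Gamma>\<^sub>0 (Suc (code (ExP \<phi>))))"
    by (simp add: witness_def)
  then show "\<exists>t. T (ren id (inst t) \<phi>)" unfolding T_def by (blast intro: Axiom)
qed (auto intro: T_lift1 ExP_I)

lemma T_AllI: "T (AllI \<phi>) \<longleftrightarrow> (\<forall>t. T (ren (inst t) id \<phi>))"
  by (simp add: T_Neg T_ExI)

lemma T_subst: "T (Eq x y) \<Longrightarrow> T (ren (inst x) id \<phi>) \<Longrightarrow> T (ren (inst y) id \<phi>)"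
  by (erule (1) T_lift2) (rule EqSubst)

lemma T_Eq_refl: "T (Eq x x)"
  by (rule T_lift0) (rule EqRefl)

lemma T_Eq_sym: "T (Eq x y) \<Longrightarrow> T (Eq y x)"
  using T_subst[of x y "Eq 0 (Suc x)"] T_Eq_refl by simp

lemma T_Eq_trans: "T (Eq x y) \<Longrightarrow> T (Eq y z) \<Longrightarrow> T (Eq x z)"
  using T_subst[of y z "Eq (Suc x) 0"] by simp

lemma T_Le_cong: "T (Eq x x') \<Longrightarrow> T (Eq y y') \<Longrightarrow> T (Le x y) \<Longrightarrow> T (Le x' y')"
  using T_subst[of x x' "Le 0 (Suc y)"] T_subst[of y y' "Le (Suc x') 0"] by simp

lemma T_Succ_cong: "T (Eq x x') \<Longrightarrow> T (Eq y y') \<Longrightarrow> T (Succ x y) \<Longrightarrow> T (Succ x' y')"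
  using T_subst[of x x' "Succ 0 (Suc y)"] T_subst[of y y' "Succ (Suc x') 0"] by simp

lemma T_Zero_cong: "T (Eq x x') \<Longrightarrow> T (Zero x) \<Longrightarrow> T (Zero x')"
  using T_subst[of x x' "Zero 0"] by simp

lemma T_Mem_cong: "T (Eq x x') \<Longrightarrow> T (Mem x X) \<Longrightarrow> T (Mem x' X)"
  using T_subst[of x x' "Mem 0 X"] by simp

lemma ex_sv: "\<exists>y. T (Succ x y)"
proof -
  have "T (ExI (Succ (Suc x) 0))" by (rule T_lift0) (rule SuccEx)
  then show ?thesis by (simp add: T_ExI)
qed

definition sv :: "nat \<Rightarrow> nat" where "sv x = (SOME y. T (Succ x y))"

lemma sv: "T (Succ x (sv x))"
  unfolding sv_def using ex_sv by (rule someI_ex)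

lemma ex_zv: "\<exists>x. T (Zero x)"
proof -
  have "T (ExI (Zero 0))" by (rule T_lift0) (rule ZeroEx)
  then show ?thesis by (simp add: T_ExI)
qed

definition zv :: nat where "zv = (SOME x. T (Zero x))"

lemma zv: "T (Zero zv)"
  unfolding zv_def using ex_zv by (rule someI_ex)

lemma T_Succ_inj: "T (Succ y x) \<Longrightarrow> T (Succ z x) \<Longrightarrow> T (Eq y z)"
  by (erule (1) T_lift2) (rule SuccInj)

lemma T_Succ_fun: "T (Succ x y) \<Longrightarrow> T (Succ x z) \<Longrightarrow> T (Eq y z)"
  by (erule (1) T_lift2) (rule SuccFun)

lemma T_Succ_Zero: "T (Succ x y) \<Longrightarrow> T (Zero y) \<Longrightarrow> False"
  using T_lift2[of "Succ x y" "Zero y" Bot] SuccZero T_Bot by blast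

section \<open>The term model, renumbered so that its domain is \<open>nat\<close>\<close>

definition cls :: "nat \<Rightarrow> nat set" where "cls x = {y. T (Eq x y)}"

lemma cls_eq: "cls x = cls y \<longleftrightarrow> T (Eq x y)"
  unfolding cls_def using T_Eq_refl T_Eq_sym T_Eq_trans by blast

text \<open>Successor is injective on classes of variables and omits the class of zero. Infinitely
  many classes are needed to number them by all of \<open>nat\<close>, since the domain of an
  \<open>mstruct\<close> is its whole type; completeness can then be stated with models on one
  type.\<close>

lemma infinite_cls: "infinite (range cls)"
proof
  assume fin: "finite (range cls)"
  define pick where "pick A = (SOME x. cls x = A)" for A
  have pick: "cls (pick A) = A" if "A \<in> range cls" for A
    unfolding pick_def using that by (metis (mono_tags) imageE someI_ex)
  define g where "g A = cls (sv (pick A))" for A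
  have "inj_on g (range cls)"
  proof (rule inj_onI)
    fix A B assume A: "A \<in> range cls" and B: "B \<in> range cls" and "g A = g B"
    then have "T (Eq (sv (pick A)) (sv (pick B)))" by (simp add: g_def cls_eq)
    then have "T (Succ (pick A) (sv (pick B)))" using T_Succ_cong[OF T_Eq_refl _ sv] by blast
    then have "T (Eq (pick A) (pick B))" using T_Succ_inj sv by blast
    then show "A = B" using pick[OF A] pick[OF B] cls_eq by metis
  qed
  moreover have "g ` range cls \<subseteq> range cls" by (auto simp: g_def)
  ultimately have "g ` range cls = range cls" using fin by (metis endo_inj_surj)
  then obtain A where "cls zv = g A" by blast
  then have "T (Eq (sv (pick A)) zv)" using cls_eq[of "sv (pick A)" zv] unfolding g_def by simp
  then have "T (Succ (pick A) zv)" using T_Succ_cong[OF T_Eq_refl _ sv] by blast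
  then show False using T_Succ_Zero zv by blast
qed

definition nm :: "nat \<Rightarrow> nat" where "nm x = to_nat_on (range cls) (cls x)"

lemma bij_nm: "bij_betw (to_nat_on (range cls)) (range cls) UNIV"
  using infinite_cls by (intro to_nat_on_infinite) auto

lemma nm_eq: "nm x = nm y \<longleftrightarrow> T (Eq x y)"
  using bij_nm unfolding nm_def cls_eq[symmetric]
  by (metis bij_betw_imp_inj_on inj_on_def rangeI)

lemma nm_surj: "\<exists>x. d = nm x"
proof -
  have "d \<in> to_nat_on (range cls) ` range cls" using bij_nm by (metis UNIV_I bij_betw_def)
  then show ?thesis by (auto simp: nm_def)
qed

definition rv :: "nat \<Rightarrow> nat" where "rv d = (SOME x. nm x = d)"

lemma nm_rv [simp]: "nm (rv d) = d"
  unfolding rv_def by (rule someI_ex) (metis nm_surj)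

lemma rv_nm: "T (Eq (rv (nm x)) x)"
  by (simp flip: nm_eq)

definition ext_of :: "nat \<Rightarrow> nat set" where "ext_of X = {nm x | x. T (Mem x X)}"

lemma mem_ext: "nm x \<in> ext_of X \<longleftrightarrow> T (Mem x X)"
  by (auto simp: ext_of_def nm_eq intro: T_Mem_cong T_Eq_sym T_Eq_refl)

definition mle :: "nat \<Rightarrow> nat \<Rightarrow> bool" where "mle a b \<longleftrightarrow> T (Le (rv a) (rv b))"

definition msuc :: "nat \<Rightarrow> nat" where "msuc a = nm (sv (rv a))"

lemma mle_nm: "mle (nm x) (nm y) \<longleftrightarrow> T (Le x y)"
  unfolding mle_def using T_Le_cong rv_nm T_Eq_sym by blast

lemma msuc_nm: "nm y = msuc (nm x) \<longleftrightarrow> T (Succ x y)"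
proof -
  have s: "T (Succ x (sv (rv (nm x))))" using T_Succ_cong[OF rv_nm T_Eq_refl sv] .
  show ?thesis unfolding msuc_def nm_eq
    using s T_Succ_fun T_Succ_cong[OF T_Eq_refl] T_Eq_sym by blast
qed

lemma zero_nm: "nm x = nm zv \<longleftrightarrow> T (Zero x)"
  unfolding nm_eq using zv T_Zero_cong T_Eq_sym T_lift2[of "Zero x" "Zero zv"] ZeroUnique by blast

sublocale M: mstruct mle "nm zv" msuc "range ext_of" .

text \<open>Stated for all assignments of the form \<open>nm \<circ> r\<close>, so that the
  quantifier cases can prepend a witness to \<open>r\<close>; no individual is missed because
  \<open>nm\<close> is onto.\<close>

lemma truth: "M.sat (nm \<circ> r) (ext_of \<circ> s) \<phi> \<longleftrightarrow> T (ren r s \<phi>)"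
proof (induction \<phi> arbitrary: r s)
  case (ExI \<phi>)
  have "M.sat (nm t ## (nm \<circ> r)) (ext_of \<circ> s) \<phi> \<longleftrightarrow> T (ren (inst t) id (ren (up r) s \<phi>))" for t
  proof -
    have "nm t ## (nm \<circ> r) = nm \<circ> (t ## r)" using scons_comp[of nm t r] by (simp add: comp_def)
    then show ?thesis using ExI.IH[of "t ## r" s] by (simp add: ren_ren inst_up del: comp_apply)
  qed
  then have "(\<exists>x. M.sat (x ## (nm \<circ> r)) (ext_of \<circ> s) \<phi>) \<longleftrightarrow> (\<exists>t. T (ren (inst t) id (ren (up r) s \<phi>)))"
    by (metis nm_surj)
  then show ?case by (simp only: M.sat.simps ren.simps T_ExI)
next
  case (ExP \<phi>)
  have "M.sat (nm \<circ> r) (ext_of t ## (ext_of \<circ> s)) \<phi> \<longleftrightarrow> T (ren id (inst t) (ren r (up s) \<phi>))" for t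
  proof -
    have "ext_of t ## (ext_of \<circ> s) = ext_of \<circ> (t ## s)"
      using scons_comp[of ext_of t s] by (simp add: comp_def)
    then show ?thesis using ExP.IH[of r "t ## s"] by (simp add: ren_ren inst_up del: comp_apply)
  qed
  then show ?case by (auto simp only: M.sat.simps ren.simps T_ExP)
qed (simp_all add: nm_eq mle_nm msuc_nm zero_nm[unfolded nm_eq] mem_ext T_Neg T_And T_Bot T_lift0 TopI)

lemma T_Le_succ_cases: "T (Succ y y') \<Longrightarrow> T (Le x y') \<Longrightarrow> \<not> T (Eq x y') \<Longrightarrow> T (Le x y)"
proof -
  assume "T (Succ y y')" "T (Le x y')" "\<not> T (Eq x y')"
  then have "T (And (Succ y y') (Le x y'))" "T (Neg (Eq x y'))" by (simp_all add: T_And T_Neg)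
  then show ?thesis by (rule T_lift2) (meson AndE1 AndE2 LeSucc)
qed

lemma M_comprehension:
  assumes "range ep \<subseteq> range ext_of"
  shows "{d. M.sat (d ## ei) ep \<phi>} \<in> range ext_of"
proof -
  have ei: "ei = nm \<circ> (rv \<circ> ei)" by (simp add: fun_eq_iff)
  have "\<forall>n. \<exists>X. ep n = ext_of X" using assms by (auto simp: image_subset_iff)
  then obtain s where ep: "ep = ext_of \<circ> s" by (metis comp_apply ext)
  \<comment> \<open>The parameters are replaced by variables naming them, so that the derived
    comprehension formula applies.\<close>
  define \<phi>' where "\<phi>' = ren (up (rv \<circ> ei)) s \<phi>"
  have "T (ExP (AllI (Iff (Mem 0 0) (shiftP \<phi>'))))" by (rule T_lift0) (rule deriv_comprehension)
  then obtain X where X: "T (ren id (inst X) (AllI (Iff (Mem 0 0) (shiftP \<phi>'))))"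
    by (auto simp only: T_ExP)
  have "inst X \<circ> Suc = id" by auto
  with X have "T (AllI (Iff (Mem 0 X) \<phi>'))" by (simp add: ren_ren)
  then have iff: "T (Mem t X) \<longleftrightarrow> T (ren (inst t) id \<phi>')" for t
    unfolding T_AllI by (auto simp: T_Neg T_And)
  have "M.sat (nm t ## ei) ep \<phi> \<longleftrightarrow> nm t \<in> ext_of X" for t
  proof -
    have "nm t ## ei = nm \<circ> (t ## (rv \<circ> ei))"
      using scons_comp[of nm t "rv \<circ> ei"] by (simp add: comp_def)
    then show ?thesis using truth[of "t ## (rv \<circ> ei)" s \<phi>] iff[of t]
      by (simp add: ep \<phi>'_def ren_ren inst_up mem_ext)
  qed
  then have "{d. M.sat (d ## ei) ep \<phi>} = ext_of X" by (metis (mono_tags) Collect_mem_eq Collect_cong nm_rv)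
  then show ?thesis by blast
qed

lemma M_induct:
  assumes "A \<in> range ext_of" "nm zv \<in> A" "\<And>x. x \<in> A \<Longrightarrow> msuc x \<in> A"
  shows "A = UNIV"
proof -
  obtain X where A: "A = ext_of X" using assms(1) by blast
  have "T (AllI (Imp (Zero 0) (Mem 0 X)))"
    using assms(2) A unfolding T_AllI by (auto simp: T_Neg T_And mem_ext simp flip: zero_nm mem_ext)
  moreover have "T (AllI (AllI (Imp (Succ 1 0) (Imp (Mem 1 X) (Mem 0 X)))))"
    using assms(3) A unfolding T_AllI by (auto simp: T_Neg T_And T_ExI numeral_2_eq_2 simp flip: msuc_nm mem_ext)
  ultimately have "T (Mem x X)" for x by (rule T_lift2) (rule deriv_induction)
  then have "d \<in> A" for d using mem_ext[of "rv d" X] A by simp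
  then show ?thesis by blast
qed

lemma M_henkin: "henkin mle (nm zv) msuc (range ext_of)"
proof
  show "range ext_of \<noteq> {}" by blast
  show "mle x x" for x unfolding mle_def by (rule T_lift0) (rule LeRefl)
  show "mle x y \<Longrightarrow> mle y z \<Longrightarrow> mle x z" for x y z
    unfolding mle_def by (erule (1) T_lift2) (rule LeTrans)
  show "x = y" if "mle x y" "mle y x" for x y
  proof -
    have "T (Eq (rv x) (rv y))"
      using that unfolding mle_def by (rule T_lift2) (rule LeAntisym)
    then show ?thesis by (simp flip: nm_eq)
  qed
  show "x = y" if "msuc x = msuc y" for x y
  proof -
    have "T (Eq (sv (rv x)) (sv (rv y)))" using that by (simp add: msuc_def nm_eq)
    then have "T (Succ (rv x) (sv (rv y)))" using T_Succ_cong[OF T_Eq_refl _ sv] by blast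
    then have "T (Eq (rv x) (rv y))" using T_Succ_inj sv by blast
    then show ?thesis by (simp flip: nm_eq)
  qed
  show "msuc x \<noteq> nm zv" for x
    using msuc_nm[of zv "rv x"] T_Succ_Zero zv by auto
  show "mle x (msuc x)" for x
  proof -
    have "T (Le (rv x) (sv (rv x)))" using sv by (rule T_lift1) (rule SuccLe)
    then show ?thesis using mle_nm[of "rv x" "sv (rv x)"] by (simp add: msuc_def)
  qed
  show "mle x y" if "mle x (msuc y)" "x \<noteq> msuc y" for x y
    using T_Le_succ_cases[OF sv, of "rv x" "rv y"] that mle_nm[of "rv x" "sv (rv y)"]
      nm_eq[of "rv x" "sv (rv y)"] mle_nm[of "rv x" "rv y"] by (simp add: msuc_def)
  show "{d. M.sat (d ## ei) ep \<phi>} \<in> range ext_of" if "range ep \<subseteq> range ext_of" for ep ei \<phi>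
    using that by (rule M_comprehension)
  show "A = UNIV" if "A \<in> range ext_of" "nm zv \<in> A" "\<And>x. x \<in> A \<Longrightarrow> msuc x \<in> A" for A
    using that by (rule M_induct)
qed

lemma M_sat: "\<phi> \<in> set \<Gamma>\<^sub>0 \<Longrightarrow> M.sat nm ext_of \<phi>"
  using truth[of id id \<phi>] T_base by simp

end

theorem henkin_completeness:
  assumes "\<And>(le :: nat \<Rightarrow> nat \<Rightarrow> bool) zero suc P ei ep.
      henkin le zero suc P \<Longrightarrow> range ep \<subseteq> P \<Longrightarrow> mstruct.sat le zero suc P ei ep \<phi>"
  shows "[] \<turnstile> \<phi>"
proof (rule ccontr)
  assume n: "\<not> [] \<turnstile> \<phi>"
  have "\<not> [Neg \<phi>] \<turnstile> Bot" using n by (meson DNegE NegI)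
  then interpret henkin_theory "[Neg \<phi>]" by unfold_locales
  have "M.sat nm ext_of (Neg \<phi>)" by (rule M_sat) simp
  moreover have "M.sat nm ext_of \<phi>" by (rule assms[OF M_henkin]) simp
  ultimately show False by simp
qed

context henkin
begin

subsection \<open>Definable relations and internal sets\<close>

text \<open>Attached to relations instead of formulae, so that definability is verified along the
  shape of an expression and no formula has to be written down. Agreement on internal set
  assignments is enough, as \<open>ExP\<close> ranges over \<open>P\<close>.\<close>

definition Def :: "((nat \<Rightarrow> 'a) \<Rightarrow> (nat \<Rightarrow> 'a set) \<Rightarrow> bool) \<Rightarrow> bool" where
  "Def R \<longleftrightarrow> (\<exists>\<phi>. \<forall>ei ep. range ep \<subseteq> P \<longrightarrow> R ei ep = sat ei ep \<phi>)"

named_theorems Def_intros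

lemma DefI: "(\<And>ei ep. range ep \<subseteq> P \<Longrightarrow> R ei ep = sat ei ep \<phi>) \<Longrightarrow> Def R"
  unfolding Def_def by blast

lemma Def_atoms [Def_intros]:
  "Def (\<lambda>ei ep. ei a = ei b)" "Def (\<lambda>ei ep. ei a \<sqsubseteq> ei b)" "Def (\<lambda>ei ep. ei b = suc (ei a))"
  "Def (\<lambda>ei ep. ei a = zero)" "Def (\<lambda>ei ep. ei a \<in> ep X)" "Def (\<lambda>ei ep. c)"
  by (rule DefI[where \<phi> = "Eq a b"] DefI[where \<phi> = "Le a b"] DefI[where \<phi> = "Succ a b"]
      DefI[where \<phi> = "Zero a"] DefI[where \<phi> = "Mem a X"] DefI[where \<phi> = "if c then Top else Bot"]; simp)+

lemma Def_Neg [Def_intros]: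
  assumes "Def R"
  shows "Def (\<lambda>ei ep. \<not> R ei ep)"
proof -
  obtain \<phi> where "\<forall>ei ep. range ep \<subseteq> P \<longrightarrow> R ei ep = sat ei ep \<phi>" using assms unfolding Def_def by blast
  then show ?thesis by (intro DefI[where \<phi> = "Neg \<phi>"]) simp
qed

lemma Def_And [Def_intros]:
  assumes "Def R" "Def S"
  shows "Def (\<lambda>ei ep. R ei ep \<and> S ei ep)"
proof -
  obtain \<phi> \<psi> where "\<forall>ei ep. range ep \<subseteq> P \<longrightarrow> R ei ep = sat ei ep \<phi>"
    "\<forall>ei ep. range ep \<subseteq> P \<longrightarrow> S ei ep = sat ei ep \<psi>" using assms unfolding Def_def by blast
  then show ?thesis by (intro DefI[where \<phi> = "And \<phi> \<psi>"]) simp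
qed

lemma Def_Ex [Def_intros]:
  assumes "Def (\<lambda>ei ep. R (ei 0) (\<lambda>i. ei (Suc i)) ep)"
  shows "Def (\<lambda>ei ep. \<exists>x. R x ei ep)"
proof -
  obtain \<phi> where *: "\<And>ei ep. range ep \<subseteq> P \<Longrightarrow> R (ei 0) (\<lambda>i. ei (Suc i)) ep = sat ei ep \<phi>"
    using assms unfolding Def_def by blast
  show ?thesis
    by (rule DefI[where \<phi> = "ExI \<phi>"]) (simp flip: *)
qed

lemma Def_ExP [Def_intros]:
  assumes "Def (\<lambda>ei ep. R (ep 0) ei (\<lambda>i. ep (Suc i)))"
  shows "Def (\<lambda>ei ep. \<exists>Y\<in>P. R Y ei ep)"
proof -
  obtain \<phi> where *: "\<And>ei ep. range ep \<subseteq> P \<Longrightarrow> R (ep 0) ei (\<lambda>i. ep (Suc i)) = sat ei ep \<phi>"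
    using assms unfolding Def_def by blast
  have "sat ei (Y ## ep) \<phi> = R Y ei ep" if "Y \<in> P" "range ep \<subseteq> P" for Y ei ep
    using *[of "Y ## ep" ei] that by (simp add: range_scons)
  then show ?thesis
    by (intro DefI[where \<phi> = "ExP \<phi>"]) simp
qed

lemma Def_Or [Def_intros]: "Def R \<Longrightarrow> Def S \<Longrightarrow> Def (\<lambda>ei ep. R ei ep \<or> S ei ep)"
  using Def_Neg[OF Def_And[OF Def_Neg Def_Neg]] by (simp add: de_Morgan_conj)

lemma Def_Imp [Def_intros]: "Def R \<Longrightarrow> Def S \<Longrightarrow> Def (\<lambda>ei ep. R ei ep \<longrightarrow> S ei ep)"
  unfolding imp_conv_disj by (intro Def_Or Def_Neg)

lemma Def_Iff [Def_intros]: "Def R \<Longrightarrow> Def S \<Longrightarrow> Def (\<lambda>ei ep. R ei ep \<longleftrightarrow> S ei ep)"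
  unfolding iff_conv_conj_imp by (intro Def_And Def_Imp)

lemma Def_All [Def_intros]:
  "Def (\<lambda>ei ep. R (ei 0) (\<lambda>i. ei (Suc i)) ep) \<Longrightarrow> Def (\<lambda>ei ep. \<forall>x. R x ei ep)"
  using Def_Neg[OF Def_Ex[OF Def_Neg]] by simp

lemma Def_finite_Bex:
  assumes "finite V" "\<And>v. v \<in> V \<Longrightarrow> Def (R v)"
  shows "Def (\<lambda>ei ep. \<exists>v\<in>V. R v ei ep)"
  using assms by (induction V rule: finite_induct) (auto intro!: Def_Or Def_atoms)

lemma Def_ren:
  assumes "Def R"
  shows "Def (\<lambda>ei ep. R (\<lambda>i. ei (r i)) (\<lambda>j. ep (s j)))"
proof -
  obtain \<phi> where *: "\<And>ei ep. range ep \<subseteq> P \<Longrightarrow> R ei ep = sat ei ep \<phi>"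
    using assms unfolding Def_def by blast
  have "R (\<lambda>i. ei (r i)) (\<lambda>j. ep (s j)) = sat ei ep (ren r s \<phi>)" if "range ep \<subseteq> P" for ei ep
    using *[of "\<lambda>j. ep (s j)"] that by (simp add: sat_ren comp_def image_subset_iff)
  then show ?thesis by (rule DefI)
qed

lemma Def_scons:
  assumes "Def R"
  shows "Def (\<lambda>ei ep. R (ei a ## (\<lambda>i. ei (t i))) (ep b ## (\<lambda>j. ep (t' j))))"
  using Def_ren[OF assms, of "a ## t" "b ## t'"] by (simp add: scons_comp)

lemma internalI: "Def R \<Longrightarrow> range ep \<subseteq> P \<Longrightarrow> {n. R (n ## ei) ep} \<in> P"
  unfolding Def_def using comprehension by auto

lemma internal_Collect:
  assumes "Def R" "range ep \<subseteq> P" "\<And>n. Q n \<longleftrightarrow> R (n ## ei) ep"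
  shows "{n. Q n} \<in> P"
  using internalI[OF assms(1,2), of ei] assms(3) by simp

text \<open>\<open>R\<close> carries the definability, \<open>Q\<close> is the property as it is
  used; the two meet only on assignments that extend the fixed parameters.\<close>

lemma Def_induct:
  assumes "Def R" "range ep \<subseteq> P" "\<And>n. Q n \<longleftrightarrow> R (n ## ei) ep" "Q zero" "\<And>x. Q x \<Longrightarrow> Q (suc x)"
  shows "Q x"
  using internal_induct[OF internal_Collect[of R ep Q ei]] assms by blast

lemma obtain_env: obtains e :: "nat \<Rightarrow> 'a set" where "range e \<subseteq> P"
proof -
  obtain Y where "Y \<in> P" using internal_nonempty by blast
  then have "range (\<lambda>_ :: nat. Y) \<subseteq> P" by auto
  then show ?thesis by (rule that)
qed


subsection \<open>The order of a Henkin model\<close>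

definition lt :: "'a \<Rightarrow> 'a \<Rightarrow> bool" (infix "\<sqsubset>" 50) where
  "x \<sqsubset> y \<longleftrightarrow> x \<sqsubseteq> y \<and> x \<noteq> y"

lemma zero_le: "zero \<sqsubseteq> x"
proof -
  obtain e :: "nat \<Rightarrow> 'a set" where e: "range e \<subseteq> P" by (rule obtain_env)
  have D: "Def (\<lambda>ei ep. ei 1 \<sqsubseteq> ei 0)" by (intro Def_intros)
  show ?thesis
    by (rule Def_induct[OF D e, where ei = "\<lambda>_. zero"]) (use le_refl le_trans le_suc in auto)
qed

lemma le_zero: "x \<sqsubseteq> zero \<longleftrightarrow> x = zero"
  using zero_le le_antisym le_refl by blast

lemma suc_le: "x \<sqsubset> y \<Longrightarrow> suc x \<sqsubseteq> y"
proof -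
  obtain e :: "nat \<Rightarrow> 'a set" where e: "range e \<subseteq> P" by (rule obtain_env)
  have D: "Def (\<lambda>ei ep. ei 1 \<sqsubseteq> ei 0 \<longrightarrow> ei 1 = ei 0 \<or> ei 2 \<sqsubseteq> ei 0)" by (intro Def_intros)
  have "x \<sqsubseteq> y \<longrightarrow> x = y \<or> suc x \<sqsubseteq> y"
  proof (rule Def_induct[OF D e, where ei = "\<lambda>i. if i = 0 then x else suc x" and x = y])
    show "x \<sqsubseteq> suc z \<longrightarrow> x = suc z \<or> suc x \<sqsubseteq> suc z" if "x \<sqsubseteq> z \<longrightarrow> x = z \<or> suc x \<sqsubseteq> z" for z
      using that le_suc_cases[of x z] le_trans[OF _ le_suc, of "suc x" z] le_refl by blast
  qed (use le_zero[of x] in \<open>simp_all add: numeral_2_eq_2\<close>)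
  then show "x \<sqsubset> y \<Longrightarrow> suc x \<sqsubseteq> y" by (simp add: lt_def)
qed

lemma le_total: "x \<sqsubseteq> y \<or> y \<sqsubseteq> x"
proof -
  obtain e :: "nat \<Rightarrow> 'a set" where e: "range e \<subseteq> P" by (rule obtain_env)
  have D: "Def (\<lambda>ei ep. ei 0 \<sqsubseteq> ei 1 \<or> ei 1 \<sqsubseteq> ei 0)" by (intro Def_intros)
  show ?thesis
  proof (rule Def_induct[OF D e, where ei = "\<lambda>_. y" and x = x])
    show "suc z \<sqsubseteq> y \<or> y \<sqsubseteq> suc z" if "z \<sqsubseteq> y \<or> y \<sqsubseteq> z" for z
      using that suc_le[of z y] le_suc[of z] le_trans[of y z "suc z"] by (auto simp: lt_def)
  qed (use zero_le in simp_all)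
qed

lemma suc_neq: "suc x \<noteq> x"
proof -
  obtain e :: "nat \<Rightarrow> 'a set" where e: "range e \<subseteq> P" by (rule obtain_env)
  have D: "Def (\<lambda>ei ep. \<not> (ei 0 = suc (ei 0)))" by (intro Def_intros)
  show ?thesis
    by (rule Def_induct[OF D e, where ei = "\<lambda>_. zero"]) (use suc_not_zero suc_inject in auto)
qed

sublocale ord: linorder le lt
  by unfold_locales (use le_total in \<open>auto simp: lt_def intro: le_refl le_trans le_antisym\<close>)

lemma lt_suc: "x \<sqsubset> suc x"
  using le_suc suc_neq[of x] by (auto simp: lt_def)

lemma suc_le_iff: "suc x \<sqsubseteq> y \<longleftrightarrow> x \<sqsubset> y"
  using suc_le lt_suc ord.less_le_trans by blast

lemma lt_suc_iff: "x \<sqsubset> suc y \<longleftrightarrow> x \<sqsubseteq> y"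
  using suc_le_iff ord.not_less by blast

lemma zero_or_suc: "x = zero \<or> (\<exists>y. x = suc y)"
proof -
  obtain e :: "nat \<Rightarrow> 'a set" where e: "range e \<subseteq> P" by (rule obtain_env)
  have D: "Def (\<lambda>ei ep. ei 0 = zero \<or> (\<exists>y. ei 0 = suc y))" by (intro Def_intros)
  show ?thesis by (rule Def_induct[OF D e, where ei = "\<lambda>_. zero"]) auto
qed

lemma Def_lt [Def_intros]: "Def (\<lambda>ei ep. ei a \<sqsubset> ei b)"
  unfolding lt_def by (intro Def_intros)

lemma internal_least:
  assumes "A \<in> P" "x \<in> A"
  obtains m where "m \<in> A" "\<And>y. y \<in> A \<Longrightarrow> m \<sqsubseteq> y"
proof -
  obtain e :: "nat \<Rightarrow> 'a set" where "range e \<subseteq> P" by (rule obtain_env)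
  then have e: "range (A ## e) \<subseteq> P" using assms by (simp add: range_scons)
  have D: "Def (\<lambda>ei ep. \<forall>x. x \<sqsubseteq> ei 0 \<longrightarrow> \<not> x \<in> ep 0)" by (intro Def_intros)
  have "\<exists>m\<in>A. \<forall>y\<in>A. m \<sqsubseteq> y"
  proof (rule ccontr)
    assume n: "\<not> ?thesis"
    have "\<forall>x. x \<sqsubseteq> n \<longrightarrow> x \<notin> A" for n
    proof (rule Def_induct[OF D e, where ei = "\<lambda>_. zero"])
      show "\<forall>x. x \<sqsubseteq> zero \<longrightarrow> x \<notin> A"
        using n zero_le by (auto simp: le_zero)
      fix m assume "\<forall>x. x \<sqsubseteq> m \<longrightarrow> x \<notin> A"
      then have "\<forall>x\<in>A. m \<sqsubset> x" by (auto simp: ord.not_le[symmetric])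
      then have "\<forall>x\<in>A. suc m \<sqsubseteq> x" by (simp add: suc_le_iff)
      then show "\<forall>x. x \<sqsubseteq> suc m \<longrightarrow> x \<notin> A"
        using n ord.order.antisym by blast
    qed simp
    from this[of x] show False using assms(2) by simp
  qed
  then show ?thesis using that by blast
qed

text \<open>The least upper bound belongs to \<open>A\<close>: otherwise it is a successor, and its
  predecessor would still bound \<open>A\<close>.\<close>

lemma internal_greatest:
  assumes "A \<in> P" "x \<in> A" "\<And>y. y \<in> A \<Longrightarrow> y \<sqsubseteq> b"
  obtains m where "m \<in> A" "\<And>y. y \<in> A \<Longrightarrow> y \<sqsubseteq> m"
proof -
  obtain e :: "nat \<Rightarrow> 'a set" where "range e \<subseteq> P" by (rule obtain_env)
  then have e: "range (A ## e) \<subseteq> P" using assms by (simp add: range_scons)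
  have D: "Def (\<lambda>ei ep. \<forall>x. x \<in> ep 0 \<longrightarrow> x \<sqsubseteq> ei 0)" by (intro Def_intros)
  from internalI[OF this e, of "\<lambda>_. zero"] have "{n. \<forall>x. x \<in> A \<longrightarrow> x \<sqsubseteq> n} \<in> P" by simp
  then obtain u where u: "\<And>x. x \<in> A \<Longrightarrow> x \<sqsubseteq> u" and least: "\<And>v. (\<And>x. x \<in> A \<Longrightarrow> x \<sqsubseteq> v) \<Longrightarrow> u \<sqsubseteq> v"
    by (rule internal_least[where x = b]) (use assms(3) in auto)
  have "u \<in> A"
  proof (rule ccontr)
    assume n: "u \<notin> A"
    have "u \<noteq> zero" using u[OF assms(2)] assms(2) n le_zero by auto
    then obtain v where v: "u = suc v" using zero_or_suc by blast
    have "x \<sqsubseteq> v" if "x \<in> A" for x using u[OF that] that n v le_suc_cases by blast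
    then show False using least[of v] v by (simp add: suc_le_iff)
  qed
  with u show ?thesis using that by blast
qed

text \<open>Course-of-values recursion along the model: the set is glued together from its
  approximations on initial segments.\<close>

lemma internal_recursion:
  assumes D: "Def R" and ep: "range ep \<subseteq> P"
    and local: "\<And>n G G'. G \<in> P \<Longrightarrow> G' \<in> P \<Longrightarrow> (\<And>m. m \<sqsubset> n \<Longrightarrow> m \<in> G \<longleftrightarrow> m \<in> G') \<Longrightarrow>
      R (n ## ei) (G ## ep) \<Longrightarrow> R (n ## ei) (G' ## ep)"
  obtains G where "G \<in> P" "\<And>n. n \<in> G \<longleftrightarrow> R (n ## ei) (G ## ep)"
proof -
  have local': "R (n ## ei) (G ## ep) \<longleftrightarrow> R (n ## ei) (G' ## ep)"
    if "G \<in> P" "G' \<in> P" "\<And>m. m \<sqsubset> n \<Longrightarrow> m \<in> G \<longleftrightarrow> m \<in> G'" for n G G'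
    using local[of G G' n] local[of G' G n] that by blast
  define good where "good n A \<longleftrightarrow> A \<in> P \<and> (\<forall>m. m \<sqsubseteq> n \<longrightarrow> (m \<in> A \<longleftrightarrow> R (m ## ei) (A ## ep)))" for n A
  have unique: "m \<in> A \<longleftrightarrow> m \<in> B" if "good n A" "good n' B" "m \<sqsubseteq> n" "m \<sqsubseteq> n'" for n n' A B m
  proof (rule ccontr)
    assume m: "\<not> ?thesis"
    have AB: "A \<in> P" "B \<in> P" using that by (auto simp: good_def)
    \<comment> \<open>At the first point where two approximations differ they agree on everything
      below, so locality forces agreement there as well.\<close>
    have "{x. \<not> (x \<in> A \<longleftrightarrow> x \<in> B)} \<in> P"
      by (rule internal_Collect[where R = "\<lambda>ei ep. \<not> (ei 0 \<in> ep 0 \<longleftrightarrow> ei 0 \<in> ep 1)" and ep = "A ## B ## ep"])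
        (intro Def_intros, use AB ep in \<open>simp_all add: range_scons\<close>)
    then obtain d where d: "\<not> (d \<in> A \<longleftrightarrow> d \<in> B)" "\<And>x. \<not> (x \<in> A \<longleftrightarrow> x \<in> B) \<Longrightarrow> d \<sqsubseteq> x"
      by (rule internal_least[where x = m]) (use m in simp_all)
    have "d \<sqsubseteq> m" using d(2) m by blast
    then have "d \<in> A \<longleftrightarrow> R (d ## ei) (A ## ep)" "d \<in> B \<longleftrightarrow> R (d ## ei) (B ## ep)"
      using that ord.order_trans[of d m] by (simp_all add: good_def)
    moreover have "R (d ## ei) (A ## ep) \<longleftrightarrow> R (d ## ei) (B ## ep)"
      by (rule local'[OF AB]) (meson d(2) ord.leD)
    ultimately show False using d(1) by blast
  qed
  have "Def (\<lambda>ei ep. \<exists>A\<in>P. \<forall>m. m \<sqsubseteq> ei 0 \<longrightarrow> (m \<in> A \<longleftrightarrow> R (m ## (\<lambda>i. ei (Suc i))) (A ## (\<lambda>i. ep i))))"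
    by (intro Def_intros Def_scons[OF D])
  then have D1: "Def (\<lambda>ei ep. \<exists>A\<in>P. \<forall>m. m \<sqsubseteq> ei 0 \<longrightarrow> (m \<in> A \<longleftrightarrow> R (m ## (\<lambda>i. ei (Suc i))) (A ## ep)))"
    by simp
  have "Def (\<lambda>ei ep. \<exists>A\<in>P. (\<forall>m. m \<sqsubseteq> ei 0 \<longrightarrow> (m \<in> A \<longleftrightarrow> R (m ## (\<lambda>i. ei (Suc i))) (A ## (\<lambda>i. ep i)))) \<and> ei 0 \<in> A)"
    by (intro Def_intros Def_scons[OF D])
  from internalI[OF this ep, of ei] have G: "{n. \<exists>A. good n A \<and> n \<in> A} \<in> P" (is "?G \<in> P")
    by (simp add: good_def Bex_def conj_assoc)
  have ex: "\<exists>A. good n A" for n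
  proof -
    have "\<exists>A\<in>P. \<forall>m. m \<sqsubseteq> n \<longrightarrow> (m \<in> A \<longleftrightarrow> R (m ## ei) (A ## ep))"
    proof (rule Def_induct[OF D1 ep, where ei = ei])
      define A where "A = {n. n = zero \<and> R (zero ## ei) ({} ## ep)}"
      have E: "{n. False} \<in> P"
        by (rule internal_Collect[OF Def_atoms(6)[of False] ep]) simp
      have A: "A \<in> P" unfolding A_def
        by (rule internal_Collect[OF Def_And[OF Def_atoms(4)[of 0] Def_atoms(6)[of "R (zero ## ei) ({} ## ep)"]] ep]) simp
      have "R (zero ## ei) (A ## ep) \<longleftrightarrow> R (zero ## ei) ({} ## ep)"
        by (rule local'[OF A]) (use E zero_le ord.leD in auto)
      then show "\<exists>A\<in>P. \<forall>m. m \<sqsubseteq> zero \<longrightarrow> (m \<in> A \<longleftrightarrow> R (m ## ei) (A ## ep))"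
        using A by (intro bexI[of _ A]) (simp_all add: le_zero A_def)
    next
      fix x
      assume "\<exists>A\<in>P. \<forall>m. m \<sqsubseteq> x \<longrightarrow> (m \<in> A \<longleftrightarrow> R (m ## ei) (A ## ep))"
      then obtain A where A: "A \<in> P" "\<And>m. m \<sqsubseteq> x \<Longrightarrow> m \<in> A \<longleftrightarrow> R (m ## ei) (A ## ep)" by auto
      \<comment> \<open>\<open>A\<close> is correct up to \<open>x\<close>, hence by locality it
        already decides \<open>suc x\<close>; \<open>B\<close> records that decision.\<close>
      define B where "B = {n. n \<sqsubseteq> x \<and> n \<in> A \<or> n = suc x \<and> R (suc x ## ei) (A ## ep)}"
      have "range (A ## ep) \<subseteq> P" using A ep by (simp add: range_scons)
      moreover have "Def (\<lambda>ei' ep'. ei' 0 \<sqsubseteq> ei' 1 \<and> ei' 0 \<in> ep' 0 \<or> ei' 0 = ei' 2 \<and> R (suc x ## ei) (A ## ep))"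
        by (intro Def_intros)
      ultimately have B: "B \<in> P"
        using internalI[of "\<lambda>ei' ep'. ei' 0 \<sqsubseteq> ei' 1 \<and> ei' 0 \<in> ep' 0 \<or> ei' 0 = ei' 2 \<and> R (suc x ## ei) (A ## ep)"
            "A ## ep" "x ## suc x ## ei"]
        by (simp add: B_def numeral_2_eq_2)
      have agree: "m \<in> A \<longleftrightarrow> m \<in> B" if "m \<sqsubset> suc x" for m
        using that by (auto simp: B_def lt_suc_iff suc_le_iff)
      have AB: "R (m ## ei) (A ## ep) \<longleftrightarrow> R (m ## ei) (B ## ep)" if "m \<sqsubseteq> suc x" for m
        by (rule local'[OF A(1) B]) (meson agree that ord.less_le_trans)
      have "m \<in> B \<longleftrightarrow> R (m ## ei) (B ## ep)" if m: "m \<sqsubseteq> suc x" for m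
      proof (cases "m = suc x")
        case True
        then have "m \<in> B \<longleftrightarrow> R (m ## ei) (A ## ep)" by (simp add: B_def suc_le_iff)
        then show ?thesis using AB[OF m] by simp
      next
        case False
        then have "m \<sqsubseteq> x" using m le_suc_cases by blast
        then have "m \<in> B \<longleftrightarrow> R (m ## ei) (A ## ep)" using agree[of m] A(2)[of m] by (simp add: lt_suc_iff)
        then show ?thesis using AB[OF m] by simp
      qed
      with B show "\<exists>A\<in>P. \<forall>m. m \<sqsubseteq> suc x \<longrightarrow> (m \<in> A \<longleftrightarrow> R (m ## ei) (A ## ep))"
        by auto
    qed simp
    then show ?thesis by (auto simp: good_def)
  qed
  have "n \<in> ?G \<longleftrightarrow> R (n ## ei) (?G ## ep)" for n
  proof -
    obtain A where A: "good n A" using ex by blast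
    have mem: "m \<in> ?G \<longleftrightarrow> m \<in> A" if "m \<sqsubseteq> n" for m
    proof
      assume "m \<in> ?G"
      then show "m \<in> A" using unique[OF _ A, of m _ m] that by blast
    next
      assume "m \<in> A"
      moreover have "good m A" using A that ord.order_trans by (auto simp: good_def)
      ultimately show "m \<in> ?G" by blast
    qed
    have AP: "A \<in> P" using A by (simp add: good_def)
    have "R (n ## ei) (?G ## ep) \<longleftrightarrow> R (n ## ei) (A ## ep)"
      by (rule local'[OF G AP]) (rule mem, simp add: lt_def)
    then show ?thesis using mem[of n] A by (simp add: good_def)
  qed
  with G show ?thesis by (rule that)
qed


subsection \<open>The type of a segment\<close>

definition seg :: "'a \<Rightarrow> 'a \<Rightarrow> 'a set" where
  "seg l u = {n. l \<sqsubseteq> n \<and> n \<sqsubseteq> u}"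

text \<open>The value \<open>None\<close> marks an individual variable that does not occur in the segment.\<close>

primrec val :: "fm \<Rightarrow> 'a \<Rightarrow> 'a \<Rightarrow> (nat \<Rightarrow> 'a option) \<Rightarrow> (nat \<Rightarrow> 'a set) \<Rightarrow> nat" where
  "val (Eq x y) l u ei ep = of_bool (\<exists>n\<in>seg l u. ei x = Some n \<and> ei y = Some n)"
| "val (Le x y) l u ei ep =
     (if \<exists>n\<in>seg l u. ei x = Some n \<and> (\<forall>m\<in>seg l u. ei y = Some m \<longrightarrow> n \<sqsubseteq> m) then 1
      else if \<exists>n\<in>seg l u. ei y = Some n then 2 else 0)"
| "val (Succ x y) l u ei ep = pe (of_bool (ei y = Some l)) (pe (of_bool (ei x = Some u))
     (of_bool (\<exists>n\<in>seg l u. suc n \<in> seg l u \<and> ei x = Some n \<and> ei y = Some (suc n))))"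
| "val (Zero x) l u ei ep = of_bool (ei x = Some l)"
| "val (Mem x X) l u ei ep = of_bool (\<exists>n\<in>seg l u. ei x = Some n \<and> n \<in> ep X)"
| "val Top l u ei ep = 0"
| "val Bot l u ei ep = 0"
| "val (And \<phi> \<psi>) l u ei ep = pe (val \<phi> l u ei ep) (val \<psi> l u ei ep)"
| "val (Neg \<phi>) l u ei ep = val \<phi> l u ei ep"
| "val (ExI \<phi>) l u ei ep = pe (val \<phi> l u (None ## ei) ep)
     (set_encode ((\<lambda>x. val \<phi> l u (Some x ## ei) ep) ` seg l u))"
| "val (ExP \<phi>) l u ei ep = set_encode ((\<lambda>Y. val \<phi> l u ei (Y ## ep)) ` P)"

definition vals :: "fm \<Rightarrow> nat set" where
  "vals \<phi> = {val \<phi> l u ei ep | l u ei ep. True}"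

lemma val_in_vals [simp]: "val \<phi> l u ei ep \<in> vals \<phi>"
  by (auto simp: vals_def)

text \<open>Each clause assembles a type from types for subformulae, of which there are finitely
  many. Finiteness makes \<open>set_encode\<close> faithful and supplies the pigeonholes of Ramsey's
  theorem.\<close>

lemma finite_vals: "finite (vals \<phi>)"
proof (induction \<phi>)
  case (Eq x y)
  have "vals (Eq x y) \<subseteq> {0, 1}" by (auto simp: vals_def)
  then show ?case by (rule finite_subset) simp
next
  case (Le x y)
  have "vals (Le x y) \<subseteq> {0, 1, 2}" by (auto simp: vals_def)
  then show ?case by (rule finite_subset) simp
next
  case (Succ x y)
  have "vals (Succ x y) \<subseteq> (\<lambda>(a, b, c). pe (of_bool a) (pe (of_bool b) (of_bool c))) ` UNIV"
    by (auto simp only: vals_def val.simps intro!: image_eqI[of _ _ "(_, _, _)"] split: prod.split)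
  then show ?case by (rule finite_subset) simp
next
  case (Zero x)
  have "vals (Zero x) \<subseteq> {0, 1}" by (auto simp: vals_def)
  then show ?case by (rule finite_subset) simp
next
  case (Mem x X)
  have "vals (Mem x X) \<subseteq> {0, 1}" by (auto simp: vals_def)
  then show ?case by (rule finite_subset) simp
next
  case (And \<phi> \<psi>)
  have "vals (And \<phi> \<psi>) \<subseteq> (\<lambda>(a, b). pe a b) ` (vals \<phi> \<times> vals \<psi>)"
    unfolding vals_def[of "And \<phi> \<psi>"] by auto
  then show ?case by (rule finite_subset) (use And in simp)
next
  case (Neg \<phi>)
  have "vals (Neg \<phi>) = vals \<phi>" by (simp add: vals_def)
  with Neg show ?case by simp
next
  case (ExI \<phi>)
  have "vals (ExI \<phi>) \<subseteq> (\<lambda>(a, b). pe a (set_encode b)) ` (vals \<phi> \<times> Pow (vals \<phi>))"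
  proof
    fix v assume "v \<in> vals (ExI \<phi>)"
    then obtain l u ei ep where "v = val (ExI \<phi>) l u ei ep" by (auto simp: vals_def)
    then show "v \<in> (\<lambda>(a, b). pe a (set_encode b)) ` (vals \<phi> \<times> Pow (vals \<phi>))"
      by (intro image_eqI[of _ _ "(val \<phi> l u (None ## ei) ep, (\<lambda>x. val \<phi> l u (Some x ## ei) ep) ` seg l u)"]) auto
  qed
  then show ?case by (rule finite_subset) (use ExI in simp)
next
  case (ExP \<phi>)
  have "vals (ExP \<phi>) \<subseteq> set_encode ` Pow (vals \<phi>)"
  proof
    fix v assume "v \<in> vals (ExP \<phi>)"
    then obtain l u ei ep where "v = val (ExP \<phi>) l u ei ep" by (auto simp: vals_def)
    then show "v \<in> set_encode ` Pow (vals \<phi>)"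
      by (intro image_eqI[of _ _ "(\<lambda>Y. val \<phi> l u ei (Y ## ep)) ` P"]) auto
  qed
  then show ?case by (rule finite_subset) (use ExP in simp)
qed (simp_all add: vals_def)

lemma finite_val_image [simp]: "finite ((\<lambda>x. val \<phi> (l x) (u x) (ei x) (ep x)) ` A)"
  by (rule finite_subset[OF _ finite_vals[of \<phi>]]) auto

text \<open>A variable placed outside the segment counts as absent, so \<open>Some x\<close> may be
  exchanged with \<open>None\<close> there. The segment must be nonempty because \<open>Zero\<close>
  and \<open>Succ\<close> look at its ends.\<close>

lemma val_cong:
  assumes "l \<sqsubseteq> u"
    and "\<And>i n. i \<in> fvi \<phi> \<Longrightarrow> n \<in> seg l u \<Longrightarrow> ei i = Some n \<longleftrightarrow> ei' i = Some n"
    and "\<And>j n. j \<in> fvp \<phi> \<Longrightarrow> n \<in> seg l u \<Longrightarrow> n \<in> ep j \<longleftrightarrow> n \<in> ep' j"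
  shows "val \<phi> l u ei ep = val \<phi> l u ei' ep'"
  using assms(2,3)
proof (induction \<phi> arbitrary: ei ei' ep ep')
  case (Le x y)
  have "(\<exists>n\<in>seg l u. ei x = Some n \<and> (\<forall>m\<in>seg l u. ei y = Some m \<longrightarrow> n \<sqsubseteq> m)) \<longleftrightarrow>
      (\<exists>n\<in>seg l u. ei' x = Some n \<and> (\<forall>m\<in>seg l u. ei' y = Some m \<longrightarrow> n \<sqsubseteq> m))"
    "(\<exists>n\<in>seg l u. ei y = Some n) \<longleftrightarrow> (\<exists>n\<in>seg l u. ei' y = Some n)"
    using Le.prems(1) by (simp_all cong: bex_cong ball_cong)
  then show ?case by (simp only: val.simps)
next
  case (Succ x y)
  have "l \<in> seg l u" "u \<in> seg l u" using assms(1) by (auto simp: seg_def)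
  moreover have "(\<exists>n\<in>seg l u. suc n \<in> seg l u \<and> ei x = Some n \<and> ei y = Some (suc n)) \<longleftrightarrow>
      (\<exists>n\<in>seg l u. suc n \<in> seg l u \<and> ei' x = Some n \<and> ei' y = Some (suc n))"
    using Succ.prems(1) by (auto cong: bex_cong)
  ultimately show ?case using Succ.prems(1) by simp
next
  case (Zero x)
  have "l \<in> seg l u" using assms(1) by (auto simp: seg_def)
  then show ?case using Zero.prems(1) by simp
next
  case (Eq x y)
  then show ?case by (simp cong: bex_cong)
next
  case (Mem x X)
  then show ?case by (simp cong: bex_cong)
next
  case (And \<phi> \<psi>)
  have "val \<phi> l u ei ep = val \<phi> l u ei' ep'" by (rule And.IH(1)) (use And.prems in auto)
  moreover have "val \<psi> l u ei ep = val \<psi> l u ei' ep'" by (rule And.IH(2)) (use And.prems in auto)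
  ultimately show ?case by simp
next
  case (Neg \<phi>)
  have "val \<phi> l u ei ep = val \<phi> l u ei' ep'" by (rule Neg.IH(1)) (use Neg.prems in auto)
  then show ?case by simp
next
  case (ExI \<phi>)
  have "val \<phi> l u (x ## ei) ep = val \<phi> l u (x ## ei') ep'" for x
    by (rule ExI.IH) (use ExI.prems in \<open>auto simp: scons_def split: nat.split\<close>)
  then show ?case by simp
next
  case (ExP \<phi>)
  have "val \<phi> l u ei (Y ## ep) = val \<phi> l u ei' (Y ## ep')" for Y
    by (rule ExP.IH) (use ExP.prems in \<open>auto simp: scons_def split: nat.split\<close>)
  then show ?case by simp
qed simp_all

lemma empty_internal: "{} \<in> P"
proof -
  obtain e :: "nat \<Rightarrow> 'a set" where e: "range e \<subseteq> P" by (rule obtain_env)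
  have "{n. False} \<in> P" by (rule internal_Collect[OF Def_atoms(6)[of False] e]) simp
  then show ?thesis by simp
qed

lemma UNIV_internal: "UNIV \<in> P"
proof -
  obtain e :: "nat \<Rightarrow> 'a set" where e: "range e \<subseteq> P" by (rule obtain_env)
  have "{n. True} \<in> P" by (rule internal_Collect[OF Def_atoms(6)[of True] e]) simp
  then show ?thesis by simp
qed

lemma splice_internal:
  assumes "A \<in> P" "B \<in> P"
  shows "{n. if n \<sqsubseteq> m then n \<in> A else n \<in> B} \<in> P"
proof -
  obtain e :: "nat \<Rightarrow> 'a set" where e: "range e \<subseteq> P" by (rule obtain_env)
  have "{n. (n \<sqsubseteq> m \<longrightarrow> n \<in> A) \<and> (\<not> n \<sqsubseteq> m \<longrightarrow> n \<in> B)} \<in> P"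
    by (rule internal_Collect[where ep = "A ## B ## e" and ei = "\<lambda>_. m" and
          R = "\<lambda>ei ep. (ei 0 \<sqsubseteq> ei 1 \<longrightarrow> ei 0 \<in> ep 0) \<and> (\<not> ei 0 \<sqsubseteq> ei 1 \<longrightarrow> ei 0 \<in> ep 1)"])
      (intro Def_intros, use assms e in \<open>simp_all add: range_scons\<close>)
  moreover have "{n. (n \<sqsubseteq> m \<longrightarrow> n \<in> A) \<and> (\<not> n \<sqsubseteq> m \<longrightarrow> n \<in> B)} = {n. if n \<sqsubseteq> m then n \<in> A else n \<in> B}"
    by auto
  ultimately show ?thesis by simp
qed

lemma seg_split:
  assumes "l \<sqsubseteq> m" "m \<sqsubset> u"
  shows "seg l u = seg l m \<union> seg (suc m) u"
proof (intro set_eqI iffI)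
  fix n assume "n \<in> seg l u"
  then show "n \<in> seg l m \<union> seg (suc m) u" by (auto simp: seg_def suc_le_iff ord.not_le)
next
  fix n assume "n \<in> seg l m \<union> seg (suc m) u"
  then consider "l \<sqsubseteq> n" "n \<sqsubseteq> m" | "m \<sqsubset> n" "n \<sqsubseteq> u" by (auto simp: seg_def suc_le_iff)
  then show "n \<in> seg l u"
  proof cases
    case 1
    then show ?thesis using ord.le_less_trans[OF 1(2) assms(2)] by (simp add: seg_def lt_def)
  next
    case 2
    then show ?thesis using ord.le_less_trans[OF assms(1) 2(1)] by (simp add: seg_def lt_def)
  qed
qed

lemma seg_split_less: "a \<in> seg l m \<Longrightarrow> b \<in> seg (suc m) u \<Longrightarrow> a \<sqsubset> b"
  unfolding seg_def suc_le_iff using ord.le_less_trans by blast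

text \<open>A quantified individual lies in one half and is absent from the other, whence the union
  in \<open>mul\<close>; a quantified set can be spliced from independent choices on the halves,
  whence the product.\<close>

lemma val_additive:
  assumes "l \<sqsubseteq> m" "m \<sqsubset> u"
  shows "val \<phi> l u ei ep = mul \<phi> (val \<phi> l m ei ep) (val \<phi> (suc m) u ei ep)"
proof (induction \<phi> arbitrary: ei ep)
  case (Eq x y)
  show ?case by (auto simp: seg_split[OF assms] of_bool_def max_def)
next
  case (Mem x X)
  show ?case by (auto simp: seg_split[OF assms] of_bool_def max_def)
next
  case (Le x y)
  define A B where "A = seg l m" and "B = seg (suc m) u"
  have AB: "seg l u = A \<union> B" using seg_split[OF assms] by (simp add: A_def B_def)
  have lt: "a \<sqsubseteq> b" "\<not> b \<sqsubseteq> a" if "a \<in> A" "b \<in> B" for a b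
    using seg_split_less[of a l m b u] that by (auto simp: A_def B_def ord.not_le)
  show ?case
    unfolding val.simps mul.simps AB A_def[symmetric] B_def[symmetric]
    by (cases "ei x"; cases "ei y") (auto dest: lt)
next
  case (Succ x y)
  define A B where "A = seg l m" and "B = seg (suc m) u"
  have AB: "seg l u = A \<union> B" using seg_split[OF assms] by (simp add: A_def B_def)
  have m: "m \<in> A" "suc m \<in> B" using assms by (auto simp: A_def B_def seg_def suc_le_iff lt_suc)
  \<comment> \<open>The only successor pair separated by the cut is \<open>m\<close>,
    \<open>suc m\<close>; it is detected by the two end markers whose product occurs in
    \<open>mul\<close>.\<close>
  have cross: "n \<in> A \<Longrightarrow> suc n \<in> B \<Longrightarrow> n = m" for n
    by (auto simp: A_def B_def seg_def suc_le_iff lt_suc_iff dest: ord.order.antisym)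
  moreover have "\<not> (n \<in> B \<and> suc n \<in> A)" for n
    using ord.less_asym by (auto simp: A_def B_def seg_def suc_le_iff)
  note cross = cross this
  have "(\<exists>n\<in>seg l u. suc n \<in> seg l u \<and> ei x = Some n \<and> ei y = Some (suc n)) \<longleftrightarrow>
      (\<exists>n\<in>A. suc n \<in> A \<and> ei x = Some n \<and> ei y = Some (suc n)) \<or>
      (\<exists>n\<in>B. suc n \<in> B \<and> ei x = Some n \<and> ei y = Some (suc n)) \<or> ei x = Some m \<and> ei y = Some (suc m)"
    unfolding AB using m cross by blast
  then show ?case
    by (simp add: A_def B_def)
next
  case (ExI \<phi>)
  let ?a = "\<lambda>x. val \<phi> l m (x ## ei) ep" and ?b = "\<lambda>x. val \<phi> (suc m) u (x ## ei) ep"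
  have um: "suc m \<sqsubseteq> u" using assms by (simp add: suc_le_iff)
  have a: "?b (Some x) = ?b None" if "x \<in> seg l m" for x
    by (rule val_cong[OF um]) (use that seg_split_less[of x l m x u] in \<open>auto simp: scons_def split: nat.split\<close>)
  have b: "?a (Some x) = ?a None" if "x \<in> seg (suc m) u" for x
    by (rule val_cong[OF assms(1)]) (use that seg_split_less[of x l m x u] in \<open>auto simp: scons_def split: nat.split\<close>)
  have "(\<lambda>x. val \<phi> l u (Some x ## ei) ep) ` seg l u =
      (\<lambda>x. mul \<phi> (?a (Some x)) (?b None)) ` seg l m \<union> (\<lambda>x. mul \<phi> (?a None) (?b (Some x))) ` seg (suc m) u"
    unfolding seg_split[OF assms] image_Un ExI.IH using a b by (simp cong: image_cong)
  then show ?case by (simp add: ExI.IH image_image set_encode_inverse)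
next
  case (ExP \<phi>)
  have um: "suc m \<sqsubseteq> u" using assms by (simp add: suc_le_iff)
  have "(\<lambda>Y. val \<phi> l u ei (Y ## ep)) ` P =
    (\<lambda>(c, d). mul \<phi> c d) ` ((\<lambda>Y. val \<phi> l m ei (Y ## ep)) ` P \<times> (\<lambda>Y. val \<phi> (suc m) u ei (Y ## ep)) ` P)"
    (is "?L = ?R")
  proof
    show "?L \<subseteq> ?R" unfolding ExP.IH by auto
    show "?R \<subseteq> ?L"
    proof
      fix v assume "v \<in> ?R"
      then obtain A B where AB: "A \<in> P" "B \<in> P"
        and v: "v = mul \<phi> (val \<phi> l m ei (A ## ep)) (val \<phi> (suc m) u ei (B ## ep))" by auto
      define C where "C = {n. if n \<sqsubseteq> m then n \<in> A else n \<in> B}"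
      have "val \<phi> l m ei (A ## ep) = val \<phi> l m ei (C ## ep)"
        by (rule val_cong[OF assms(1)]) (auto simp: C_def seg_def scons_def split: nat.split)
      moreover have "val \<phi> (suc m) u ei (B ## ep) = val \<phi> (suc m) u ei (C ## ep)"
        by (rule val_cong[OF um])
          (auto simp: C_def seg_def scons_def suc_le_iff ord.not_le[symmetric] split: nat.split)
      moreover have "C \<in> P" unfolding C_def using splice_internal[OF AB] .
      ultimately show "v \<in> ?L" unfolding v ExP.IH by auto
    qed
  qed
  then show ?case by (simp add: set_encode_inverse)
qed simp_all

text \<open>In the binary code of a set, doubling shifts all members up by one and adding 1 inserts
  0; this is the effect of \<open>##\<close> on the letter at \<open>n\<close>. Both letters under a
  set quantifier occur because \<open>{}\<close> and \<open>UNIV\<close> are internal.\<close>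

lemma val_letter:
  assumes "\<And>k. k \<in> set_decode i \<longleftrightarrow> ei k = Some n" "\<And>k. k \<in> set_decode j \<longleftrightarrow> n \<in> ep k"
  shows "val \<phi> n n ei ep = hval \<phi> i j"
proof -
  have seg: "seg n n = {n}" by (auto simp: seg_def)
  have suc: "suc n \<noteq> n" by (rule suc_neq)
  show ?thesis using assms
  proof (induction \<phi> arbitrary: ei ep i j)
    case (ExI \<phi>)
    have "val \<phi> n n (None ## ei) ep = hval \<phi> (2 * i) j"
      by (rule ExI.IH) (use ExI.prems in \<open>auto simp: scons_def split: nat.split\<close>)
    moreover have "val \<phi> n n (Some n ## ei) ep = hval \<phi> (2 * i + 1) j"
      by (rule ExI.IH) (use ExI.prems in \<open>auto simp: scons_def split: nat.split\<close>)
    ultimately show ?case by (simp add: seg)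
  next
    case (ExP \<phi>)
    have 0: "val \<phi> n n ei (Y ## ep) = hval \<phi> i (2 * j)" if "n \<notin> Y" for Y
      by (rule ExP.IH) (use ExP.prems that in \<open>auto simp: scons_def split: nat.split\<close>)
    have 1: "val \<phi> n n ei (Y ## ep) = hval \<phi> i (2 * j + 1)" if "n \<in> Y" for Y
      by (rule ExP.IH) (use ExP.prems that in \<open>auto simp: scons_def split: nat.split\<close>)
    have "(\<lambda>Y. val \<phi> n n ei (Y ## ep)) ` P = {hval \<phi> i (2 * j), hval \<phi> i (2 * j + 1)}"
    proof
      show "(\<lambda>Y. val \<phi> n n ei (Y ## ep)) ` P \<subseteq> {hval \<phi> i (2 * j), hval \<phi> i (2 * j + 1)}"
        using 0 1 by blast
      show "{hval \<phi> i (2 * j), hval \<phi> i (2 * j + 1)} \<subseteq> (\<lambda>Y. val \<phi> n n ei (Y ## ep)) ` P"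
        using 0[of "{}"] 1[of UNIV] empty_internal UNIV_internal by (simp add: image_iff) metis
    qed
    then show ?case by simp
  qed (simp_all add: seg suc)
qed


subsection \<open>Types are definable by bounded formulae\<close>

text \<open>The bounded analogue of \<open>Def\<close>, with similar closure properties; the
  internal constructions and the final bounded formula both draw on it.\<close>

definition bdef :: "nat \<Rightarrow> nat \<Rightarrow> ((nat \<Rightarrow> 'a) \<Rightarrow> (nat \<Rightarrow> 'a set) \<Rightarrow> bool) \<Rightarrow> bool" where
  "bdef k m R \<longleftrightarrow> (\<exists>\<theta>. bnd k m \<theta> \<and> (\<forall>ei ep. range ep \<subseteq> P \<longrightarrow> R ei ep = sat ei ep \<theta>))"

lemma bdefI: "bnd k m \<theta> \<Longrightarrow> (\<And>ei ep. range ep \<subseteq> P \<Longrightarrow> R ei ep = sat ei ep \<theta>) \<Longrightarrow> bdef k m R"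
  unfolding bdef_def by blast

lemma bdef_imp_Def: "bdef k m R \<Longrightarrow> Def R"
  unfolding bdef_def Def_def by blast

lemma bdef_const: "bdef k m (\<lambda>ei ep. c)"
  by (cases c; rule bdefI[where \<theta> = "if c then Top else Bot"]) (auto intro: bnd.intros)

lemma bdef_atoms:
  "a \<le> k \<Longrightarrow> b \<le> k \<Longrightarrow> bdef k m (\<lambda>ei ep. ei a = ei b)"
  "a \<le> k \<Longrightarrow> b \<le> k \<Longrightarrow> bdef k m (\<lambda>ei ep. ei a \<sqsubseteq> ei b)"
  "a \<le> k \<Longrightarrow> b \<le> k \<Longrightarrow> bdef k m (\<lambda>ei ep. ei b = suc (ei a))"
  "a \<le> k \<Longrightarrow> bdef k m (\<lambda>ei ep. ei a = zero)"
  "a \<le> k \<Longrightarrow> X < m \<Longrightarrow> bdef k m (\<lambda>ei ep. ei a \<in> ep X)"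
  by (rule bdefI[where \<theta> = "Eq a b"] bdefI[where \<theta> = "Le a b"] bdefI[where \<theta> = "Succ a b"]
      bdefI[where \<theta> = "Zero a"] bdefI[where \<theta> = "Mem a X"]; auto intro: bnd.intros)+

lemma bdef_Neg:
  assumes "bdef k m R"
  shows "bdef k m (\<lambda>ei ep. \<not> R ei ep)"
proof -
  obtain \<phi> where "bnd k m \<phi>" "\<forall>ei ep. range ep \<subseteq> P \<longrightarrow> R ei ep = sat ei ep \<phi>"
    using assms unfolding bdef_def by blast
  then show ?thesis by (intro bdefI[where \<theta> = "Neg \<phi>"]) (auto intro: bnd.intros)
qed

lemma bdef_And:
  assumes "bdef k m R" "bdef k m S"
  shows "bdef k m (\<lambda>ei ep. R ei ep \<and> S ei ep)"
proof -
  obtain \<phi> \<psi> where "bnd k m \<phi>" "bnd k m \<psi>" "\<forall>ei ep. range ep \<subseteq> P \<longrightarrow> R ei ep = sat ei ep \<phi>"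
    "\<forall>ei ep. range ep \<subseteq> P \<longrightarrow> S ei ep = sat ei ep \<psi>" using assms unfolding bdef_def by blast
  then show ?thesis by (intro bdefI[where \<theta> = "And \<phi> \<psi>"]) (auto intro: bnd.intros)
qed

lemma bdef_Ex:
  assumes "bdef (Suc k) m (\<lambda>ei ep. R (ei 0) (\<lambda>i. ei (Suc i)) ep)"
  shows "bdef k m (\<lambda>ei ep. \<exists>x. x \<sqsubseteq> ei k \<and> R x ei ep)"
proof -
  obtain \<phi> where "bnd (Suc k) m \<phi>"
    and *: "\<And>ei ep. range ep \<subseteq> P \<Longrightarrow> R (ei 0) (\<lambda>i. ei (Suc i)) ep = sat ei ep \<phi>"
    using assms unfolding bdef_def by blast
  then show ?thesis
    by (intro bdefI[where \<theta> = "ExI (And (Le 0 (Suc k)) \<phi>)"]) (auto intro: bnd.intros simp flip: *)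
qed

lemma bdef_ExP:
  assumes "bdef k (Suc m) (\<lambda>ei ep. R (ep 0) ei (\<lambda>i. ep (Suc i)))"
  shows "bdef k m (\<lambda>ei ep. \<exists>Y\<in>P. R Y ei ep)"
proof -
  obtain \<phi> where "bnd k (Suc m) \<phi>"
    and *: "\<And>ei ep. range ep \<subseteq> P \<Longrightarrow> R (ep 0) ei (\<lambda>i. ep (Suc i)) = sat ei ep \<phi>"
    using assms unfolding bdef_def by blast
  have "sat ei (Y ## ep) \<phi> = R Y ei ep" if "Y \<in> P" "range ep \<subseteq> P" for Y ei ep
    using *[of "Y ## ep" ei] that by (simp add: range_scons)
  with \<open>bnd k (Suc m) \<phi>\<close> show ?thesis
    by (intro bdefI[where \<theta> = "ExP \<phi>"]) (auto intro: bnd.intros)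
qed

lemma bdef_Or: "bdef k m R \<Longrightarrow> bdef k m S \<Longrightarrow> bdef k m (\<lambda>ei ep. R ei ep \<or> S ei ep)"
  using bdef_Neg[OF bdef_And[OF bdef_Neg bdef_Neg]] by (simp add: de_Morgan_conj)

lemma bdef_Iff: "bdef k m R \<Longrightarrow> bdef k m S \<Longrightarrow> bdef k m (\<lambda>ei ep. R ei ep \<longleftrightarrow> S ei ep)"
proof -
  assume "bdef k m R" "bdef k m S"
  then have "bdef k m (\<lambda>ei ep. (\<not> R ei ep \<or> S ei ep) \<and> (\<not> S ei ep \<or> R ei ep))"
    by (intro bdef_And bdef_Or bdef_Neg)
  moreover have "(\<lambda>ei ep. (\<not> R ei ep \<or> S ei ep) \<and> (\<not> S ei ep \<or> R ei ep)) = (\<lambda>ei ep. R ei ep \<longleftrightarrow> S ei ep)"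
    by (auto simp: fun_eq_iff)
  ultimately show ?thesis by simp
qed

lemma bdef_finite_Bex:
  assumes "finite V" "\<And>v. v \<in> V \<Longrightarrow> bdef k m (R v)"
  shows "bdef k m (\<lambda>ei ep. \<exists>v\<in>V. R v ei ep)"
  using assms by (induction V rule: finite_induct) (auto intro!: bdef_Or bdef_const)

lemma bdef_finite_Ball:
  assumes "finite V" "\<And>v. v \<in> V \<Longrightarrow> bdef k m (R v)"
  shows "bdef k m (\<lambda>ei ep. \<forall>v\<in>V. R v ei ep)"
  using assms by (induction V rule: finite_induct) (auto intro!: bdef_And bdef_const)

lemma bdef_of_bool: "bdef k m R \<Longrightarrow> bdef k m (\<lambda>ei ep. of_bool (R ei ep) = (s :: nat))"
proof -
  assume "bdef k m R"
  moreover have "(\<lambda>ei ep. of_bool (R ei ep) = s) = (\<lambda>ei ep. R ei ep \<and> s = 1 \<or> \<not> R ei ep \<and> s = 0)"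
    by (auto simp: fun_eq_iff)
  ultimately show ?thesis by (simp only:) (intro bdef_Or bdef_And bdef_Neg bdef_const)
qed

text \<open>A finite range \<open>V\<close> turns an equation between codes into finitely many
  membership questions.\<close>

lemma bdef_set_encode:
  assumes "finite V" "\<And>ei ep. A ei ep \<subseteq> V" "\<And>v. v \<in> V \<Longrightarrow> bdef k m (\<lambda>ei ep. v \<in> A ei ep)"
  shows "bdef k m (\<lambda>ei ep. set_encode (A ei ep) = s)"
proof -
  have "set_encode (A ei ep) = s \<longleftrightarrow> set_decode s \<subseteq> V \<and> (\<forall>v\<in>V. v \<in> A ei ep \<longleftrightarrow> v \<in> set_decode s)" for ei ep
    using set_encode_eq_iff[OF finite_subset[OF assms(2,1)], of ei ep s] assms(2)[of ei ep] by blast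
  moreover have "bdef k m (\<lambda>ei ep. set_decode s \<subseteq> V \<and> (\<forall>v\<in>V. v \<in> A ei ep \<longleftrightarrow> v \<in> set_decode s))"
    by (intro bdef_And bdef_const bdef_finite_Ball bdef_Iff assms)
  ultimately show ?thesis by simp
qed


lemma bdef_cong: "(\<And>ei ep. R ei ep = S ei ep) \<Longrightarrow> bdef k m S \<Longrightarrow> bdef k m R"
  by (simp add: bdef_def)

lemma bdef_seg: "l \<le> k \<Longrightarrow> a \<le> k \<Longrightarrow> bdef k m (\<lambda>ei ep. ei a \<in> seg (ei l) (ei k))"
  unfolding seg_def by (simp, intro bdef_And bdef_atoms) simp_all

lemma map_option_scons:
  "Some x ## (\<lambda>i. map_option ei (\<rho> i)) = (\<lambda>i. map_option (x ## ei) ((Some 0 ## (\<lambda>i. map_option Suc (\<rho> i))) i))"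
  "None ## (\<lambda>i. map_option ei (\<rho> i)) = (\<lambda>i. map_option ei ((None ## \<rho>) i))"
  by (rule ext, simp add: scons_def option.map_comp comp_def split: nat.split)+

text \<open>The bounding variable is the upper end of the segment, so quantification over its
  positions is bounded; set quantifiers carry no bound. A variable with
  \<open>\<rho> i = None\<close> is absent, which provides the first component for
  \<open>ExI\<close> without a quantifier.\<close>

lemma val_bdef:
  assumes "l \<le> k" "fvp \<phi> \<subseteq> {..<m}" "\<And>i j. i \<in> fvi \<phi> \<Longrightarrow> \<rho> i = Some j \<Longrightarrow> j \<le> k"
  shows "bdef k m (\<lambda>ei ep. val \<phi> (ei l) (ei k) (\<lambda>i. map_option ei (\<rho> i)) ep = s)"
  using assms
proof (induction \<phi> arbitrary: k l m \<rho> s)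
  case (Eq x y)
  show ?case
  proof (cases "\<rho> x = None \<or> \<rho> y = None")
    case True
    then show ?thesis by (intro bdef_cong[OF _ bdef_const[of _ _ "s = 0"]]) auto
  next
    case False
    then obtain a b where ab: "\<rho> x = Some a" "\<rho> y = Some b" by auto
    then have "a \<le> k" "b \<le> k" using Eq.prems(3) by auto
    with Eq.prems(1) have "bdef k m (\<lambda>ei ep. of_bool (ei a \<in> seg (ei l) (ei k) \<and> ei a = ei b) = s)"
      by (intro bdef_of_bool bdef_And bdef_seg bdef_atoms)
    then show ?thesis by (rule bdef_cong[rotated]) (auto simp: ab)
  qed
next
  case (Mem x X)
  show ?case
  proof (cases "\<rho> x")
    case None
    then show ?thesis by (intro bdef_cong[OF _ bdef_const[of _ _ "s = 0"]]) auto
  next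
    case (Some a)
    then have "a \<le> k" "X < m" using Mem.prems by auto
    with Mem.prems(1) have "bdef k m (\<lambda>ei ep. of_bool (ei a \<in> seg (ei l) (ei k) \<and> ei a \<in> ep X) = s)"
      by (intro bdef_of_bool bdef_And bdef_seg bdef_atoms)
    then show ?thesis by (rule bdef_cong[rotated]) (auto simp: Some)
  qed
next
  case (Zero x)
  show ?case
  proof (cases "\<rho> x")
    case None
    then show ?thesis by (intro bdef_cong[OF _ bdef_const[of _ _ "s = 0"]]) auto
  next
    case (Some a)
    then have "a \<le> k" using Zero.prems by auto
    with Zero.prems(1) have "bdef k m (\<lambda>ei ep. of_bool (ei a = ei l) = s)"
      by (intro bdef_of_bool bdef_atoms)
    then show ?thesis by (rule bdef_cong[rotated]) (auto simp: Some)
  qed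
next
  case (Le x y)
  have b: "bdef k m (\<lambda>ei ep. \<exists>n\<in>seg (ei l) (ei k). map_option ei (\<rho> z) = Some n)" if "z \<in> {x, y}" for z
  proof (cases "\<rho> z")
    case None
    then show ?thesis by (simp add: bdef_const)
  next
    case (Some a)
    then have "bdef k m (\<lambda>ei ep. ei a \<in> seg (ei l) (ei k))"
      using Le.prems that by (intro bdef_seg) auto
    then show ?thesis by (rule bdef_cong[rotated]) (auto simp: Some)
  qed
  have c: "bdef k m (\<lambda>ei ep. \<exists>n\<in>seg (ei l) (ei k). map_option ei (\<rho> x) = Some n \<and>
      (\<forall>m\<in>seg (ei l) (ei k). map_option ei (\<rho> y) = Some m \<longrightarrow> n \<sqsubseteq> m))"
  proof (cases "\<rho> x")
    case None
    then show ?thesis by (simp add: bdef_const)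
  next
    case x: (Some a)
    then have a: "a \<le> k" using Le.prems by auto
    show ?thesis
    proof (cases "\<rho> y")
      case None
      then show ?thesis using b[of x] by simp
    next
      case (Some b)
      then have "b \<le> k" using Le.prems by auto
      with a Le.prems(1)
      have "bdef k m (\<lambda>ei ep. ei a \<in> seg (ei l) (ei k) \<and> (\<not> ei b \<in> seg (ei l) (ei k) \<or> ei a \<sqsubseteq> ei b))"
        by (intro bdef_And bdef_Or bdef_Neg bdef_seg bdef_atoms)
      then show ?thesis by (rule bdef_cong[rotated]) (auto simp: x Some)
    qed
  qed
  let ?c = "\<lambda>ei (ep :: nat \<Rightarrow> 'a set). \<exists>n\<in>seg (ei l) (ei k). map_option ei (\<rho> x) = Some n \<and>
      (\<forall>m\<in>seg (ei l) (ei k). map_option ei (\<rho> y) = Some m \<longrightarrow> n \<sqsubseteq> m)"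
  let ?b = "\<lambda>ei (ep :: nat \<Rightarrow> 'a set). \<exists>n\<in>seg (ei l) (ei k). map_option ei (\<rho> y) = Some n"
  have "bdef k m (\<lambda>ei ep. ?c ei ep \<and> s = 1 \<or> \<not> ?c ei ep \<and> ?b ei ep \<and> s = 2 \<or> \<not> ?c ei ep \<and> \<not> ?b ei ep \<and> s = 0)"
    using b[of y] c by (intro bdef_Or bdef_And bdef_Neg bdef_const) simp_all
  moreover have "(if c then 1 else if b then 2 else (0 :: nat)) = s \<longleftrightarrow>
      c \<and> s = 1 \<or> \<not> c \<and> b \<and> s = 2 \<or> \<not> c \<and> \<not> b \<and> s = 0" for b c
    by auto
  ultimately show ?case by (simp only: val.simps)
next
  case (Succ x y)
  have 1: "bdef k m (\<lambda>ei ep. of_bool (map_option ei (\<rho> z) = Some (ei c)) = t)" if "z \<in> {x, y}" "c \<le> k" for z c and t :: nat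
  proof (cases "\<rho> z")
    case None
    then show ?thesis by (simp add: bdef_const)
  next
    case (Some a)
    then have "bdef k m (\<lambda>ei ep. of_bool (ei a = ei c) = t)"
      using Succ.prems that by (intro bdef_of_bool bdef_atoms) auto
    then show ?thesis by (rule bdef_cong[rotated]) (auto simp: Some)
  qed
  have 2: "bdef k m (\<lambda>ei ep. of_bool (\<exists>n\<in>seg (ei l) (ei k). suc n \<in> seg (ei l) (ei k) \<and>
      map_option ei (\<rho> x) = Some n \<and> map_option ei (\<rho> y) = Some (suc n)) = t)" for t :: nat
  proof (cases "\<rho> x = None \<or> \<rho> y = None")
    case True
    then show ?thesis by (intro bdef_cong[OF _ bdef_const[of _ _ "t = 0"]]) auto
  next
    case False
    then obtain a b where ab: "\<rho> x = Some a" "\<rho> y = Some b" by auto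
    then have "a \<le> k" "b \<le> k" using Succ.prems(3) by auto
    with Succ.prems(1)
    have "bdef k m (\<lambda>ei ep. of_bool (ei a \<in> seg (ei l) (ei k) \<and> ei b \<in> seg (ei l) (ei k) \<and> ei b = suc (ei a)) = t)"
      by (intro bdef_of_bool bdef_And bdef_seg bdef_atoms)
    then show ?thesis by (rule bdef_cong[rotated]) (auto simp: ab)
  qed
  show ?case unfolding val.simps pe_eq_iff
    using Succ.prems(1) by (intro bdef_And 1 2) simp_all
next
  case (And \<phi> \<psi>)
  show ?case unfolding val.simps pe_eq_iff
    by (intro bdef_And And.IH) (use And.prems in auto)
next
  case (Neg \<phi>)
  then show ?case by simp
next
  case (ExI \<phi>)
  have 1: "bdef k m (\<lambda>ei ep. val \<phi> (ei l) (ei k) (None ## (\<lambda>i. map_option ei (\<rho> i))) ep = t)" for t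
    unfolding map_option_scons
    by (rule ExI.IH) (use ExI.prems in \<open>auto simp: scons_def split: nat.splits\<close>)
  have 2: "bdef (Suc k) m (\<lambda>ei ep. val \<phi> (ei (Suc l)) (ei (Suc k))
      (\<lambda>i. map_option ei ((Some 0 ## (\<lambda>i. map_option Suc (\<rho> i))) i)) ep = t)" for t
    by (rule ExI.IH) (use ExI.prems in \<open>auto simp: scons_def split: nat.splits\<close>)
  have "bdef k m (\<lambda>ei ep. \<exists>x. x \<sqsubseteq> ei k \<and> ei l \<sqsubseteq> x \<and>
      val \<phi> (ei l) (ei k) (\<lambda>i. map_option (x ## ei) ((Some 0 ## (\<lambda>i. map_option Suc (\<rho> i))) i)) ep = t)" for t
    by (intro bdef_Ex bdef_And bdef_atoms) (use 2[of t] ExI.prems(1) in \<open>simp_all add: scons_eta\<close>)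
  note e = this[folded map_option_scons(1)]
  have 3: "bdef k m (\<lambda>ei ep. t \<in> (\<lambda>x. val \<phi> (ei l) (ei k) (Some x ## (\<lambda>i. map_option ei (\<rho> i))) ep) ` seg (ei l) (ei k))" for t
    using e[of t] by (rule bdef_cong[rotated]) (auto simp: seg_def)
  show ?case unfolding val.simps pe_eq_iff
    by (intro bdef_And 1 bdef_set_encode[OF finite_vals[of \<phi>]] 3) auto
next
  case (ExP \<phi>)
  have 2: "bdef k (Suc m) (\<lambda>ei ep. val \<phi> (ei l) (ei k) (\<lambda>i. map_option ei (\<rho> i)) ep = t)" for t
  proof (rule ExP.IH)
    show "fvp \<phi> \<subseteq> {..<Suc m}"
    proof
      fix n assume "n \<in> fvp \<phi>"
      then show "n \<in> {..<Suc m}" using ExP.prems(2) by (cases n) auto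
    qed
  qed (use ExP.prems in auto)
  have e: "bdef k m (\<lambda>ei ep. \<exists>Y\<in>P. val \<phi> (ei l) (ei k) (\<lambda>i. map_option ei (\<rho> i)) (Y ## ep) = t)" for t
    by (rule bdef_ExP) (use 2[of t] in \<open>simp add: scons_eta\<close>)
  have 3: "bdef k m (\<lambda>ei ep. t \<in> (\<lambda>Y. val \<phi> (ei l) (ei k) (\<lambda>i. map_option ei (\<rho> i)) (Y ## ep)) ` P)" for t
    using e[of t] by (rule bdef_cong[rotated]) auto
  show ?case unfolding val.simps
    by (intro bdef_set_encode[OF finite_vals[of \<phi>]] 3) auto
qed (simp_all add: bdef_const)

lemma val_fv:
  assumes "\<And>i. i \<in> fvi \<phi> \<Longrightarrow> ei i = ei' i" "\<And>j. j \<in> fvp \<phi> \<Longrightarrow> ep j = ep' j"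
  shows "val \<phi> l u ei ep = val \<phi> l u ei' ep'"
  using assms
proof (induction \<phi> arbitrary: ei ei' ep ep')
  case (And \<phi> \<psi>)
  have "val \<phi> l u ei ep = val \<phi> l u ei' ep'" by (rule And.IH(1)) (use And.prems in auto)
  moreover have "val \<psi> l u ei ep = val \<psi> l u ei' ep'" by (rule And.IH(2)) (use And.prems in auto)
  ultimately show ?case by simp
next
  case (Neg \<phi>)
  have "val \<phi> l u ei ep = val \<phi> l u ei' ep'" by (rule Neg.IH(1)) (use Neg.prems in auto)
  then show ?case by simp
next
  case (ExI \<phi>)
  have "val \<phi> l u (x ## ei) ep = val \<phi> l u (x ## ei') ep'" for x
    by (rule ExI.IH) (use ExI.prems in \<open>auto simp: scons_def split: nat.split\<close>)
  then show ?case by simp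
next
  case (ExP \<phi>)
  have "val \<phi> l u ei (Y ## ep) = val \<phi> l u ei' (Y ## ep')" for Y
    by (rule ExP.IH) (use ExP.prems in \<open>auto simp: scons_def split: nat.split\<close>)
  then show ?case by simp
qed simp_all

text \<open>Parameters may have any index, while \<open>val_bdef\<close> wants the index of the
  upper end to dominate the others. A fresh index \<open>N\<close> plays that part and is renamed to
  \<open>b\<close> afterwards. Of \<open>eo\<close> only the pattern of present variables
  matters.\<close>

lemma Def_val:
  "Def (\<lambda>ei ep. val \<phi> (ei a) (ei b) (\<lambda>i. map_option (\<lambda>_. ei (t i)) (eo i)) (\<lambda>j. ep (t' j)) = v)"
proof -
  obtain m where m: "fvp \<phi> \<subseteq> {..<m}" using finite_fvp[of \<phi>] by (auto simp: finite_nat_set_iff_bounded)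
  have "finite (insert a (t ` fvi \<phi>))" by (simp add: finite_fvi)
  then obtain N where N: "insert a (t ` fvi \<phi>) \<subseteq> {..<N}" unfolding finite_nat_set_iff_bounded by auto
  define \<rho> where "\<rho> i = (if i \<in> fvi \<phi> then map_option (\<lambda>_. t i) (eo i) else None)" for i
  define r where "r i = (if i = N then b else i)" for i
  have "bdef N m (\<lambda>ei ep. val \<phi> (ei a) (ei N) (\<lambda>i. map_option ei (\<rho> i)) ep = v)"
    by (rule val_bdef) (use m N in \<open>auto simp: \<rho>_def split: if_splits\<close>)
  then have "Def (\<lambda>ei ep. val \<phi> (ei (r a)) (ei (r N)) (\<lambda>i. map_option (\<lambda>j. ei (r j)) (\<rho> i)) (\<lambda>j. ep (t' j)) = v)"
    by (rule Def_ren[OF bdef_imp_Def])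
  moreover have "val \<phi> (ei (r a)) (ei (r N)) (\<lambda>i. map_option (\<lambda>j. ei (r j)) (\<rho> i)) ep' =
      val \<phi> (ei a) (ei b) (\<lambda>i. map_option (\<lambda>_. ei (t i)) (eo i)) ep'" for ei ep'
  proof -
    have "r a = a" "r N = b" using N by (auto simp: r_def)
    moreover have "val \<phi> (ei a) (ei b) (\<lambda>i. map_option (\<lambda>j. ei (r j)) (\<rho> i)) ep' =
      val \<phi> (ei a) (ei b) (\<lambda>i. map_option (\<lambda>_. ei (t i)) (eo i)) ep'"
      by (rule val_fv) (use N in \<open>auto simp: \<rho>_def r_def option.map_comp comp_def\<close>)
    ultimately show ?thesis by simp
  qed
  ultimately show ?thesis by simp
qed

lemma Def_sval:
  "Def (\<lambda>ei ep. val \<phi> (suc (ei a)) (ei b) (\<lambda>i. map_option (\<lambda>_. ei (t i)) (eo i)) (\<lambda>j. ep (t' j)) = v)"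
proof -
  have "Def (\<lambda>ei ep. \<exists>z. z = suc (ei a) \<and>
      val \<phi> z (ei b) (\<lambda>i. map_option (\<lambda>_. ei (t i)) (eo i)) (\<lambda>j. ep (t' j)) = v)"
    by (intro Def_Ex Def_And Def_atoms Def_val)
  then show ?thesis by simp
qed

lemma Def_sval_scons:
  "Def (\<lambda>ei ep. val \<phi> (suc (ei a)) (ei b) (\<lambda>i. map_option (\<lambda>_. ei (t i)) (eo i)) (ep y ## (\<lambda>j. ep (t' j))) = v)"
  using Def_sval[of \<phi> a b t eo "y ## t'" v] by (simp add: scons_comp)

text \<open>Equality of two types is a disjunction over the finitely many values.\<close>

lemma Def_sval_eq:
  "Def (\<lambda>ei ep. val \<phi> (suc (ei a)) (ei b) (\<lambda>i. map_option (\<lambda>_. ei (t i)) (eo i)) (\<lambda>j. ep (t' j))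
     = val \<phi> (suc (ei a')) (ei b) (\<lambda>i. map_option (\<lambda>_. ei (t i)) (eo i)) (\<lambda>j. ep (t' j)))"
proof -
  have "Def (\<lambda>ei ep. \<exists>v\<in>vals \<phi>.
      val \<phi> (suc (ei a)) (ei b) (\<lambda>i. map_option (\<lambda>_. ei (t i)) (eo i)) (\<lambda>j. ep (t' j)) = v \<and>
      val \<phi> (suc (ei a')) (ei b) (\<lambda>i. map_option (\<lambda>_. ei (t i)) (eo i)) (\<lambda>j. ep (t' j)) = v)"
    by (intro Def_finite_Bex finite_vals Def_And Def_sval)
  moreover have "(\<exists>v\<in>vals \<phi>. val \<phi> l u ei ep = v \<and> val \<phi> l' u' ei ep = v) \<longleftrightarrow> val \<phi> l u ei ep = val \<phi> l' u' ei ep"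
    for l u ei ep l' u'
    by (metis val_in_vals)
  ultimately show ?thesis by simp
qed


subsection \<open>Ramsey's theorem for types\<close>

definition unb :: "'a set \<Rightarrow> bool" where
  "unb H \<longleftrightarrow> (\<forall>x. \<exists>p\<in>H. x \<sqsubseteq> p)"

lemma unb_gt: "unb H \<Longrightarrow> \<exists>p\<in>H. x \<sqsubset> p"
  unfolding unb_def by (metis suc_le_iff)

lemma finite_upper: "finite A \<Longrightarrow> \<exists>b. \<forall>a\<in>A. a \<sqsubseteq> b"
proof (induction A rule: finite_induct)
  case (insert x A)
  then obtain b where b: "\<forall>a\<in>A. a \<sqsubseteq> b" by blast
  show ?case
  proof (cases "b \<sqsubseteq> x")
    case True
    then have "\<forall>a\<in>insert x A. a \<sqsubseteq> x" using b le_trans le_refl by blast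
    then show ?thesis by blast
  next
    case False
    then have "x \<sqsubseteq> b" using le_total by blast
    then have "\<forall>a\<in>insert x A. a \<sqsubseteq> b" using b by blast
    then show ?thesis by blast
  qed
qed simp

lemma unb_pigeonhole:
  assumes "unb H" "finite V" "\<And>p. p \<in> H \<Longrightarrow> g p \<in> V"
  obtains v where "unb {p \<in> H. g p = v}"
proof -
  have "\<exists>v. unb {p \<in> H. g p = v}"
  proof (rule ccontr)
    assume "\<not> ?thesis"
    then have "\<forall>v. \<exists>b. \<forall>p\<in>H. g p = v \<longrightarrow> \<not> b \<sqsubseteq> p" unfolding unb_def by blast
    then obtain b where b: "\<And>v p. p \<in> H \<Longrightarrow> g p = v \<Longrightarrow> \<not> b v \<sqsubseteq> p" by metis
    obtain B where B: "\<And>v. v \<in> V \<Longrightarrow> b v \<sqsubseteq> B" using finite_upper[of "b ` V"] assms(2) by auto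
    obtain p where "p \<in> H" "B \<sqsubseteq> p" using assms(1) unfolding unb_def by blast
    then show False using b[of p "g p"] B[OF assms(3)] le_trans by blast
  qed
  then show ?thesis using that by blast
qed

lemma option_env:
  "(\<lambda>i. map_option (\<lambda>_. case eo i of Some x \<Rightarrow> x | None \<Rightarrow> zero) (eo i)) = eo"
  by (rule ext) (simp split: option.split)

text \<open>Points \<open>p\<close> and \<open>q\<close> merge at \<open>r\<close> if the segments
  from both to \<open>r\<close> have equal type; by additivity they then stay merged. A point
  \<open>p\<close> that merges with unboundedly many others is fixed, and a later point is collected
  once all members collected before it look the same as \<open>p\<close> from there. A segment
  between two members then has the type seen from \<open>p\<close>, which pigeonholing has made
  constant. Starting inside a given \<open>H\<close> is what the set quantifier requires.\<close>

theorem ramsey: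
  assumes ep: "range ep \<subseteq> P" and H: "H \<in> P" "unb H"
  obtains H' a f where "H' \<subseteq> H" "H' \<in> P" "unb H'" "\<And>p. p \<in> H' \<Longrightarrow> val \<phi> zero p eo ep = a"
    "\<And>p q. p \<in> H' \<Longrightarrow> q \<in> H' \<Longrightarrow> p \<sqsubset> q \<Longrightarrow> val \<phi> (suc p) q eo ep = f"
proof -
  define ei where "ei i = (case eo i of Some x \<Rightarrow> x | None \<Rightarrow> zero)" for i
  have eo: "(\<lambda>i. map_option (\<lambda>_. ei i) (eo i)) = eo" unfolding ei_def by (rule option_env)
  define c where "c p q = val \<phi> (suc p) q eo ep" for p q
  have c_add: "c p r = mul \<phi> (c p q) (c q r)" if "p \<sqsubset> q" "q \<sqsubset> r" for p q r
    unfolding c_def using that by (intro val_additive) (simp add: suc_le_iff)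
  define mg where "mg p q r \<longleftrightarrow> p \<sqsubset> r \<and> q \<sqsubset> r \<and> c p r = c q r" for p q r
  have mg_up: "mg p q r'" if "mg p q r" "r \<sqsubseteq> r'" for p q r r'
  proof (cases "r = r'")
    case False
    then have "r \<sqsubset> r'" using that(2) by (simp add: lt_def)
    moreover have "p \<sqsubset> r'" "q \<sqsubset> r'" using that ord.less_le_trans unfolding mg_def by blast+
    ultimately show ?thesis using that(1) c_add[of p r r'] c_add[of q r r'] by (simp add: mg_def)
  qed (use that in simp)
  define K where "K p = {q. q \<in> H \<and> (\<exists>r. mg p q r)}" for p
  \<comment> \<open>Otherwise there are arbitrarily large finite sets of pairwise unmerged points;
    but more points than there are types cannot all look different from a common later
    position.\<close>
  have "\<exists>p\<in>H. unb (K p)"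
  proof (rule ccontr)
    assume "\<not> ?thesis"
    then have "\<forall>p. \<exists>b. p \<in> H \<longrightarrow> (\<forall>q\<in>K p. \<not> b \<sqsubseteq> q)" unfolding unb_def by blast
    then obtain b where b: "\<And>p q. p \<in> H \<Longrightarrow> q \<in> K p \<Longrightarrow> \<not> b p \<sqsubseteq> q" by metis
    have ex: "\<exists>F\<subseteq>H. finite F \<and> card F = n \<and> (\<forall>p\<in>F. \<forall>q\<in>F. p \<noteq> q \<longrightarrow> \<not> (\<exists>r. mg p q r))" for n
    proof (induction n)
      case (Suc n)
      then obtain F where F: "F \<subseteq> H" "finite F" "card F = n"
        "\<And>p q r. p \<in> F \<Longrightarrow> q \<in> F \<Longrightarrow> p \<noteq> q \<Longrightarrow> \<not> mg p q r" by blast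
      obtain B where B: "\<And>x. x \<in> F \<union> b ` F \<Longrightarrow> x \<sqsubseteq> B" using finite_upper[of "F \<union> b ` F"] F(2) by auto
      obtain q where q: "q \<in> H" "B \<sqsubset> q" using unb_gt H(2) by blast
      have "q \<notin> F" using B q(2) ord.leD by blast
      have "\<not> mg p q r" if "p \<in> F" for p r
      proof
        assume "mg p q r"
        then have "q \<in> K p" using q by (auto simp: K_def)
        then have "\<not> b p \<sqsubseteq> q" using b that F(1) by blast
        moreover have "b p \<sqsubseteq> B" using B that by blast
        ultimately show False using q(2) le_trans[of "b p" B q] by (simp add: lt_def)
      qed
      moreover from this have "\<not> mg q p r" if "p \<in> F" for p r
        using that unfolding mg_def by metis
      ultimately have "\<forall>p\<in>insert q F. \<forall>q'\<in>insert q F. p \<noteq> q' \<longrightarrow> \<not> (\<exists>r. mg p q' r)"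
        using F(4) by blast
      with F \<open>q \<notin> F\<close> q(1) show ?case by (intro exI[of _ "insert q F"]) auto
    qed (auto intro: exI[of _ "{}"])
    obtain F where F: "F \<subseteq> H" "finite F" "card F = Suc (card (vals \<phi>))"
      "\<And>p q r. p \<in> F \<Longrightarrow> q \<in> F \<Longrightarrow> p \<noteq> q \<Longrightarrow> \<not> mg p q r"
      using ex[of "Suc (card (vals \<phi>))"] by blast
    obtain B where B: "\<And>x. x \<in> F \<Longrightarrow> x \<sqsubseteq> B" using finite_upper[OF F(2)] by blast
    have "card ((\<lambda>p. c p (suc B)) ` F) \<le> card (vals \<phi>)"
      by (rule card_mono[OF finite_vals]) (auto simp: c_def)
    then have "\<not> inj_on (\<lambda>p. c p (suc B)) F" using F(3) by (intro pigeonhole) simp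
    then obtain p q where "p \<in> F" "q \<in> F" "p \<noteq> q" "c p (suc B) = c q (suc B)" by (auto simp: inj_on_def)
    then show False using F(4)[of p q "suc B"] B by (simp add: mg_def lt_suc_iff)
  qed
  then obtain p where p: "p \<in> H" "unb (K p)" by blast
  have Kint: "K p \<in> P" unfolding K_def mg_def c_def
    by (rule internal_Collect[where ep = "H ## ep" and ei = "p ## ei" and
          R = "\<lambda>ei ep. ei 0 \<in> ep 0 \<and> (\<exists>r. ei 1 \<sqsubset> r \<and> ei 0 \<sqsubset> r \<and>
            val \<phi> (suc (ei 1)) r (\<lambda>i. map_option (\<lambda>_. ei (Suc (Suc i))) (eo i)) (\<lambda>j. ep (Suc j)) =
            val \<phi> (suc (ei 0)) r (\<lambda>i. map_option (\<lambda>_. ei (Suc (Suc i))) (eo i)) (\<lambda>j. ep (Suc j)))"])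
      (intro Def_intros Def_sval_eq, use H ep in \<open>simp_all add: range_scons eo\<close>)
  have "unb {q \<in> K p. p \<sqsubset> q}"
    unfolding unb_def
  proof
    fix x
    obtain b where "x \<sqsubseteq> b" "p \<sqsubseteq> b" using le_total[of x p] le_refl by blast
    moreover obtain q where "q \<in> K p" "b \<sqsubset> q" using unb_gt p(2) by blast
    ultimately show "\<exists>q\<in>{q \<in> K p. p \<sqsubset> q}. x \<sqsubseteq> q"
      using ord.le_less_trans[of x b q] ord.le_less_trans[of p b q] by (auto simp: lt_def)
  qed
  then obtain f where f: "unb {q \<in> {q \<in> K p. p \<sqsubset> q}. c p q = f}"
    by (rule unb_pigeonhole[OF _ finite_vals[of \<phi>], where g = "c p"]) (simp only: c_def val_in_vals)
  define K1 where "K1 = {q. q \<in> K p \<and> p \<sqsubset> q \<and> c p q = f}"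
  have K1: "unb K1" using f by (simp add: K1_def conj_assoc)
  have K1int: "K1 \<in> P" unfolding K1_def c_def
    by (rule internal_Collect[where ep = "K p ## ep" and ei = "p ## ei" and
          R = "\<lambda>ei ep. ei 0 \<in> ep 0 \<and> ei 1 \<sqsubset> ei 0 \<and>
            val \<phi> (suc (ei 1)) (ei 0) (\<lambda>i. map_option (\<lambda>_. ei (Suc (Suc i))) (eo i)) (\<lambda>j. ep (Suc j)) = f"])
      (intro Def_intros Def_sval, use Kint ep in \<open>simp_all add: range_scons eo\<close>)
  \<comment> \<open>At \<open>n\<close> the condition inspects only members of \<open>G\<close>
    below \<open>n\<close>, so internal recursion applies.\<close>
  obtain G where G: "G \<in> P" "\<And>n. n \<in> G \<longleftrightarrow> n \<in> K1 \<and> (\<forall>q. q \<in> G \<longrightarrow> q \<sqsubset> n \<longrightarrow> c q n = c p n)"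
  proof -
    let ?R = "\<lambda>ei ep. ei 0 \<in> ep 1 \<and> (\<forall>q. q \<in> ep 0 \<longrightarrow> q \<sqsubset> ei 0 \<longrightarrow>
            val \<phi> (suc q) (ei 0) (\<lambda>i. map_option (\<lambda>_. ei (Suc (Suc i))) (eo i)) (\<lambda>j. ep (Suc (Suc j))) =
            val \<phi> (suc (ei 1)) (ei 0) (\<lambda>i. map_option (\<lambda>_. ei (Suc (Suc i))) (eo i)) (\<lambda>j. ep (Suc (Suc j))))"
    have R: "?R (n ## p ## ei) (G ## K1 ## ep) \<longleftrightarrow> n \<in> K1 \<and> (\<forall>q. q \<in> G \<longrightarrow> q \<sqsubset> n \<longrightarrow> c q n = c p n)" for n G
      by (simp add: eo c_def)
    have D: "Def ?R" by (intro Def_intros Def_sval_eq)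
    have E: "range (K1 ## ep) \<subseteq> P" using K1int ep by (simp add: range_scons)
    show ?thesis
    proof (rule internal_recursion[OF D E, where ei = "p ## ei", unfolded R])
      show "n \<in> K1 \<and> (\<forall>q. q \<in> G' \<longrightarrow> q \<sqsubset> n \<longrightarrow> c q n = c p n)"
        if "\<And>m. m \<sqsubset> n \<Longrightarrow> (m \<in> G) = (m \<in> G')" "n \<in> K1 \<and> (\<forall>q. q \<in> G \<longrightarrow> q \<sqsubset> n \<longrightarrow> c q n = c p n)" for n G G'
        using that by blast
    qed (rule that)
  qed
  have GK: "q \<in> K p" if "q \<in> G" for q using that G(2)[of q] by (simp add: K1_def)
  have "unb G"
  proof (rule ccontr)
    assume "\<not> unb G"
    then obtain b where b: "\<And>q. q \<in> G \<Longrightarrow> \<not> b \<sqsubseteq> q" by (auto simp: unb_def)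
    \<comment> \<open>A bounded \<open>G\<close> may still be infinite from outside, so a common
      merging point for its members comes from internal induction and not from a finite
      maximum.\<close>
    have "\<exists>r. \<forall>q. q \<in> G \<longrightarrow> q \<sqsubseteq> x \<longrightarrow> mg p q r" for x
    proof (rule Def_induct[where x = x and ep = "G ## ep" and ei = "p ## ei" and
          R = "\<lambda>ei ep. \<exists>r. \<forall>q. q \<in> ep 0 \<longrightarrow> q \<sqsubseteq> ei 0 \<longrightarrow> ei 1 \<sqsubset> r \<and> q \<sqsubset> r \<and>
            val \<phi> (suc (ei 1)) r (\<lambda>i. map_option (\<lambda>_. ei (Suc (Suc i))) (eo i)) (\<lambda>j. ep (Suc j)) =
            val \<phi> (suc q) r (\<lambda>i. map_option (\<lambda>_. ei (Suc (Suc i))) (eo i)) (\<lambda>j. ep (Suc j))"])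
      show "\<exists>r. \<forall>q. q \<in> G \<longrightarrow> q \<sqsubseteq> zero \<longrightarrow> mg p q r"
        using GK[of zero] by (auto simp: le_zero K_def)
      fix x assume "\<exists>r. \<forall>q. q \<in> G \<longrightarrow> q \<sqsubseteq> x \<longrightarrow> mg p q r"
      then obtain r where r: "\<And>q. q \<in> G \<Longrightarrow> q \<sqsubseteq> x \<Longrightarrow> mg p q r" by blast
      show "\<exists>r. \<forall>q. q \<in> G \<longrightarrow> q \<sqsubseteq> suc x \<longrightarrow> mg p q r"
      proof (cases "suc x \<in> G")
        case True
        then obtain r' where r': "mg p (suc x) r'" using GK by (auto simp: K_def)
        obtain R where R: "r \<sqsubseteq> R" "r' \<sqsubseteq> R" using le_total[of r r'] le_refl by blast
        have "mg p q R" if "q \<in> G" "q \<sqsubseteq> suc x" for q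
        proof (cases "q = suc x")
          case False
          then have "q \<sqsubseteq> x" using that le_suc_cases by blast
          then show ?thesis using mg_up[OF r R(1)] that by blast
        qed (use mg_up[OF r' R(2)] in simp)
        then show ?thesis by blast
      next
        case False
        then have "mg p q r" if "q \<in> G" "q \<sqsubseteq> suc x" for q
          using r[OF that(1)] le_suc_cases[OF that(2)] that(1) by blast
        then show ?thesis by blast
      qed
    qed (intro Def_intros Def_sval_eq, use G(1) ep in \<open>simp_all add: range_scons eo c_def mg_def\<close>)
    then obtain r where r: "\<And>q. q \<in> G \<Longrightarrow> q \<sqsubseteq> b \<Longrightarrow> mg p q r" by blast
    obtain B where B: "r \<sqsubseteq> B" "b \<sqsubseteq> B" using le_total[of r b] le_refl by blast
    obtain n where n: "n \<in> K1" "B \<sqsubseteq> n" using K1 unfolding unb_def by blast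
    have "c q n = c p n" if "q \<in> G" for q
    proof -
      have "q \<sqsubseteq> b" using b[OF that] le_total by blast
      then have "mg p q n" using mg_up[OF r[OF that] le_trans[OF B(1) n(2)]] by blast
      then show ?thesis by (simp add: mg_def)
    qed
    then have "n \<in> G" using G(2)[of n] n(1) by blast
    then show False using b le_trans[OF B(2) n(2)] by blast
  qed
  \<comment> \<open>One more thinning makes the types of the prefixes constant.\<close>
  then obtain a where a: "unb {q \<in> G. val \<phi> zero q eo ep = a}"
    by (rule unb_pigeonhole[OF _ finite_vals[of \<phi>], where g = "\<lambda>q. val \<phi> zero q eo ep"]) (simp only: val_in_vals)
  have "{q. q \<in> G \<and> val \<phi> zero q eo ep = a} \<in> P"
    by (rule internal_Collect[where ep = "G ## ep" and ei = "zero ## ei" and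
          R = "\<lambda>ei ep. ei 0 \<in> ep 0 \<and>
            val \<phi> (ei 1) (ei 0) (\<lambda>i. map_option (\<lambda>_. ei (Suc (Suc i))) (eo i)) (\<lambda>j. ep (Suc j)) = a"])
      (intro Def_intros Def_val, use G(1) ep in \<open>simp_all add: range_scons eo\<close>)
  moreover have "{q. q \<in> G \<and> val \<phi> zero q eo ep = a} \<subseteq> H" using GK by (auto simp: K_def)
  moreover have "c q q' = f" if "q \<in> G" "q' \<in> G" "q \<sqsubset> q'" for q q'
    using that G(2)[of q'] by (auto simp: K1_def)
  note hom = this
  ultimately show ?thesis
  proof (rule_tac that[of "{q. q \<in> G \<and> val \<phi> zero q eo ep = a}" a f])
    show "unb {q. q \<in> G \<and> val \<phi> zero q eo ep = a}" by (rule a)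
    show "val \<phi> (suc p) q eo ep = f"
      if "p \<in> {q. q \<in> G \<and> val \<phi> zero q eo ep = a}" "q \<in> {q. q \<in> G \<and> val \<phi> zero q eo ep = a}" "p \<sqsubset> q" for p q
      using hom[of p q] that by (simp add: c_def)
  qed simp_all
qed


subsection \<open>Truth is determined by types\<close>

text \<open>Segments start at \<open>suc p\<close>, so the prefix ending at one member and the
  segments between consecutive later members do not overlap.\<close>

definition Hom :: "fm \<Rightarrow> (nat \<Rightarrow> 'a option) \<Rightarrow> (nat \<Rightarrow> 'a set) \<Rightarrow> 'a set \<Rightarrow> nat \<Rightarrow> nat \<Rightarrow> bool" where
  "Hom \<phi> eo ep H s e \<longleftrightarrow> H \<in> P \<and> unb H \<and> (\<forall>p\<in>H. val \<phi> zero p eo ep = s) \<and>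
     (\<forall>p\<in>H. \<forall>q\<in>H. p \<sqsubset> q \<longrightarrow> val \<phi> (suc p) q eo ep = e)"

text \<open>Compare the splits at three increasing members of \<open>H\<close>.\<close>

lemma Hom_linked:
  assumes "Hom \<phi> eo ep H s e"
  shows "mul \<phi> s e = s" "mul \<phi> e e = e"
proof -
  have H: "unb H" "\<And>p. p \<in> H \<Longrightarrow> val \<phi> zero p eo ep = s"
    "\<And>p q. p \<in> H \<Longrightarrow> q \<in> H \<Longrightarrow> p \<sqsubset> q \<Longrightarrow> val \<phi> (suc p) q eo ep = e"
    using assms by (auto simp: Hom_def)
  obtain p where p: "p \<in> H" using unb_gt[OF H(1), of zero] by blast
  obtain q where q: "q \<in> H" "p \<sqsubset> q" using unb_gt[OF H(1)] by blast
  obtain r where r: "r \<in> H" "q \<sqsubset> r" using unb_gt[OF H(1)] by blast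
  have pr: "p \<sqsubset> r" using ord.less_trans[OF q(2) r(2)] .
  show "mul \<phi> s e = s"
    using val_additive[OF zero_le q(2), of \<phi> eo ep] H(2)[OF p] H(2)[OF q(1)] H(3)[OF p q] by simp
  have "suc p \<sqsubseteq> q" using q(2) by (simp add: suc_le_iff)
  from val_additive[OF this r(2), of \<phi> eo ep] show "mul \<phi> e e = e"
    using H(3)[OF p q] H(3)[OF q(1) r] H(3)[OF p r(1) pr] by simp
qed

lemma Hom_tail:
  assumes "H \<in> P" "unb H"
  shows "{p. p \<in> H \<and> p0 \<sqsubset> p} \<in> P" "unb {p. p \<in> H \<and> p0 \<sqsubset> p}"
proof -
  obtain e :: "nat \<Rightarrow> 'a set" where e: "range e \<subseteq> P" by (rule obtain_env)
  show "{p. p \<in> H \<and> p0 \<sqsubset> p} \<in> P"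
    by (rule internal_Collect[where ep = "H ## e" and ei = "\<lambda>_. p0" and R = "\<lambda>ei ep. ei 0 \<in> ep 0 \<and> ei 1 \<sqsubset> ei 0"])
      (intro Def_intros, use assms e in \<open>simp_all add: range_scons\<close>)
  show "unb {p. p \<in> H \<and> p0 \<sqsubset> p}" unfolding unb_def
  proof
    fix x
    obtain b where b: "x \<sqsubseteq> b" "p0 \<sqsubseteq> b" using le_total[of x p0] le_refl by blast
    obtain p where p: "p \<in> H" "b \<sqsubset> p" using unb_gt assms(2) by blast
    have "x \<sqsubset> p" "p0 \<sqsubset> p" using ord.le_less_trans b p(2) by blast+
    then show "\<exists>p\<in>{p. p \<in> H \<and> p0 \<sqsubset> p}. x \<sqsubseteq> p" using p(1) by (auto simp: lt_def)
  qed
qed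

text \<open>Beyond \<open>p0\<close> the new variable is absent, and the types without it are the
  first components of those for \<open>ExI \<phi>\<close>.\<close>

lemma Hom_ExI:
  assumes "Hom (ExI \<phi>) eo ep H s e" "p0 \<in> H" "x \<sqsubseteq> p0"
  shows "Hom \<phi> (Some x ## eo) ep {p. p \<in> H \<and> p0 \<sqsubset> p}
    (mul \<phi> (val \<phi> zero p0 (Some x ## eo) ep) (pfst e)) (pfst e)"
proof -
  have H: "H \<in> P" "unb H" "\<And>p q. p \<in> H \<Longrightarrow> q \<in> H \<Longrightarrow> p \<sqsubset> q \<Longrightarrow> val (ExI \<phi>) (suc p) q eo ep = e"
    using assms by (auto simp: Hom_def)
  have e: "val \<phi> (suc p) q (Some x ## eo) ep = pfst e" if "p \<in> H" "q \<in> H" "p \<sqsubset> q" "p0 \<sqsubseteq> p" for p q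
  proof -
    have "x \<sqsubset> suc p" using le_trans[OF assms(3) that(4)] by (simp add: lt_suc_iff)
    then have "x \<notin> seg (suc p) q" by (auto simp: seg_def ord.not_le)
    moreover have "suc p \<sqsubseteq> q" using that(3) by (simp add: suc_le_iff)
    ultimately have "val \<phi> (suc p) q (Some x ## eo) ep = val \<phi> (suc p) q (None ## eo) ep"
      by (intro val_cong) (auto simp: scons_def split: nat.split)
    also have "\<dots> = pfst e" using H(3)[OF that(1-3)] by auto
    finally show ?thesis .
  qed
  have "val \<phi> zero p (Some x ## eo) ep = mul \<phi> (val \<phi> zero p0 (Some x ## eo) ep) (pfst e)"
    if "p \<in> H" "p0 \<sqsubset> p" for p
    using val_additive[OF zero_le that(2), of \<phi> "Some x ## eo" ep] e[OF assms(2) that le_refl] by simp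
  moreover have "val \<phi> (suc p) q (Some x ## eo) ep = pfst e"
    if "p \<in> H" "q \<in> H" "p \<sqsubset> q" "p0 \<sqsubset> p" for p q
    using e that by (simp add: lt_def)
  ultimately show ?thesis using Hom_tail[OF H(1,2), of p0] by (simp add: Hom_def)
qed

text \<open>The choice of one set on each of the consecutive segments cut out by \<open>H\<close> is made
  position by position: a position is left out whenever the choice made so far still extends to a
  set of type \<open>f\<close>.\<close>

lemma Hom_ExP_intro:
  assumes ep: "range ep \<subseteq> P" and hom: "Hom (ExP \<phi>) eo ep H s e"
    and a: "a \<in> set_decode s" and f: "f \<in> set_decode e" and af: "mul \<phi> a f = a" and ff: "mul \<phi> f f = f"
  obtains Y where "Y \<in> P" "Hom \<phi> eo (Y ## ep) H a f"
proof -
  have H: "H \<in> P" "unb H" "\<And>p. p \<in> H \<Longrightarrow> val (ExP \<phi>) zero p eo ep = s"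
    "\<And>p q. p \<in> H \<Longrightarrow> q \<in> H \<Longrightarrow> p \<sqsubset> q \<Longrightarrow> val (ExP \<phi>) (suc p) q eo ep = e"
    using hom by (auto simp: Hom_def)
  define ei where "ei i = (case eo i of Some x \<Rightarrow> x | None \<Rightarrow> zero)" for i
  have eo: "(\<lambda>i. map_option (\<lambda>_. ei i) (eo i)) = eo" unfolding ei_def by (rule option_env)
  obtain h where "h \<in> H" using unb_gt[OF H(2), of zero] by blast
  then obtain p0 where p0: "p0 \<in> H" "\<And>p. p \<in> H \<Longrightarrow> p0 \<sqsubseteq> p" using internal_least[OF H(1)] by blast
  have "a \<in> (\<lambda>Y. val \<phi> zero p0 eo (Y ## ep)) ` P"
    using a H(3)[OF p0(1)] by (auto simp: set_encode_inverse)
  then obtain Y0 where Y0: "Y0 \<in> P" "val \<phi> zero p0 eo (Y0 ## ep) = a" by blast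
  have ex: "\<exists>Y\<in>P. val \<phi> (suc p) q eo (Y ## ep) = f" if "p \<in> H" "q \<in> H" "p \<sqsubset> q" for p q
  proof -
    have "f \<in> (\<lambda>Y. val \<phi> (suc p) q eo (Y ## ep)) ` P"
      using f H(4)[OF that] by (auto simp: set_encode_inverse)
    then show ?thesis by blast
  qed
  define nxt where "nxt p q \<longleftrightarrow> p \<in> H \<and> q \<in> H \<and> p \<sqsubset> q \<and> (\<forall>r. r \<in> H \<longrightarrow> \<not> (p \<sqsubset> r \<and> r \<sqsubset> q))" for p q
  have nxt_unique: "p = p' \<and> q = q'"
    if "nxt p q" "nxt p' q'" "p \<sqsubset> n" "n \<sqsubseteq> q" "p' \<sqsubset> n" "n \<sqsubseteq> q'" for p q p' q' n
  proof -
    have "p \<sqsubset> q'" "p' \<sqsubset> q" using that(3-6) ord.less_le_trans by blast+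
    then have "\<not> p \<sqsubset> p'" "\<not> p' \<sqsubset> p" "\<not> q \<sqsubset> q'" "\<not> q' \<sqsubset> q" using that(1,2) by (auto simp: nxt_def)
    then show ?thesis using ord.less_linear by blast
  qed
  define good where "good p q n G \<longleftrightarrow> (\<exists>Y\<in>P. (\<forall>m. p \<sqsubset> m \<longrightarrow> m \<sqsubset> n \<longrightarrow> (m \<in> Y \<longleftrightarrow> m \<in> G)) \<and> \<not> n \<in> Y \<and>
     val \<phi> (suc p) q eo (Y ## ep) = f)" for p q n G
  obtain G where G: "G \<in> P" "\<And>n. n \<in> G \<longleftrightarrow> n \<sqsubseteq> p0 \<and> n \<in> Y0 \<or>
      (\<exists>p q. nxt p q \<and> p \<sqsubset> n \<and> n \<sqsubseteq> q \<and> \<not> good p q n G)"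
  proof -
    let ?R = "\<lambda>ei ep. ei 0 \<sqsubseteq> ei 1 \<and> ei 0 \<in> ep 1 \<or>
      (\<exists>p q. (p \<in> ep 2 \<and> q \<in> ep 2 \<and> p \<sqsubset> q \<and> (\<forall>r. r \<in> ep 2 \<longrightarrow> \<not> (p \<sqsubset> r \<and> r \<sqsubset> q))) \<and> p \<sqsubset> ei 0 \<and> ei 0 \<sqsubseteq> q \<and>
        \<not> (\<exists>Y\<in>P. (\<forall>m. p \<sqsubset> m \<longrightarrow> m \<sqsubset> ei 0 \<longrightarrow> (m \<in> Y \<longleftrightarrow> m \<in> ep 0)) \<and> \<not> ei 0 \<in> Y \<and>
          val \<phi> (suc p) q (\<lambda>i. map_option (\<lambda>_. ei (Suc (Suc i))) (eo i)) (Y ## (\<lambda>j. ep (Suc (Suc (Suc j))))) = f))"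
    have R: "?R (n ## p0 ## ei) (G ## Y0 ## H ## ep) \<longleftrightarrow> n \<sqsubseteq> p0 \<and> n \<in> Y0 \<or>
      (\<exists>p q. nxt p q \<and> p \<sqsubset> n \<and> n \<sqsubseteq> q \<and> \<not> good p q n G)" for n G
      unfolding nxt_def good_def by (simp add: eo numeral_2_eq_2)
    have D: "Def ?R" by (intro Def_intros Def_sval_scons)
    have E: "range (Y0 ## H ## ep) \<subseteq> P" using Y0(1) H(1) ep by (simp add: range_scons)
    show ?thesis
    proof (rule internal_recursion[OF D E, where ei = "p0 ## ei", unfolded R])
      fix n G G'
      assume eq: "\<And>m. m \<sqsubset> n \<Longrightarrow> (m \<in> G) = (m \<in> G')"
        and g: "n \<sqsubseteq> p0 \<and> n \<in> Y0 \<or> (\<exists>p q. nxt p q \<and> p \<sqsubset> n \<and> n \<sqsubseteq> q \<and> \<not> good p q n G)"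
      have "good p q n G = good p q n G'" for p q unfolding good_def by (simp add: eq cong: conj_cong imp_cong)
      with g show "n \<sqsubseteq> p0 \<and> n \<in> Y0 \<or> (\<exists>p q. nxt p q \<and> p \<sqsubset> n \<and> n \<sqsubseteq> q \<and> \<not> good p q n G')" by simp
    qed (rule that)
  qed
  have G_seg: "n \<in> G \<longleftrightarrow> \<not> good p q n G" if "nxt p q" "p \<sqsubset> n" "n \<sqsubseteq> q" for p q n
  proof -
    have "p0 \<sqsubset> n" using p0(2)[of p] that by (meson nxt_def ord.le_less_trans)
    then have "\<not> n \<sqsubseteq> p0" by (simp add: ord.not_le)
    then have "n \<in> G \<longleftrightarrow> (\<exists>p q. nxt p q \<and> p \<sqsubset> n \<and> n \<sqsubseteq> q \<and> \<not> good p q n G)" using G(2)[of n] by blast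
    then show ?thesis using nxt_unique[OF that(1) _ that(2,3)] that by metis
  qed
  have seg_val: "val \<phi> (suc p) q eo (G ## ep) = f" if pq: "nxt p q" for p q
  proof -
    have q: "p \<sqsubset> q" "p \<in> H" "q \<in> H" using pq by (auto simp: nxt_def)
    \<comment> \<open>The invariant of the choice: what \<open>G\<close> contains up to
      \<open>n\<close> extends to a set of type \<open>f\<close>. At \<open>n = q\<close> the
      extension agrees with \<open>G\<close> on the whole segment.\<close>
    have "p \<sqsubseteq> n \<longrightarrow> n \<sqsubseteq> q \<longrightarrow> (\<exists>Y\<in>P. (\<forall>m. p \<sqsubset> m \<longrightarrow> m \<sqsubseteq> n \<longrightarrow> (m \<in> Y \<longleftrightarrow> m \<in> G)) \<and>
        val \<phi> (suc p) q eo (Y ## ep) = f)" for n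
    proof (rule Def_induct[where x = n and ep = "G ## ep" and ei = "p ## q ## ei" and
          R = "\<lambda>ei ep. ei 1 \<sqsubseteq> ei 0 \<longrightarrow> ei 0 \<sqsubseteq> ei 2 \<longrightarrow> (\<exists>Y\<in>P. (\<forall>m. ei 1 \<sqsubset> m \<longrightarrow> m \<sqsubseteq> ei 0 \<longrightarrow> (m \<in> Y \<longleftrightarrow> m \<in> ep 0)) \<and>
            val \<phi> (suc (ei 1)) (ei 2) (\<lambda>i. map_option (\<lambda>_. ei (Suc (Suc (Suc i)))) (eo i)) (Y ## (\<lambda>j. ep (Suc j))) = f)"])
      have base: "\<exists>Y\<in>P. (\<forall>m. p \<sqsubset> m \<longrightarrow> m \<sqsubseteq> n \<longrightarrow> (m \<in> Y \<longleftrightarrow> m \<in> G)) \<and> val \<phi> (suc p) q eo (Y ## ep) = f"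
        if "n \<sqsubseteq> p" for n
        using ex[OF q(2,3,1)] ord.le_less_trans[OF that] ord.leD by blast
      then show "p \<sqsubseteq> zero \<longrightarrow> zero \<sqsubseteq> q \<longrightarrow> (\<exists>Y\<in>P. (\<forall>m. p \<sqsubset> m \<longrightarrow> m \<sqsubseteq> zero \<longrightarrow> (m \<in> Y \<longleftrightarrow> m \<in> G)) \<and>
          val \<phi> (suc p) q eo (Y ## ep) = f)" using zero_le by blast
      fix n
      assume IH: "p \<sqsubseteq> n \<longrightarrow> n \<sqsubseteq> q \<longrightarrow> (\<exists>Y\<in>P. (\<forall>m. p \<sqsubset> m \<longrightarrow> m \<sqsubseteq> n \<longrightarrow> (m \<in> Y \<longleftrightarrow> m \<in> G)) \<and>
          val \<phi> (suc p) q eo (Y ## ep) = f)"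
      show "p \<sqsubseteq> suc n \<longrightarrow> suc n \<sqsubseteq> q \<longrightarrow> (\<exists>Y\<in>P. (\<forall>m. p \<sqsubset> m \<longrightarrow> m \<sqsubseteq> suc n \<longrightarrow> (m \<in> Y \<longleftrightarrow> m \<in> G)) \<and>
          val \<phi> (suc p) q eo (Y ## ep) = f)"
      proof (intro impI)
        assume 1: "p \<sqsubseteq> suc n" "suc n \<sqsubseteq> q"
        show "\<exists>Y\<in>P. (\<forall>m. p \<sqsubset> m \<longrightarrow> m \<sqsubseteq> suc n \<longrightarrow> (m \<in> Y \<longleftrightarrow> m \<in> G)) \<and> val \<phi> (suc p) q eo (Y ## ep) = f"
        proof (cases "p = suc n")
          case True
          then show ?thesis using base[of "suc n"] le_refl by simp
        next
          case False
          then have pn: "p \<sqsubset> suc n" using 1 by (simp add: lt_def)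
          have "n \<sqsubset> q" using 1(2) by (simp add: suc_le_iff)
          then obtain Y where Y: "Y \<in> P" "\<And>m. p \<sqsubset> m \<Longrightarrow> m \<sqsubseteq> n \<Longrightarrow> m \<in> Y \<longleftrightarrow> m \<in> G"
            "val \<phi> (suc p) q eo (Y ## ep) = f" using IH pn by (auto simp: lt_suc_iff lt_def[of n])
          obtain Z where Z: "Z \<in> P" "\<And>m. p \<sqsubset> m \<Longrightarrow> m \<sqsubset> suc n \<Longrightarrow> m \<in> Z \<longleftrightarrow> m \<in> G"
            "val \<phi> (suc p) q eo (Z ## ep) = f" "suc n \<in> Z \<longleftrightarrow> suc n \<in> G"
          proof (cases "good p q (suc n) G")
            case True
            moreover from this obtain Z where "Z \<in> P" "\<And>m. p \<sqsubset> m \<Longrightarrow> m \<sqsubset> suc n \<Longrightarrow> m \<in> Z \<longleftrightarrow> m \<in> G"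
              "val \<phi> (suc p) q eo (Z ## ep) = f" "suc n \<notin> Z" unfolding good_def by blast
            ultimately show ?thesis using that G_seg[OF pq pn 1(2)] by blast
          next
            case False
            then have "suc n \<in> Y" using Y unfolding good_def lt_suc_iff by blast
            then show ?thesis using that[OF Y(1) _ Y(3)] False Y(2) G_seg[OF pq pn 1(2)] by (simp add: lt_suc_iff)
          qed
          have "m \<in> Z \<longleftrightarrow> m \<in> G" if "p \<sqsubset> m" "m \<sqsubseteq> suc n" for m
            using Z(2)[OF that(1)] Z(4) that(2) by (cases "m = suc n") (simp_all add: lt_def)
          then show ?thesis using Z(1,3) by blast
        qed
      qed
    qed (intro Def_intros Def_sval_scons, use G(1) ep in \<open>simp_all add: range_scons eo numeral_2_eq_2\<close>)
    from this[of q] obtain Y where Y: "\<And>m. p \<sqsubset> m \<Longrightarrow> m \<sqsubseteq> q \<Longrightarrow> m \<in> Y \<longleftrightarrow> m \<in> G"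
      "val \<phi> (suc p) q eo (Y ## ep) = f" using q(1) le_refl by (auto simp: lt_def)
    have "val \<phi> (suc p) q eo (G ## ep) = val \<phi> (suc p) q eo (Y ## ep)"
      by (rule val_cong) (use q(1) Y(1) in \<open>auto simp: suc_le_iff seg_def scons_def split: nat.split\<close>)
    with Y(2) show ?thesis by simp
  qed
  have all_val: "val \<phi> (suc p) q eo (G ## ep) = f" if pq: "p \<in> H" "q \<in> H" "p \<sqsubset> q" for p q
  proof (rule ccontr)
    assume n: "val \<phi> (suc p) q eo (G ## ep) \<noteq> f"
    \<comment> \<open>Consecutive members are settled. For the others, the segment with the least
      offending end \<open>q1\<close> is split at the last member of \<open>H\<close> before
      \<open>q1\<close>, and \<open>mul \<phi> f f = f\<close> gives the contradiction.\<close>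
    have "{q. q \<in> H \<and> p \<sqsubset> q \<and> \<not> val \<phi> (suc p) q eo (G ## ep) = f} \<in> P"
      by (rule internal_Collect[where ep = "G ## H ## ep" and ei = "p ## ei" and
          R = "\<lambda>ei ep. ei 0 \<in> ep 1 \<and> ei 1 \<sqsubset> ei 0 \<and> \<not> val \<phi> (suc (ei 1)) (ei 0)
            (\<lambda>i. map_option (\<lambda>_. ei (Suc (Suc i))) (eo i)) (ep 0 ## (\<lambda>j. ep (Suc (Suc j)))) = f"])
        (intro Def_intros Def_sval_scons, use G(1) H(1) ep in \<open>simp_all add: range_scons eo\<close>)
    then obtain q1 where q1: "q1 \<in> H" "p \<sqsubset> q1" "val \<phi> (suc p) q1 eo (G ## ep) \<noteq> f"
      and q1_least: "\<And>r. r \<in> H \<Longrightarrow> p \<sqsubset> r \<Longrightarrow> val \<phi> (suc p) r eo (G ## ep) \<noteq> f \<Longrightarrow> q1 \<sqsubseteq> r"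
      by (rule internal_least[where x = q]) (use n pq in auto)
    obtain e' :: "nat \<Rightarrow> 'a set" where e': "range e' \<subseteq> P" by (rule obtain_env)
    have "{r. r \<in> H \<and> r \<sqsubset> q1} \<in> P"
      by (rule internal_Collect[where ep = "H ## e'" and ei = "\<lambda>_. q1" and R = "\<lambda>ei ep. ei 0 \<in> ep 0 \<and> ei 0 \<sqsubset> ei 1"])
        (intro Def_intros, use H(1) e' in \<open>simp_all add: range_scons\<close>)
    then obtain r where r: "r \<in> H" "r \<sqsubset> q1" "\<And>x. x \<in> H \<Longrightarrow> x \<sqsubset> q1 \<Longrightarrow> x \<sqsubseteq> r"
      by (rule internal_greatest[where x = p and b = q1]) (use pq q1 in \<open>auto simp: lt_def\<close>)
    have nx: "nxt r q1" unfolding nxt_def using r q1 ord.leD by blast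
    have "p \<sqsubseteq> r" using r(3)[OF pq(1) q1(2)] .
    show False
    proof (cases "p = r")
      case True
      then show False using seg_val[OF nx] q1(3) by simp
    next
      case False
      then have pr: "p \<sqsubset> r" using \<open>p \<sqsubseteq> r\<close> by (simp add: lt_def)
      have "val \<phi> (suc p) r eo (G ## ep) = f" using q1_least[OF r(1) pr] r(2) ord.leD by blast
      moreover have "suc p \<sqsubseteq> r" using pr by (simp add: suc_le_iff)
      ultimately show False
        using val_additive[OF _ r(2), of "suc p" \<phi> eo "G ## ep"] seg_val[OF nx] q1(3) ff by simp
    qed
  qed
  have v0: "val \<phi> zero p0 eo (G ## ep) = a"
  proof -
    have "n \<in> G \<longleftrightarrow> n \<in> Y0" if "n \<sqsubseteq> p0" for n
    proof -
      have "\<not> (nxt p q \<and> p \<sqsubset> n)" for p q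
        using p0(2)[of p] that ord.le_less_trans[of p0 p n] ord.leD[OF that] by (auto simp: nxt_def)
      then show ?thesis using G(2)[of n] that by blast
    qed
    then have "val \<phi> zero p0 eo (G ## ep) = val \<phi> zero p0 eo (Y0 ## ep)"
      by (intro val_cong zero_le) (auto simp: seg_def scons_def split: nat.split)
    with Y0(2) show ?thesis by simp
  qed
  have "val \<phi> zero p eo (G ## ep) = a" if "p \<in> H" for p
  proof (cases "p = p0")
    case False
    then have "p0 \<sqsubset> p" using p0(2)[OF that] by (simp add: lt_def)
    then show ?thesis
      using val_additive[OF zero_le, of p0 p \<phi> eo "G ## ep"] v0 all_val[OF p0(1) that] af by simp
  qed (simp add: v0)
  with all_val G(1) H(1,2) show ?thesis by (intro that[of G]) (auto simp: Hom_def)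
qed

text \<open>For atoms, a member of \<open>H\<close> beyond the variables decides. For
  \<open>ExP\<close>, a witness is analysed by Ramsey's theorem, and conversely
  \<open>Hom_ExP_intro\<close> realizes a linked pair of types from the coded sets by one internal
  set.\<close>

theorem acc_sat:
  assumes "range ep \<subseteq> P" "Hom \<phi> (\<lambda>i. Some (ei i)) ep H s e"
  shows "sat ei ep \<phi> \<longleftrightarrow> acc \<phi> s e"
  using assms
proof (induction \<phi> arbitrary: ei ep H s e)
  have ex: "\<exists>p\<in>H. x \<sqsubseteq> p \<and> y \<sqsubseteq> p \<and> s = val \<phi> zero p (\<lambda>i. Some (ei i)) ep"
    if hom: "Hom \<phi> (\<lambda>i. Some (ei i)) ep H s e" for \<phi> ei ep H s e x y
  proof -
    obtain b where b: "x \<sqsubseteq> b" "y \<sqsubseteq> b" using le_total[of x y] le_refl by blast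
    obtain p where p: "p \<in> H" "b \<sqsubseteq> p" using hom unfolding Hom_def unb_def by blast
    have "s = val \<phi> zero p (\<lambda>i. Some (ei i)) ep" using hom p(1) by (simp add: Hom_def)
    then show ?thesis using p(1) le_trans[OF b(1) p(2)] le_trans[OF b(2) p(2)] by blast
  qed
  {
    case (Eq x y)
    from ex[OF Eq(2), of "ei x" "ei y"] show ?case using zero_le by (auto simp: seg_def of_bool_def split: if_splits)
  next
    case (Le x y)
    from ex[OF Le(2), of "ei x" "ei y"] show ?case using zero_le by (auto simp: seg_def of_bool_def split: if_splits)
  next
    case (Succ x y)
    from ex[OF Succ(2), of "ei x" "ei y"] show ?case using zero_le by (auto simp: seg_def of_bool_def split: if_splits)
  next
    case (Zero x)
    from ex[OF Zero(2), of "ei x" "ei x"] show ?case by (auto simp: of_bool_def split: if_splits)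
  next
    case (Mem x X)
    from ex[OF Mem(2), of "ei x" "ei x"] show ?case using zero_le by (auto simp: seg_def of_bool_def split: if_splits)
  next
    case Top
    show ?case by simp
  next
    case Bot
    show ?case by simp
  next
    case (And \<phi> \<psi>)
    have "Hom \<phi> (\<lambda>i. Some (ei i)) ep H (pfst s) (pfst e)" "Hom \<psi> (\<lambda>i. Some (ei i)) ep H (psnd s) (psnd e)"
      using And.prems(2) by (auto simp: Hom_def pe_eq_iff)
    then show ?case using And.IH And.prems(1) by simp
  next
    case (Neg \<phi>)
    have "Hom \<phi> (\<lambda>i. Some (ei i)) ep H s e" using Neg.prems(2) by (simp add: Hom_def)
    then show ?case using Neg.IH Neg.prems(1) by simp
  next
    case (ExI \<phi>)
    have IH: "sat (x ## ei) ep \<phi> \<longleftrightarrow> acc \<phi> (mul \<phi> (val \<phi> zero p (Some x ## (\<lambda>i. Some (ei i))) ep) (pfst e)) (pfst e)"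
      if "p \<in> H" "x \<sqsubseteq> p" for p x
      using ExI.IH[OF ExI.prems(1), of "x ## ei"] Hom_ExI[OF ExI.prems(2) that] by (simp add: scons_comp)
    have S: "set_decode (psnd s) = (\<lambda>x. val \<phi> zero p (Some x ## (\<lambda>i. Some (ei i))) ep) ` seg zero p" if "p \<in> H" for p
      using ExI.prems(2) that by (auto simp: Hom_def set_encode_inverse)
    show ?case
    proof
      assume "sat ei ep (ExI \<phi>)"
      then obtain x where x: "sat (x ## ei) ep \<phi>" by auto
      obtain p where p: "p \<in> H" "x \<sqsubseteq> p" using ExI.prems(2) unfolding Hom_def unb_def by blast
      then have "x \<in> seg zero p" using zero_le by (simp add: seg_def)
      then show "acc (ExI \<phi>) s e" using IH[OF p] x S[OF p(1)] by auto
    next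
      assume "acc (ExI \<phi>) s e"
      then obtain a where a: "a \<in> set_decode (psnd s)" "acc \<phi> (mul \<phi> a (pfst e)) (pfst e)" by auto
      obtain p where p: "p \<in> H" using ExI.prems(2) unfolding Hom_def unb_def by blast
      then obtain x where "x \<sqsubseteq> p" "a = val \<phi> zero p (Some x ## (\<lambda>i. Some (ei i))) ep"
        using a(1) S[OF p] by (auto simp: seg_def)
      then show "sat ei ep (ExI \<phi>)" using IH[OF p] a(2) by auto
    qed
  next
    case (ExP \<phi>)
    have H: "H \<in> P" "unb H" using ExP.prems(2) by (auto simp: Hom_def)
    show ?case
    proof
      assume "sat ei ep (ExP \<phi>)"
      then obtain Y where Y: "Y \<in> P" "sat ei (Y ## ep) \<phi>" by auto
      have ep': "range (Y ## ep) \<subseteq> P" using Y(1) ExP.prems(1) by (simp add: range_scons)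
      \<comment> \<open>Staying inside \<open>H\<close> keeps the types for
        \<open>ExP \<phi>\<close> on the new segments equal to \<open>s\<close> and
        \<open>e\<close>, so \<open>a\<close> and \<open>f\<close> are members of the sets coded by
        them.\<close>
      obtain H' a f where H': "H' \<subseteq> H" "H' \<in> P" "unb H'"
        "\<And>p. p \<in> H' \<Longrightarrow> val \<phi> zero p (\<lambda>i. Some (ei i)) (Y ## ep) = a"
        "\<And>p q. p \<in> H' \<Longrightarrow> q \<in> H' \<Longrightarrow> p \<sqsubset> q \<Longrightarrow> val \<phi> (suc p) q (\<lambda>i. Some (ei i)) (Y ## ep) = f"
        using ramsey[OF ep' H, where \<phi> = \<phi> and eo = "\<lambda>i. Some (ei i)"] by blast
      then have hom: "Hom \<phi> (\<lambda>i. Some (ei i)) (Y ## ep) H' a f" by (simp add: Hom_def)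
      obtain p where p: "p \<in> H'" using H'(3) unfolding unb_def by blast
      obtain q where q: "q \<in> H'" "p \<sqsubset> q" using unb_gt[OF H'(3)] by blast
      have "s = val (ExP \<phi>) zero p (\<lambda>i. Some (ei i)) ep" "e = val (ExP \<phi>) (suc p) q (\<lambda>i. Some (ei i)) ep"
        using ExP.prems(2) H'(1) p q by (auto simp: Hom_def)
      then have "a \<in> set_decode s" "f \<in> set_decode e"
        using H'(4)[OF p] H'(5)[OF p q] Y(1) by (auto simp: set_encode_inverse)
      then show "acc (ExP \<phi>) s e"
        using Hom_linked[OF hom] ExP.IH[OF ep' hom] Y(2) by auto
    next
      assume "acc (ExP \<phi>) s e"
      then obtain a f where af: "a \<in> set_decode s" "f \<in> set_decode e" "mul \<phi> a f = a" "mul \<phi> f f = f" "acc \<phi> a f"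
        by auto
      from Hom_ExP_intro[OF ExP.prems af(1-4)]
      obtain Y where Y: "Y \<in> P" "Hom \<phi> (\<lambda>i. Some (ei i)) (Y ## ep) H a f" by blast
      moreover have "range (Y ## ep) \<subseteq> P" using Y(1) ExP.prems(1) by (simp add: range_scons)
      ultimately have "sat ei (Y ## ep) \<phi>" using ExP.IH af(5) by blast
      then show "sat ei ep (ExP \<phi>)" using Y(1) by auto
    qed
  }
qed


lemma Hom_ex:
  assumes "range ep \<subseteq> P"
  obtains H s e where "Hom \<phi> eo ep H s e"
proof -
  have "unb UNIV" using le_refl by (auto simp: unb_def)
  then show ?thesis
  proof (rule ramsey[OF assms UNIV_internal, where \<phi> = \<phi> and eo = eo])
    fix H s e
    assume "H \<in> P" "unb H" "\<And>p. p \<in> H \<Longrightarrow> val \<phi> zero p eo ep = s"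
      "\<And>p q. p \<in> H \<Longrightarrow> q \<in> H \<Longrightarrow> p \<sqsubset> q \<Longrightarrow> val \<phi> (suc p) q eo ep = e"
    then show ?thesis by (intro that[of H s e]) (simp add: Hom_def)
  qed
qed

section \<open>Segments that carry no variable\<close>

lemma val_empty_letter:
  assumes "\<And>i. i \<in> fvi \<phi> \<Longrightarrow> eo i \<noteq> Some n" "\<And>j. j \<in> fvp \<phi> \<Longrightarrow> n \<notin> ep j"
  shows "val \<phi> n n eo ep = hval \<phi> 0 0"
proof -
  have "val \<phi> n n eo ep = val \<phi> n n (\<lambda>_. None) (\<lambda>_. {})"
    by (rule val_cong[OF le_refl]) (use assms in \<open>auto simp: seg_def dest: ord.order.antisym\<close>)
  also have "\<dots> = hval \<phi> 0 0" by (rule val_letter) simp_all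
  finally show ?thesis .
qed

text \<open>Every position carries the same empty letter, and moving the end to the next position
  multiplies by it once more. The segment may have nonstandard length, yet its type is a standard
  power.\<close>

lemma val_closed_hpow:
  assumes "fvi \<phi> = {}" "fvp \<phi> = {}" "x \<sqsubseteq> y"
  shows "val \<phi> x y eo ep \<in> range (hpow \<phi>)"
proof -
  obtain e :: "nat \<Rightarrow> 'a set" where e: "range e \<subseteq> P" by (rule obtain_env)
  have eq: "val \<phi> x y eo ep = val \<phi> x y (\<lambda>i. None) e" for y
    by (rule val_fv) (use assms in auto)
  \<comment> \<open>Intersecting with \<open>vals \<phi>\<close> leaves finitely many admissible
    values, so the claim is definable and open to internal induction.\<close>
  have "x \<sqsubseteq> y \<longrightarrow> (\<exists>v\<in>vals \<phi> \<inter> range (hpow \<phi>). val \<phi> x y eo ep = v)"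
  proof (rule Def_induct[where x = y and ep = e and ei = "x ## (\<lambda>_. zero)" and
        R = "\<lambda>ei ep. ei 1 \<sqsubseteq> ei 0 \<longrightarrow> (\<exists>v\<in>vals \<phi> \<inter> range (hpow \<phi>).
          val \<phi> (ei 1) (ei 0) (\<lambda>i. map_option (\<lambda>_. ei (Suc i)) (None :: unit option)) (\<lambda>j. ep j) = v)"])
    show "Def (\<lambda>ei ep. ei 1 \<sqsubseteq> ei 0 \<longrightarrow> (\<exists>v\<in>vals \<phi> \<inter> range (hpow \<phi>).
          val \<phi> (ei 1) (ei 0) (\<lambda>i. map_option (\<lambda>_. ei (Suc i)) (None :: unit option)) (\<lambda>j. ep j) = v))"
      by (intro Def_Imp Def_atoms Def_finite_Bex Def_val finite_Int disjI1 finite_vals)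
    have letter: "val \<phi> z z eo ep = hpow \<phi> 0" for z
      using val_empty_letter[of \<phi> eo z ep] assms by simp
    have "hval \<phi> 0 0 \<in> range (hpow \<phi>)" by (rule range_eqI[of _ _ 0]) simp
    note range0 = this
    show "x \<sqsubseteq> zero \<longrightarrow> (\<exists>v\<in>vals \<phi> \<inter> range (hpow \<phi>). val \<phi> x zero eo ep = v)"
      using letter[of zero] val_in_vals[of \<phi> zero zero eo ep] range0 by (auto simp: le_zero)
    fix y assume IH: "x \<sqsubseteq> y \<longrightarrow> (\<exists>v\<in>vals \<phi> \<inter> range (hpow \<phi>). val \<phi> x y eo ep = v)"
    show "x \<sqsubseteq> suc y \<longrightarrow> (\<exists>v\<in>vals \<phi> \<inter> range (hpow \<phi>). val \<phi> x (suc y) eo ep = v)"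
    proof
      assume xy: "x \<sqsubseteq> suc y"
      have "val \<phi> x (suc y) eo ep \<in> range (hpow \<phi>)"
      proof (cases "x = suc y")
        case True
        then show ?thesis using letter range0 by simp
      next
        case False
        then have "x \<sqsubseteq> y" using le_suc_cases xy by blast
        then obtain k where "val \<phi> x y eo ep = hpow \<phi> k" using IH by auto
        then have "val \<phi> x (suc y) eo ep = hpow \<phi> (Suc k)"
          using val_additive[OF \<open>x \<sqsubseteq> y\<close> lt_suc, of \<phi> eo ep] letter[of "suc y"] by simp
        then show ?thesis by blast
      qed
      then show "\<exists>v\<in>vals \<phi> \<inter> range (hpow \<phi>). val \<phi> x (suc y) eo ep = v" by auto
    qed
  qed (simp_all add: e eq)
  then show ?thesis using assms(3) by auto
qed

end


subsection \<open>The standard model\<close>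

interpretation std: henkin "(\<le>)" "0 :: nat" Suc UNIV
proof
  show "A = UNIV" if "0 \<in> A" "\<And>x. x \<in> A \<Longrightarrow> Suc x \<in> A" for A :: "nat set"
  proof -
    have "n \<in> A" for n using that by (induction n) auto
    then show ?thesis by blast
  qed
qed auto

lemma std_lt [simp]: "std.lt x y \<longleftrightarrow> x < y"
  by (auto simp: std.lt_def)

lemma std_val_hpow:
  assumes "\<And>i n. i \<in> fvi \<phi> \<Longrightarrow> x \<le> n \<Longrightarrow> eo i \<noteq> Some n" "\<And>j n. j \<in> fvp \<phi> \<Longrightarrow> x \<le> n \<Longrightarrow> n \<notin> ep j"
  shows "std.val \<phi> x (x + k) eo ep = hpow \<phi> k"
proof (induction k)
  case 0
  show ?case using std.val_empty_letter[of \<phi> eo x ep] assms by simp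
next
  case (Suc k)
  have "std.val \<phi> (Suc (x + k)) (Suc (x + k)) eo ep = hval \<phi> 0 0"
    using assms by (intro std.val_empty_letter) auto
  then show ?case using std.val_additive[of x "x + k" "x + Suc k" \<phi> eo ep] Suc.IH by simp
qed

text \<open>In the word without variables every segment has a power as its type, so a homogeneous
  set yields an idempotent one.\<close>

lemma hpow_idempotent_ex: "\<exists>k. mul \<phi> (hpow \<phi> k) (hpow \<phi> k) = hpow \<phi> k"
proof -
  obtain H a f where hom: "std.Hom \<phi> (\<lambda>_. None) (\<lambda>_. {}) H a f" using std.Hom_ex[of "\<lambda>_. {}"] by blast
  then have H: "std.unb H" "\<And>p q. p \<in> H \<Longrightarrow> q \<in> H \<Longrightarrow> std.lt p q \<Longrightarrow> std.val \<phi> (Suc p) q (\<lambda>_. None) (\<lambda>_. {}) = f"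
    by (simp_all add: std.Hom_def)
  obtain p where p: "p \<in> H" using std.unb_gt[OF H(1), of 0] by blast
  obtain q where q: "q \<in> H" "p < q" using std.unb_gt[OF H(1), of p] by auto
  have "f = hpow \<phi> (q - Suc p)"
    using std_val_hpow[of \<phi> "Suc p" "\<lambda>_. None" "\<lambda>_. {}" "q - Suc p"] H(2)[OF p q(1)] q(2) by simp
  then show ?thesis using std.Hom_linked(2)[OF hom] by auto
qed

text \<open>After \<open>x\<close> all letters are empty. A block of \<open>k + 1\<close> of them
  has the idempotent type \<open>hpow \<phi> k\<close>, and so has any concatenation of such blocks;
  the block ends form a homogeneous set.\<close>

lemma std_tail_acc:
  assumes i: "\<And>i. i \<in> fvi \<phi> \<Longrightarrow> ei i \<le> x" and j: "\<And>j. j \<in> fvp \<phi> \<Longrightarrow> ep j \<subseteq> {..x}"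
    and idem: "mul \<phi> (hpow \<phi> k) (hpow \<phi> k) = hpow \<phi> k"
  shows "std.sat ei ep \<phi> \<longleftrightarrow> acc \<phi> (mul \<phi> (std.val \<phi> 0 x (\<lambda>i. Some (ei i)) ep) (hpow \<phi> k)) (hpow \<phi> k)"
proof -
  let ?v = "\<lambda>l u. std.val \<phi> l u (\<lambda>i. Some (ei i)) ep"
  have pow: "?v (Suc y) (Suc y + n) = hpow \<phi> n" if "x \<le> y" for y n
    by (rule std_val_hpow) (use i j that in fastforce)+
  have e: "?v (Suc y) (y + Suc k * Suc d) = hpow \<phi> k" if "x \<le> y" for y d
  proof (induction d)
    case 0
    then show ?case using pow[OF that, of k] by simp
  next
    case (Suc d)
    let ?z = "y + Suc k * Suc d"
    have "?v (Suc y) (y + Suc k * Suc (Suc d)) = mul \<phi> (?v (Suc y) ?z) (?v (Suc ?z) (y + Suc k * Suc (Suc d)))"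
      by (rule std.val_additive) auto
    moreover have "?v (Suc ?z) (y + Suc k * Suc (Suc d)) = hpow \<phi> k"
      using pow[of ?z k] that by (simp add: algebra_simps)
    ultimately show ?case using Suc.IH idem by simp
  qed
  \<comment> \<open>With \<open>Suc t\<close> blocks every prefix contains at least one, which puts
    the factor \<open>hpow \<phi> k\<close> into its type.\<close>
  define H where "H = {x + Suc k * Suc t | t. True}"
  have "std.unb H" unfolding std.unb_def
  proof
    fix n
    have "x + Suc k * Suc n \<in> H" by (auto simp: H_def)
    moreover have "n \<le> x + Suc k * Suc n" by simp
    ultimately show "\<exists>p\<in>H. n \<le> p" by blast
  qed
  moreover have "?v 0 p = mul \<phi> (?v 0 x) (hpow \<phi> k)" if pH: "p \<in> H" for p
  proof -
    obtain t where p: "p = x + Suc k * Suc t" using pH unfolding H_def by blast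
    then have "?v 0 p = mul \<phi> (?v 0 x) (?v (Suc x) p)" by (intro std.val_additive) simp_all
    then show ?thesis using e[of x t] p by simp
  qed
  moreover have "?v (Suc p) q = hpow \<phi> k" if pq: "p \<in> H" "q \<in> H" "p < q" for p q
  proof -
    obtain s t where p: "p = x + Suc k * Suc s" and q: "q = x + Suc k * Suc t"
      using pq unfolding H_def by blast
    with pq(3) have "Suc k * Suc s < Suc k * Suc t" by linarith
    then have "s < t" by (metis Suc_less_eq nat_mult_less_cancel_disj)
    then obtain d where "t = s + Suc d" using less_imp_Suc_add by auto
    then have "q = p + Suc k * Suc d" using p q by (simp add: algebra_simps)
    then show ?thesis using e[of p d] p by simp
  qed
  ultimately have "std.Hom \<phi> (\<lambda>i. Some (ei i)) ep H (mul \<phi> (?v 0 x) (hpow \<phi> k)) (hpow \<phi> k)"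
    by (simp add: std.Hom_def)
  then show ?thesis by (intro std.acc_sat) simp_all
qed

text \<open>The word is cut after position \<open>i\<close>, where the prefix type
  \<open>hpow \<phi> i\<close> absorbs \<open>hpow \<phi> k\<close>. Hence all linked pairs of
  powers give the same answer, whichever one a Henkin model happens to produce.\<close>

lemma std_linked_acc:
  assumes "fvi \<phi> = {}" "fvp \<phi> = {}" "mul \<phi> (hpow \<phi> i) (hpow \<phi> k) = hpow \<phi> i"
    and "mul \<phi> (hpow \<phi> k) (hpow \<phi> k) = hpow \<phi> k"
  shows "std.sat ei ep \<phi> \<longleftrightarrow> acc \<phi> (hpow \<phi> i) (hpow \<phi> k)"
  using std_tail_acc[of \<phi> ei i ep k] std_val_hpow[of \<phi> 0 "\<lambda>i. Some (ei i)" ep i] assms by simp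

text \<open>A single exponent is a witness, which a finite table can certify; by
  \<open>std_linked_acc\<close> all idempotent powers agree.\<close>

definition truth :: "fm \<Rightarrow> bool" where
  "truth \<phi> \<longleftrightarrow> (\<exists>k. mul \<phi> (hpow \<phi> k) (hpow \<phi> k) = hpow \<phi> k \<and> acc \<phi> (hpow \<phi> k) (hpow \<phi> k))"

lemma std_sat_iff_truth:
  assumes "fvi \<phi> = {}" "fvp \<phi> = {}"
  shows "std.sat ei ep \<phi> \<longleftrightarrow> truth \<phi>"
proof -
  obtain k where "mul \<phi> (hpow \<phi> k) (hpow \<phi> k) = hpow \<phi> k" using hpow_idempotent_ex by blast
  then show ?thesis unfolding truth_def using std_linked_acc[OF assms] by metis
qed

theorem (in henkin) sat_iff_std_sat:
  assumes "fvi \<phi> = {}" "fvp \<phi> = {}" "range ep \<subseteq> P"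
  shows "sat ei ep \<phi> \<longleftrightarrow> std.sat ei' ep' \<phi>"
proof -
  obtain H s e where hom: "Hom \<phi> (\<lambda>i. Some (ei i)) ep H s e" using Hom_ex[OF assms(3)] .
  then have H: "H \<in> P" "unb H" "\<And>p. p \<in> H \<Longrightarrow> val \<phi> zero p (\<lambda>i. Some (ei i)) ep = s"
    "\<And>p q. p \<in> H \<Longrightarrow> q \<in> H \<Longrightarrow> p \<sqsubset> q \<Longrightarrow> val \<phi> (suc p) q (\<lambda>i. Some (ei i)) ep = e"
    by (simp_all add: Hom_def)
  obtain p where p: "p \<in> H" using unb_gt[OF H(2), of zero] by blast
  obtain q where q: "q \<in> H" "p \<sqsubset> q" using unb_gt[OF H(2), of p] by auto
  have "s \<in> range (hpow \<phi>)" using val_closed_hpow[OF assms(1,2) zero_le, of p] H(3)[OF p] by metis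
  moreover have "suc p \<sqsubseteq> q" using q by (simp add: suc_le_iff)
  then have "e \<in> range (hpow \<phi>)" using val_closed_hpow[OF assms(1,2), of "suc p" q] H(4)[OF p q] by metis
  ultimately obtain i k where ik: "s = hpow \<phi> i" "e = hpow \<phi> k" by blast
  show ?thesis
    using acc_sat[OF assms(3) hom] std_linked_acc[OF assms(1,2), of i k ei' ep'] Hom_linked[OF hom] ik by simp
qed


subsection \<open>Soundness in the standard model\<close>

lemma std_sat_psub: "std.sat ei ep (psub \<sigma> \<phi>) \<longleftrightarrow> std.sat ei (\<lambda>X. {d. std.sat (d ## ei) ep (\<sigma> X)}) \<phi>"
proof (induction \<phi> arbitrary: \<sigma> ei ep)
  case (Mem x X)
  show ?case by (simp add: std.sat_ren scons_inst)
next
  case (ExI \<phi>)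
  have "(d ## x ## ei) \<circ> up Suc = d ## ei" for d x by (rule ext) (simp add: up_def scons_def split: nat.split)
  then show ?case by (simp add: ExI.IH std.sat_ren)
next
  case (ExP \<phi>)
  have "(\<lambda>X. {d. std.sat (d ## ei) (Y ## ep) (case X of 0 \<Rightarrow> Mem 0 0 | Suc Z \<Rightarrow> shiftP (\<sigma> Z))})
      = Y ## (\<lambda>X. {d. std.sat (d ## ei) ep (\<sigma> X)})" for Y
    by (rule ext) (simp add: scons_def[of Y "\<lambda>X. {d. std.sat (d ## ei) ep (\<sigma> X)}"] std.sat_ren comp_def split: nat.split)
  then show ?case by (simp only: psub.simps std.sat.simps ExP.IH)
qed simp_all

lemma soundness: "\<Gamma> \<turnstile> \<phi> \<Longrightarrow> (\<And>\<gamma>. \<gamma> \<in> set \<Gamma> \<Longrightarrow> std.sat ei ep \<gamma>) \<Longrightarrow> std.sat ei ep \<phi>"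
proof (induction arbitrary: ei ep rule: deriv.induct)
  case (Cut \<Gamma> \<phi> \<psi>)
  then show ?case by (metis set_ConsD)
next
  case (NegI \<phi> \<Gamma>)
  then show ?case by (metis set_ConsD std.sat.simps(7,9))
next
  case (ExI_I \<Gamma> t \<phi>)
  then show ?case by (auto simp: std.sat_ren scons_inst)
next
  case (ExI_E \<Gamma> \<phi> \<psi>)
  from ExI_E.IH(1)[OF ExI_E.prems] obtain x where x: "std.sat (x ## ei) ep \<phi>" by auto
  have "std.sat (x ## ei) ep (shiftI \<psi>)"
    by (rule ExI_E.IH(2)) (use x ExI_E.prems in \<open>auto simp: std.sat_ren comp_def\<close>)
  then show ?case by (simp add: std.sat_ren comp_def)
next
  case (ExP_I \<Gamma> Y \<phi>)
  from ExP_I.IH[OF ExP_I.prems] show ?case by (auto simp: std.sat_ren scons_inst)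
next
  case (ExP_E \<Gamma> \<phi> \<psi>)
  from ExP_E.IH(1)[OF ExP_E.prems] obtain x where x: "std.sat ei (x ## ep) \<phi>" by auto
  have "std.sat ei (x ## ep) (shiftP \<psi>)"
    by (rule ExP_E.IH(2)) (use x ExP_E.prems in \<open>auto simp: std.sat_ren comp_def\<close>)
  then show ?case by (simp add: std.sat_ren comp_def)
next
  case (EqSubst \<Gamma> x \<phi> y)
  from EqSubst.IH(1)[OF EqSubst.prems] EqSubst.IH(2)[OF EqSubst.prems] show ?case
    by (simp add: std.sat_ren scons_inst)
next
  case (Compr \<Gamma> \<chi> \<phi>)
  have "(\<lambda>X. {d. std.sat (d ## ei) ep (case X of 0 \<Rightarrow> \<chi> | Suc Y \<Rightarrow> Mem 0 Y)}) = {d. std.sat (d ## ei) ep \<chi>} ## ep"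
    by (rule ext) (simp add: scons_def[of "{d. std.sat (d ## ei) ep \<chi>}" ep] split: nat.split)
  with Compr.IH[OF Compr.prems] have "std.sat ei ({d. std.sat (d ## ei) ep \<chi>} ## ep) \<phi>"
    by (simp only: comp_inst_def std_sat_psub)
  then show ?case by auto
next
  case (Induct \<Gamma> \<phi> x)
  have "std.sat (n ## ei) ep \<phi>" for n
  proof (induction n)
    case 0
    show ?case by (rule Induct.IH(1)) (use Induct.prems in \<open>auto simp: std.sat_ren comp_def\<close>)
  next
    case (Suc n)
    have "std.sat (Suc n ## n ## ei) ep (ren (up Suc) id \<phi>)"
      by (rule Induct.IH(2)) (use Induct.prems Suc.IH in \<open>auto simp: std.sat_ren comp_def\<close>)
    moreover have "(Suc n ## n ## ei) \<circ> up Suc = Suc n ## ei" by (rule ext) (simp add: up_def scons_def split: nat.split)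
    ultimately show ?case by (simp add: std.sat_ren)
  qed
  then show ?case by (simp add: std.sat_ren scons_inst)
next
  case (LeSucc \<Gamma> y y' x)
  from LeSucc.IH(1-3)[OF LeSucc.prems] show ?case by auto
qed (fastforce simp: le_antisym)+


subsection \<open>Bounded equivalents of causal formulae\<close>

lemma funpow_AllP_fv:
  "fvp ((AllP ^^ q) \<phi>) = {n. n + q \<in> fvp \<phi>}" "fvi ((AllP ^^ q) \<phi>) = fvi \<phi>"
  by (induction q) auto

lemma std_sat_AllP:
  "std.sat ei ep ((AllP ^^ q) \<phi>) \<longleftrightarrow> (\<forall>f. std.sat ei (\<lambda>n. if n < q then f n else ep (n - q)) \<phi>)"
proof (induction q arbitrary: ep)
  case (Suc q)
  have eq: "(\<lambda>n. if n < q then f n else (f q ## ep) (n - q)) = (\<lambda>n. if n < Suc q then f n else ep (n - Suc q))" for f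
  proof
    fix n
    show "(if n < q then f n else (f q ## ep) (n - q)) = (if n < Suc q then f n else ep (n - Suc q))"
    proof (cases "n \<le> q")
      case False
      then obtain d where "n = Suc (q + d)" using less_imp_Suc_add[of q n] by auto
      then show ?thesis by (simp add: Suc_diff_le)
    qed auto
  qed
  have "std.sat ei ep ((AllP ^^ Suc q) \<phi>) \<longleftrightarrow>
      (\<forall>Y f. std.sat ei (\<lambda>n. if n < q then f n else (Y ## ep) (n - q)) \<phi>)"
    by (simp add: Suc.IH)
  also have "\<dots> \<longleftrightarrow> (\<forall>f. std.sat ei (\<lambda>n. if n < q then f n else (f q ## ep) (n - q)) \<phi>)"
  proof (intro iffI allI)
    fix Y f assume "\<forall>f. std.sat ei (\<lambda>n. if n < q then f n else (f q ## ep) (n - q)) \<phi>"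
    from this[rule_format, of "f(q := Y)"] show "std.sat ei (\<lambda>n. if n < q then f n else (Y ## ep) (n - q)) \<phi>"
      by (simp cong: if_cong)
  qed simp
  finally show ?case by (simp only: eq)
qed simp

lemma std_sat_BigAnd: "std.sat ei ep (BigAnd \<phi>s) \<longleftrightarrow> (\<forall>\<phi>\<in>set \<phi>s. std.sat ei ep \<phi>)"
  by (induction \<phi>s) (simp_all add: BigAnd_def)

lemma std_causalD:
  assumes causal: "MSO (causal q \<psi>)" and fvp: "fvp \<psi> \<subseteq> {..<q}" and fvi: "fvi \<psi> \<subseteq> {0}"
    and agree: "\<And>j y. j < q \<Longrightarrow> y \<le> ei 0 \<Longrightarrow> y \<in> Z j \<longleftrightarrow> y \<in> Z' j"
  shows "std.sat ei Z \<psi> \<longleftrightarrow> std.sat ei Z' \<psi>"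
proof -
  define x where "x = ei 0"
  \<comment> \<open>The values of the two quantifier blocks: \<open>Z'\<close> below
    \<open>q\<close>, then \<open>Z\<close>. Later indices are not free in the matrix and get the
    default \<open>{}\<close>.\<close>
  define E where "E n = (if n < q then Z' n else if n - q < q then Z (n - q) else {})" for n
  have "std.sat ei (\<lambda>_. {}) (causal q \<psi>)" by (rule soundness[OF causal]) simp
  then have "std.sat (x ## ei) (\<lambda>n. if n < q then Z' n else if n - q < q then Z (n - q) else {})
    (Imp (BigAnd (map (\<lambda>i. AllI (Imp (Le 0 1) (Iff (Mem 0 (q + i)) (Mem 0 i)))) [0..<q]))
       (Iff (ren id (\<lambda>i. q + i) \<psi>) (ren id (\<lambda>i. i) \<psi>)))"
    unfolding causal_def std.sat.simps std_sat_AllP by blast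
  then have "std.sat (x ## ei) E
    (Imp (BigAnd (map (\<lambda>i. AllI (Imp (Le 0 1) (Iff (Mem 0 (q + i)) (Mem 0 i)))) [0..<q]))
       (Iff (ren id (\<lambda>i. q + i) \<psi>) (ren id (\<lambda>i. i) \<psi>)))"
    by (simp only: E_def[abs_def])
  moreover have "std.sat (x ## ei) E (BigAnd (map (\<lambda>i. AllI (Imp (Le 0 1) (Iff (Mem 0 (q + i)) (Mem 0 i)))) [0..<q]))"
    using agree by (auto simp: std_sat_BigAnd E_def x_def)
  ultimately have "std.sat (x ## ei) E (ren id (\<lambda>i. q + i) \<psi>) \<longleftrightarrow> std.sat (x ## ei) E (ren id (\<lambda>i. i) \<psi>)"
    unfolding std.sat.simps by blast
  moreover have "std.sat (x ## ei) E (ren id (\<lambda>i. q + i) \<psi>) \<longleftrightarrow> std.sat ei Z \<psi>"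
    unfolding std.sat_ren by (rule std.sat_cong) (use fvi fvp in \<open>auto simp: x_def E_def\<close>)
  moreover have "std.sat (x ## ei) E (ren id (\<lambda>i. i) \<psi>) \<longleftrightarrow> std.sat ei Z' \<psi>"
    unfolding std.sat_ren by (rule std.sat_cong) (use fvi fvp in \<open>auto simp: x_def E_def\<close>)
  ultimately show ?thesis by simp
qed

text \<open>\<open>V\<close> collects the types of \<open>[0, x]\<close> that become accepted when
  an empty tail follows. The number \<open>m\<close> of set variables is kept apart from
  \<open>q\<close>, since the search knows only \<psi>.\<close>

theorem bounded_equivalent_ex:
  assumes causal: "MSO (causal q \<psi>)" and fvp: "fvp \<psi> \<subseteq> {..<q}" and fvi: "fvi \<psi> \<subseteq> {0}"
    and m: "fvp \<psi> \<subseteq> {..<m}"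
  shows "\<exists>\<phi>. bnd 0 m \<phi> \<and> (\<forall>ei ep. std.sat ei ep \<psi> \<longleftrightarrow> std.sat ei ep \<phi>)"
proof -
  obtain k where idem: "mul \<psi> (hpow \<psi> k) (hpow \<psi> k) = hpow \<psi> k" using hpow_idempotent_ex by blast
  define V where "V = {v \<in> std.vals \<psi>. acc \<psi> (mul \<psi> v (hpow \<psi> k)) (hpow \<psi> k)}"
  have "finite V" unfolding V_def using std.finite_vals by simp
  \<comment> \<open>There is no term for zero, so the lower end of the segment enters through a
    quantifier, which may be bounded by x because zero is least.\<close>
  have "std.bdef 0 m (\<lambda>ei ep. \<exists>l. l \<le> ei 0 \<and> l = 0 \<and>
      (\<exists>v\<in>V. std.val \<psi> l (ei 0) (\<lambda>i. map_option (\<lambda>_. ei 0) (Some 0)) ep = v))"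
  proof (intro std.bdef_Ex std.bdef_And std.bdef_finite_Bex \<open>finite V\<close>)
    show "std.bdef (Suc 0) m (\<lambda>ei ep. ei 0 = 0)" by (rule std.bdef_atoms) simp
    show "std.bdef (Suc 0) m (\<lambda>ei ep. std.val \<psi> (ei 0) (ei (Suc 0)) (\<lambda>i. map_option (\<lambda>_. ei (Suc 0)) (Some 0)) ep = v)" for v
      using std.val_bdef[of 0 "Suc 0" \<psi> m "\<lambda>_. Some (Suc 0)" v] m by simp
  qed
  then obtain \<phi> where \<phi>: "bnd 0 m \<phi>" "\<And>ei ep. (\<exists>v\<in>V. std.val \<psi> 0 (ei 0) (\<lambda>i. Some (ei 0)) ep = v) \<longleftrightarrow> std.sat ei ep \<phi>"
    unfolding std.bdef_def by auto
  have "std.sat ei ep \<psi> \<longleftrightarrow> std.sat ei ep \<phi>" for ei ep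
  proof -
    define Z where "Z j = ep j \<inter> {..ei 0}" for j
    have "std.sat ei ep \<psi> \<longleftrightarrow> std.sat ei Z \<psi>"
      by (rule std_causalD[OF causal fvp fvi]) (simp add: Z_def)
    also have "\<dots> \<longleftrightarrow> acc \<psi> (mul \<psi> (std.val \<psi> 0 (ei 0) (\<lambda>i. Some (ei i)) Z) (hpow \<psi> k)) (hpow \<psi> k)"
      by (rule std_tail_acc[OF _ _ idem]) (use fvi in \<open>auto simp: Z_def\<close>)
    \<comment> \<open>Only index 0 is free, so all variables may be placed at \<open>ei 0\<close>;
      up to there \<open>Z\<close> and \<open>ep\<close> agree.\<close>
    also have "std.val \<psi> 0 (ei 0) (\<lambda>i. Some (ei i)) Z = std.val \<psi> 0 (ei 0) (\<lambda>i. Some (ei 0)) ep"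
      by (rule std.val_cong) (use fvi in \<open>auto simp: Z_def std.seg_def\<close>)
    finally show ?thesis using \<phi>(2)[of ei ep] by (auto simp: V_def)
  qed
  with \<phi>(1) show ?thesis by blast
qed

subsection \<open>Computable functions and decidable relations of environments\<close>

text \<open>Environments list the arguments of a function, so that a bounded quantifier or a local
  definition is treated by shifting the environment by one position.\<close>

definition cf :: "((nat \<Rightarrow> nat) \<Rightarrow> nat) \<Rightarrow> bool" where
  "cf f \<longleftrightarrow> (\<exists>n\<^sub>0. \<forall>n\<ge>n\<^sub>0. \<exists>F. \<forall>e. computes F (map e [0..<n]) (f e))"

definition cd :: "((nat \<Rightarrow> nat) \<Rightarrow> bool) \<Rightarrow> bool" where
  "cd R \<longleftrightarrow> cf (\<lambda>e. of_bool (R e))"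

named_theorems cf_intros

lemma cfI: "(\<And>n. n \<ge> n\<^sub>0 \<Longrightarrow> \<exists>F. \<forall>e. computes F (map e [0..<n]) (f e)) \<Longrightarrow> cf f"
  unfolding cf_def by blast

lemma cf_var [cf_intros]: "cf (\<lambda>e. e i)"
proof (rule cfI[of "Suc i"])
  fix n assume "n \<ge> Suc i"
  then have "computes (Proj i) (map e [0..<n]) (e i)" for e
    using computes.intros(3)[of i "map e [0..<n]"] by simp
  then show "\<exists>F. \<forall>e. computes F (map e [0..<n]) (e i)" by blast
qed

lemma cf_Suc [cf_intros]:
  assumes "cf f"
  shows "cf (\<lambda>e. Suc (f e))"
proof -
  obtain n\<^sub>0 where n0: "\<And>n. n \<ge> n\<^sub>0 \<Longrightarrow> \<exists>F. \<forall>e. computes F (map e [0..<n]) (f e)"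
    using assms unfolding cf_def by blast
  show ?thesis
  proof (rule cfI[of n\<^sub>0])
    fix n assume "n \<ge> n\<^sub>0"
    then obtain F where F: "\<And>e. computes F (map e [0..<n]) (f e)" using n0 by blast
    have "computes (Comp SucF [F]) (map e [0..<n]) (Suc (f e))" for e
      using computes.intros(4)[of "[f e]" "[F]" "map e [0..<n]" SucF "Suc (f e)"] F
      by (simp add: computes.intros)
    then show "\<exists>F. \<forall>e. computes F (map e [0..<n]) (Suc (f e))" by blast
  qed
qed

lemma cf_0: "cf (\<lambda>e. 0)"
  by (rule cfI) (auto intro: computes.intros)

lemma cf_const [cf_intros]: "cf (\<lambda>e. c)"
  by (induction c) (auto intro: cf_0 cf_Suc)

lemma map_scons_upt: "map (x ## e) [0..<Suc n] = x # map e [0..<n]"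
  by (simp add: map_upt_Suc del: upt_Suc)

lemma computes_Comp_Cons:
  assumes "computes B (map e [0..<n]) b" "computes F (b # map e [0..<n]) y"
  shows "computes (Comp F (B # map Proj [0..<n])) (map e [0..<n]) y"
proof (rule computes.intros(4)[where ys = "b # map e [0..<n]"])
  show "\<forall>i<length (B # map Proj [0..<n]).
      computes ((B # map Proj [0..<n]) ! i) (map e [0..<n]) ((b # map e [0..<n]) ! i)"
    using assms(1) computes.intros(3)[of _ "map e [0..<n]"] by (auto simp: nth_Cons split: nat.split)
qed (use assms in simp_all)

lemma cf_subst:
  assumes "cf f" "\<And>i. cf (s i)"
  shows "cf (\<lambda>e. f (\<lambda>i. s i e))"
proof -
  obtain n F where F: "\<And>e. computes F (map e [0..<n]) (f e)" using assms unfolding cf_def by blast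
  have "\<forall>i. \<exists>n\<^sub>0. \<forall>n\<ge>n\<^sub>0. \<exists>F. \<forall>e. computes F (map e [0..<n]) (s i e)" using assms(2) unfolding cf_def by blast
  then obtain N where N: "\<And>i n. n \<ge> N i \<Longrightarrow> \<exists>F. \<forall>e. computes F (map e [0..<n]) (s i e)" by metis
  show ?thesis
  proof (rule cfI[of "Max (insert 0 (N ` {..<n}))"])
    fix m assume m: "m \<ge> Max (insert 0 (N ` {..<n}))"
    have "\<forall>i<n. \<exists>F. \<forall>e. computes F (map e [0..<m]) (s i e)"
      using N m by (simp add: Max_le_iff)
    then obtain G where G: "\<And>i e. i < n \<Longrightarrow> computes (G i) (map e [0..<m]) (s i e)" by metis
    have "computes (Comp F (map G [0..<n])) (map e [0..<m]) (f (\<lambda>i. s i e))" for e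
      by (rule computes.intros(4)[where ys = "map (\<lambda>i. s i e) [0..<n]"]) (use F G in simp_all)
    then show "\<exists>F. \<forall>e. computes F (map e [0..<m]) (f (\<lambda>i. s i e))" by blast
  qed
qed

lemma cf_ren: "cf b \<Longrightarrow> cf (\<lambda>e. b (\<lambda>i. e (s i)))"
  using cf_subst[of b "\<lambda>i e. e (s i)"] cf_var by blast

lemma cf_let:
  assumes "cf b" "cf (\<lambda>e. g (e 0) (\<lambda>i. e (Suc i)))"
  shows "cf (\<lambda>e. g (b e) e)"
proof -
  obtain n\<^sub>0 where n0: "\<And>n. n \<ge> n\<^sub>0 \<Longrightarrow> \<exists>F. \<forall>e. computes F (map e [0..<n]) (b e)"
    using assms unfolding cf_def by blast
  obtain n\<^sub>1 where n1: "\<And>n. n \<ge> n\<^sub>1 \<Longrightarrow> \<exists>F. \<forall>e. computes F (map e [0..<n]) (g (e 0) (\<lambda>i. e (Suc i)))"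
    using assms unfolding cf_def by blast
  show ?thesis
  proof (rule cfI[of "max n\<^sub>0 n\<^sub>1"])
    fix n assume n: "n \<ge> max n\<^sub>0 n\<^sub>1"
    then obtain B where B: "\<And>e. computes B (map e [0..<n]) (b e)" using n0[of n] by auto
    have "Suc n \<ge> n\<^sub>1" using n by simp
    then obtain G where G: "\<And>e. computes G (map e [0..<Suc n]) (g (e 0) (\<lambda>i. e (Suc i)))" using n1 by blast
    have "computes (Comp G (B # map Proj [0..<n])) (map e [0..<n]) (g (b e) e)" for e
      using computes_Comp_Cons[OF B] G[of "b e ## e"] by (simp only: map_scons_upt scons_simps scons_tail)
    then show "\<exists>F. \<forall>e. computes F (map e [0..<n]) (g (b e) e)" by blast
  qed
qed

lemma cf_rec:
  assumes "cf b" "cf f" "cf (\<lambda>e. g (e 0) (e (Suc 0)) (\<lambda>i. e (Suc (Suc i))))"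
  shows "cf (\<lambda>e. rec_nat (f e) (\<lambda>n y. g n y e) (b e))"
proof -
  \<comment> \<open>\<open>PrimRec\<close> expects its counter as the first argument;
    \<open>cf_let\<close> then feeds in the value of \<open>b\<close>.\<close>
  have "cf (\<lambda>e. rec_nat (f (\<lambda>i. e (Suc i))) (\<lambda>n y. g n y (\<lambda>i. e (Suc i))) (e 0))"
  proof -
    obtain n\<^sub>0 where n0: "\<And>n. n \<ge> n\<^sub>0 \<Longrightarrow> \<exists>F. \<forall>e. computes F (map e [0..<n]) (f e)"
      using assms unfolding cf_def by blast
    obtain n\<^sub>1 where n1: "\<And>n. n \<ge> n\<^sub>1 \<Longrightarrow> \<exists>F. \<forall>e. computes F (map e [0..<n]) (g (e 0) (e (Suc 0)) (\<lambda>i. e (Suc (Suc i))))"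
      using assms unfolding cf_def by blast
    show ?thesis
    proof (rule cfI[of "Suc (max n\<^sub>0 n\<^sub>1)"])
      fix n' assume "n' \<ge> Suc (max n\<^sub>0 n\<^sub>1)"
      then obtain n where n: "n' = Suc n" "n \<ge> max n\<^sub>0 n\<^sub>1" by (cases n') auto
      obtain F where F: "\<And>e. computes F (map e [0..<n]) (f e)" using n0[of n] n by auto
      have "Suc (Suc n) \<ge> n\<^sub>1" using n by simp
      then obtain G where G: "\<And>e. computes G (map e [0..<Suc (Suc n)]) (g (e 0) (e (Suc 0)) (\<lambda>i. e (Suc (Suc i))))"
        using n1 by blast
      have "computes (PrimRec F G) (k # map e [0..<n]) (rec_nat (f e) (\<lambda>n y. g n y e) k)" for k e
      proof (induction k)
        case 0
        then show ?case using F by (auto intro: computes.intros)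
      next
        case (Suc k)
        then show ?case using G[of "k ## rec_nat (f e) (\<lambda>n y. g n y e) k ## e"]
          by (auto simp only: map_scons_upt scons_simps nat.rec scons_tail intro: computes.intros)
      qed
      then have "computes (PrimRec F G) (map e [0..<n']) (rec_nat (f (\<lambda>i. e (Suc i))) (\<lambda>n y. g n y (\<lambda>i. e (Suc i))) (e 0))" for e
        by (simp add: n(1) map_upt_Suc del: upt_Suc)
      then show "\<exists>F. \<forall>e. computes F (map e [0..<n']) (rec_nat (f (\<lambda>i. e (Suc i))) (\<lambda>n y. g n y (\<lambda>i. e (Suc i))) (e 0))"
        by blast
    qed
  qed
  from cf_let[OF assms(1), where g = "\<lambda>k e. rec_nat (f e) (\<lambda>n y. g n y e) k", OF this] show ?thesis .
qed

lemma cf_add [cf_intros]: "cf a \<Longrightarrow> cf b \<Longrightarrow> cf (\<lambda>e. a e + b e)"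
proof -
  assume "cf a" "cf b"
  then have "cf (\<lambda>e. rec_nat (b e) (\<lambda>n y. Suc y) (a e))" by (intro cf_rec cf_intros)
  moreover have "rec_nat y (\<lambda>n y. Suc y) x = x + y" for x y by (induction x) auto
  ultimately show ?thesis by simp
qed

lemma cf_mult [cf_intros]: "cf a \<Longrightarrow> cf b \<Longrightarrow> cf (\<lambda>e. a e * b e)"
proof -
  assume a: "cf a" and b: "cf b"
  have "cf (\<lambda>e. rec_nat 0 (\<lambda>n y. y + b e) (a e))" by (intro cf_rec a cf_ren[OF b] cf_intros)
  moreover have "rec_nat 0 (\<lambda>n z. z + y) x = x * y" for x y :: nat by (induction x) auto
  ultimately show ?thesis by simp
qed

lemma cf_pred: "cf a \<Longrightarrow> cf (\<lambda>e. a e - 1)"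
proof -
  assume a: "cf a"
  have "cf (\<lambda>e. rec_nat 0 (\<lambda>n y. n) (a e))" by (intro cf_rec a cf_intros)
  moreover have "rec_nat 0 (\<lambda>n z. n) x = x - 1" for x :: nat by (cases x) auto
  ultimately show ?thesis by simp
qed

lemma cf_diff [cf_intros]: "cf a \<Longrightarrow> cf b \<Longrightarrow> cf (\<lambda>e. a e - b e)"
proof -
  assume a: "cf a" and b: "cf b"
  have "cf (\<lambda>e. rec_nat (a e) (\<lambda>n y. y - 1) (b e))" by (intro cf_rec a b cf_pred cf_intros)
  moreover have "rec_nat y (\<lambda>n z. z - 1) x = y - x" for x y :: nat by (induction x) auto
  ultimately show ?thesis by simp
qed

lemma cf_if [cf_intros]: "cd R \<Longrightarrow> cf a \<Longrightarrow> cf b \<Longrightarrow> cf (\<lambda>e. if R e then a e else b e)"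
proof -
  assume R: "cd R" and a: "cf a" and b: "cf b"
  have "cf (\<lambda>e. rec_nat (b e) (\<lambda>n y. a e) (of_bool (R e)))"
    by (intro cf_rec b cf_ren[OF a] R[unfolded cd_def])
  moreover have "rec_nat x (\<lambda>n z. y) (of_bool c) = (if c then y else x)" for x y :: nat and c by simp
  ultimately show ?thesis by simp
qed

lemma cf_of_bool [cf_intros]: "cd R \<Longrightarrow> cf (\<lambda>e. of_bool (R e))"
  by (simp add: cd_def)

lemma cd_not [cf_intros]: "cd R \<Longrightarrow> cd (\<lambda>e. \<not> R e)"
proof -
  assume "cd R"
  then have "cf (\<lambda>e. if R e then 0 else 1)" by (intro cf_if cf_const)
  moreover have "(\<lambda>e. if R e then 0 else 1 :: nat) = (\<lambda>e. of_bool (\<not> R e))" by auto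
  ultimately show ?thesis by (simp add: cd_def)
qed

lemma cd_and [cf_intros]: "cd R \<Longrightarrow> cd S \<Longrightarrow> cd (\<lambda>e. R e \<and> S e)"
proof -
  assume "cd R" "cd S"
  then have "cf (\<lambda>e. if R e then of_bool (S e) else 0)" by (intro cf_if cf_of_bool cf_const)
  moreover have "(\<lambda>e. if R e then of_bool (S e) else 0 :: nat) = (\<lambda>e. of_bool (R e \<and> S e))" by auto
  ultimately show ?thesis by (simp add: cd_def)
qed

lemma cd_or [cf_intros]: "cd R \<Longrightarrow> cd S \<Longrightarrow> cd (\<lambda>e. R e \<or> S e)"
  using cd_not[OF cd_and[OF cd_not cd_not]] by (simp add: de_Morgan_conj)

lemma cd_le [cf_intros]: "cf a \<Longrightarrow> cf b \<Longrightarrow> cd (\<lambda>e. a e \<le> b e)"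
proof -
  assume a: "cf a" and b: "cf b"
  have "cf (\<lambda>e. rec_nat 1 (\<lambda>n y. 0) (a e - b e))" by (intro cf_rec cf_diff a b cf_intros)
  moreover have "rec_nat 1 (\<lambda>n y. 0) (x - y) = (of_bool (x \<le> y) :: nat)" for x y :: nat by (cases "x - y") auto
  ultimately show ?thesis by (simp only: cd_def)
qed

lemma cd_eq [cf_intros]: "cf a \<Longrightarrow> cf b \<Longrightarrow> cd (\<lambda>e. a e = b e)"
  unfolding eq_iff by (intro cf_intros)

lemma cd_less [cf_intros]: "cf a \<Longrightarrow> cf b \<Longrightarrow> cd (\<lambda>e. a e < b e)"
  unfolding less_eq_Suc_le by (intro cf_intros)

lemma cd_ren: "cd R \<Longrightarrow> cd (\<lambda>e. R (\<lambda>i. e (s i)))"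
  unfolding cd_def by (rule cf_ren)

lemma cd_ex_less:
  assumes "cf b" "cd (\<lambda>e. R (e 0) (\<lambda>i. e (Suc i)))"
  shows "cd (\<lambda>e. \<exists>x<b e. R x e)"
proof -
  have "cd (\<lambda>e. R (e 0) (\<lambda>i. e (Suc (Suc i))))"
    using cd_ren[OF assms(2), of "\<lambda>i. case i of 0 \<Rightarrow> 0 | Suc j \<Rightarrow> Suc (Suc j)"] by simp
  then have "cf (\<lambda>e. rec_nat 0 (\<lambda>n y. if R n e then 1 else y) (b e))" by (intro cf_rec assms cf_if cf_intros)
  moreover have "rec_nat 0 (\<lambda>n y. if R n e then 1 else y) k = (of_bool (\<exists>x<k. R x e) :: nat)" for k e
    by (induction k) (auto simp: less_Suc_eq)
  ultimately show ?thesis by (simp add: cd_def)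
qed

lemma cf_Least:
  assumes "\<And>e. \<exists>x. R x e" "cd (\<lambda>e. R (e 0) (\<lambda>i. e (Suc i)))"
  shows "cf (\<lambda>e. LEAST x. R x e)"
proof -
  obtain n\<^sub>0 where n0: "\<And>n. n \<ge> n\<^sub>0 \<Longrightarrow> \<exists>F. \<forall>e. computes F (map e [0..<n]) (of_bool (\<not> R (e 0) (\<lambda>i. e (Suc i))))"
    using cd_not[OF assms(2)] unfolding cd_def cf_def by blast
  show ?thesis
  proof (rule cfI[of n\<^sub>0])
    fix n assume "n \<ge> n\<^sub>0"
    then have "Suc n \<ge> n\<^sub>0" by simp
    then obtain F where "\<And>e. computes F (map e [0..<Suc n]) (of_bool (\<not> R (e 0) (\<lambda>i. e (Suc i))))" using n0 by blast
    from this[of "_ ## _"] have F: "computes F (x # map e [0..<n]) (of_bool (\<not> R x e))" for x e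
      by (simp only: map_scons_upt scons_simps scons_tail)
    have "computes (Mu F) (map e [0..<n]) (LEAST x. R x e)" for e
    proof (rule computes.intros(7))
      show "computes F ((LEAST x. R x e) # map e [0..<n]) 0"
        using F[of "LEAST x. R x e" e] LeastI_ex[OF assms(1)[of e]] by simp
      show "\<forall>m<LEAST x. R x e. \<exists>k. computes F (m # map e [0..<n]) (Suc k)"
        using F[of _ e] not_less_Least[of _ "\<lambda>x. R x e"] by (metis One_nat_def of_bool_eq(2))
    qed
    then show "\<exists>F. \<forall>e. computes F (map e [0..<n]) (LEAST x. R x e)" by blast
  qed
qed

section \<open>Computability of pairing and of quantifiers over coded finite sets\<close>

lemma cf_prod_encode [cf_intros]: "cf a \<Longrightarrow> cf b \<Longrightarrow> cf (\<lambda>e. pe (a e) (b e))"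
proof -
  assume a: "cf a" and b: "cf b"
  have "cf (\<lambda>e. rec_nat 0 (\<lambda>n y. y + Suc n) (a e + b e) + a e)" by (intro cf_add cf_rec a b cf_intros)
  moreover have "rec_nat 0 (\<lambda>n y. y + Suc n) k = triangle k" for k by (induction k) auto
  ultimately show ?thesis by (simp add: prod_encode_def)
qed

text \<open>Found by minimization: the second component is bounded by the pair, so the condition is
  decidable.\<close>

lemma cf_pfst [cf_intros]: "cf a \<Longrightarrow> cf (\<lambda>e. pfst (a e))"
proof -
  assume a: "cf a"
  have "cf (\<lambda>e. LEAST x. \<exists>y<Suc (a e). a e = pe x y)"
    by (rule cf_Least, metis le_prod_encode_2 less_Suc_eq_le prod.collapse prod_decode_inverse)
      (intro cd_ex_less cf_intros cf_ren[OF a])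
  moreover have "(LEAST x. \<exists>y<Suc c. c = pe x y) = pfst c" for c
  proof (rule Least_equality)
    show "\<exists>y<Suc c. c = pe (pfst c) y"
      by (rule exI[of _ "psnd c"]) (metis le_prod_encode_2 less_Suc_eq_le prod.collapse prod_decode_inverse)
  qed auto
  ultimately show ?thesis by simp
qed

lemma cf_psnd [cf_intros]: "cf a \<Longrightarrow> cf (\<lambda>e. psnd (a e))"
proof -
  assume a: "cf a"
  have "cf (\<lambda>e. LEAST x. a e = pe (pfst (a e)) x)"
    by (rule cf_Least, metis prod.collapse prod_decode_inverse) (intro cf_intros cf_ren[OF a])
  moreover have "(LEAST x. c = pe (pfst c) x) = psnd c" for c
  proof (rule Least_equality)
    show "c = pe (pfst c) (psnd c)" by simp
    show "psnd c \<le> y" if "c = pe (pfst c) y" for y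
      using that by (metis eq_imp_le prod_encode_inverse snd_conv)
  qed
  ultimately show ?thesis by simp
qed

lemma cf_power2 [cf_intros]: "cf a \<Longrightarrow> cf (\<lambda>e. 2 ^ a e)"
proof -
  assume a: "cf a"
  have "cf (\<lambda>e. rec_nat 1 (\<lambda>n y. y + y) (a e))" by (intro cf_rec a cf_intros)
  moreover have "rec_nat 1 (\<lambda>n y. y + y) k = (2 :: nat) ^ k" for k by (induction k) auto
  ultimately show ?thesis by simp
qed

lemma cf_max [cf_intros]: "cf a \<Longrightarrow> cf b \<Longrightarrow> cf (\<lambda>e. max (a e) (b e))"
  unfolding max_def by (intro cf_intros)

lemma cf_funpow: "cf n \<Longrightarrow> cf a \<Longrightarrow> cf (\<lambda>e. g (e 0)) \<Longrightarrow> cf (\<lambda>e. (g ^^ n e) (a e))"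
proof -
  assume n: "cf n" and a: "cf a" and g: "cf (\<lambda>e. g (e 0))"
  have "cf (\<lambda>e. rec_nat (a e) (\<lambda>n y. g y) (n e))"
    using cf_ren[OF g, of "\<lambda>i. Suc 0"] by (intro cf_rec n a) simp
  moreover have "rec_nat x (\<lambda>n y. g y) k = (g ^^ k) x" for x k by (induction k) auto
  ultimately show ?thesis by simp
qed

lemma set_decode_less: "x \<in> set_decode s \<Longrightarrow> x < s"
proof -
  assume "x \<in> set_decode s"
  then have "odd (s div 2 ^ x)" by (simp add: set_decode_def)
  then have "s div 2 ^ x > 0" by (cases "s div 2 ^ x") auto
  then have "2 ^ x \<le> s" by (simp add: div_greater_zero_iff)
  then show ?thesis using less_exp[of x] by linarith
qed

text \<open>The binary digit at place \<open>x\<close> is 1 exactly if the number is an odd multiple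
  of \<open>2 ^ x\<close> plus a smaller remainder.\<close>

lemma cd_set_decode [cf_intros]: "cf a \<Longrightarrow> cf s \<Longrightarrow> cd (\<lambda>e. a e \<in> set_decode (s e))"
proof -
  assume a: "cf a" and s: "cf s"
  have "cd (\<lambda>e. \<exists>q<Suc (s e). \<exists>r<2 ^ a e. s e = (2 * q + 1) * 2 ^ a e + r)"
    by (intro cd_ex_less cf_intros cf_ren[OF a] cf_ren[OF s] a s)
  moreover have "(\<exists>q<Suc n. \<exists>r<2 ^ x. n = (2 * q + 1) * 2 ^ x + r) \<longleftrightarrow> x \<in> set_decode n" for n x
  proof
    assume "\<exists>q<Suc n. \<exists>r<2 ^ x. n = (2 * q + 1) * 2 ^ x + r"
    then obtain q r where qr: "r < 2 ^ x" "n = (2 * q + 1) * 2 ^ x + r" by blast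
    then have "n div 2 ^ x = 2 * q + 1" by (simp only: div_mult_self3) simp
    then show "x \<in> set_decode n" by (simp add: set_decode_def)
  next
    assume "x \<in> set_decode n"
    then have "odd (n div 2 ^ x)" by (simp add: set_decode_def)
    then obtain q where q: "n div 2 ^ x = 2 * q + 1" by (rule oddE)
    have n: "n = (2 * q + 1) * 2 ^ x + n mod 2 ^ x" using div_mult_mod_eq[of n "2 ^ x"] q by simp
    have "q \<le> (2 * q + 1) * 2 ^ x" using mult_le_mono[of q "2 * q + 1" 1 "2 ^ x"] by simp
    then have "q < Suc n" using n by linarith
    moreover have "n mod 2 ^ x < 2 ^ x" by simp
    ultimately show "\<exists>q<Suc n. \<exists>r<2 ^ x. n = (2 * q + 1) * 2 ^ x + r" using n by blast
  qed
  ultimately show ?thesis by simp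
qed

text \<open>Members of a coded set are smaller than its code, so the quantifier is bounded.\<close>

lemma cd_Bex [cf_intros]:
  assumes "cf s" "cd (\<lambda>e. R (e 0) (\<lambda>i. e (Suc i)))"
  shows "cd (\<lambda>e. \<exists>x\<in>set_decode (s e). R x e)"
proof -
  have "cd (\<lambda>e. \<exists>x<s e. x \<in> set_decode (s e) \<and> R x e)"
    by (intro cd_ex_less cf_intros assms cf_ren[OF assms(1)])
  moreover have "(\<exists>x<s e. x \<in> set_decode (s e) \<and> R x e) \<longleftrightarrow> (\<exists>x\<in>set_decode (s e). R x e)" for e
    using set_decode_less by blast
  ultimately show ?thesis by simp
qed

lemma cd_Ball [cf_intros]:
  "cf s \<Longrightarrow> cd (\<lambda>e. R (e 0) (\<lambda>i. e (Suc i))) \<Longrightarrow> cd (\<lambda>e. \<forall>x\<in>set_decode (s e). R x e)"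
  using cd_not[OF cd_Bex[OF _ cd_not]] by simp

subsection \<open>Finite tables witnessing the values of types\<close>

text \<open>A table is a finite set of tuples, coded by \<open>set_encode\<close>; it is correct if each of its
  entries follows from other entries by one step of the recursion defining it. The tuples are:
  \<open>(0, \<phi>, i, j, r)\<close> for \<open>r = hval \<phi> i j\<close>, \<open>(1, \<phi>, a, b, r)\<close> for \<open>r = mul \<phi> a b\<close>,
  \<open>(2, \<phi>, s, e, b)\<close> for \<open>b = of_bool (acc \<phi> s e)\<close>, \<open>(3, \<phi>, k, 0, r)\<close> for \<open>r = hpow \<phi> k\<close>,
  \<open>(4, k, m, 0, \<phi>)\<close> for \<open>bnd k m \<phi>\<close>, and \<open>(5, j, 0, 0, \<phi>)\<close> for \<open>j \<in> fvp \<phi>\<close>.\<close>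

abbreviation tup :: "nat \<Rightarrow> nat \<Rightarrow> nat \<Rightarrow> nat \<Rightarrow> nat \<Rightarrow> nat" where
  "tup k w x y z \<equiv> pe k (pe w (pe x (pe y z)))"

abbreviation lst :: "nat \<Rightarrow> nat" where
  "lst z \<equiv> psnd (psnd (psnd (psnd z)))"

abbreviation sd :: "nat \<Rightarrow> nat set" where
  "sd \<equiv> set_decode"

abbreviation arg1 :: "nat \<Rightarrow> nat" where "arg1 c \<equiv> pfst (psnd c)"
abbreviation arg2 :: "nat \<Rightarrow> nat" where "arg2 c \<equiv> psnd (psnd c)"

text \<open>\<open>pfst c\<close> is the tag that \<open>code\<close> gives to the outermost
  constructor. For tag 9, \<open>psnd r = 2 ^ b\<close> says that the coded set is the singleton of
  \<open>b\<close>; for tag 10, that \<open>r\<close> codes the set of \<open>a\<close> and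
  \<open>b\<close> is expressed by membership.\<close>

definition step_hval :: "nat \<Rightarrow> nat \<Rightarrow> nat \<Rightarrow> nat \<Rightarrow> nat \<Rightarrow> bool" where
  "step_hval t c i j r \<longleftrightarrow>
     pfst c = 0 \<and> r = of_bool (arg1 c \<in> sd i \<and> arg2 c \<in> sd i)
   \<or> pfst c = 1 \<and> r = (if arg1 c \<in> sd i then 1 else if arg2 c \<in> sd i then 2 else 0)
   \<or> pfst c = 2 \<and> r = pe (of_bool (arg2 c \<in> sd i)) (pe (of_bool (arg1 c \<in> sd i)) 0)
   \<or> pfst c = 3 \<and> r = of_bool (psnd c \<in> sd i)
   \<or> pfst c = 4 \<and> r = of_bool (arg1 c \<in> sd i \<and> arg2 c \<in> sd j)
   \<or> (pfst c = 5 \<or> pfst c = 6) \<and> r = 0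
   \<or> pfst c = 7 \<and> tup 0 (arg1 c) i j (pfst r) \<in> sd t \<and> tup 0 (arg2 c) i j (psnd r) \<in> sd t
   \<or> pfst c = 8 \<and> tup 0 (psnd c) i j r \<in> sd t
   \<or> pfst c = 9 \<and> tup 0 (psnd c) (2 * i) j (pfst r) \<in> sd t \<and>
       (\<exists>b\<in>sd (psnd r). psnd r = 2 ^ b \<and> tup 0 (psnd c) (2 * i + 1) j b \<in> sd t)
   \<or> pfst c = 10 \<and> (\<exists>a\<in>sd r. \<exists>b\<in>sd r. tup 0 (psnd c) i (2 * j) a \<in> sd t \<and>
       tup 0 (psnd c) i (2 * j + 1) b \<in> sd t \<and> (\<forall>v\<in>sd r. v = a \<or> v = b))"

text \<open>For the quantifiers, equality of the coded result with an image is split into two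
  inclusions, each a statement about members of coded sets.\<close>

definition step_mul :: "nat \<Rightarrow> nat \<Rightarrow> nat \<Rightarrow> nat \<Rightarrow> nat \<Rightarrow> bool" where
  "step_mul t c a b r \<longleftrightarrow>
     (pfst c = 0 \<or> pfst c = 4) \<and> r = max a b
   \<or> pfst c = 1 \<and> r = (if a = 0 then b else a)
   \<or> pfst c = 2 \<and> r = pe (pfst a) (pe (pfst (psnd b))
       (max (max (psnd (psnd a)) (psnd (psnd b))) (pfst (psnd a) * pfst b)))
   \<or> pfst c = 3 \<and> r = a
   \<or> (pfst c = 5 \<or> pfst c = 6) \<and> r = 0
   \<or> pfst c = 7 \<and> tup 1 (arg1 c) (pfst a) (pfst b) (pfst r) \<in> sd t \<and>
       tup 1 (arg2 c) (psnd a) (psnd b) (psnd r) \<in> sd t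
   \<or> pfst c = 8 \<and> tup 1 (psnd c) a b r \<in> sd t
   \<or> pfst c = 9 \<and> tup 1 (psnd c) (pfst a) (pfst b) (pfst r) \<in> sd t \<and>
       (\<forall>v\<in>sd (psnd a). \<exists>w\<in>sd (psnd r). tup 1 (psnd c) v (pfst b) w \<in> sd t) \<and>
       (\<forall>v\<in>sd (psnd b). \<exists>w\<in>sd (psnd r). tup 1 (psnd c) (pfst a) v w \<in> sd t) \<and>
       (\<forall>w\<in>sd (psnd r). (\<exists>v\<in>sd (psnd a). tup 1 (psnd c) v (pfst b) w \<in> sd t) \<or>
          (\<exists>v\<in>sd (psnd b). tup 1 (psnd c) (pfst a) v w \<in> sd t))
   \<or> pfst c = 10 \<and>
       (\<forall>v\<in>sd a. \<forall>u\<in>sd b. \<exists>w\<in>sd r. tup 1 (psnd c) v u w \<in> sd t) \<and>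
       (\<forall>w\<in>sd r. \<exists>v\<in>sd a. \<exists>u\<in>sd b. tup 1 (psnd c) v u w \<in> sd t)"

text \<open>Falsity needs a certificate as well as truth, because of negation, so an entry carries
  the bit. An equation such as \<open>z = tup 2 (psnd c) s e (lst z)\<close> for a member
  \<open>z\<close> of the table stands for the existence of a recorded value and keeps quantifiers
  bounded. A failed product equation is witnessed by recording the product itself.\<close>

definition step_acc :: "nat \<Rightarrow> nat \<Rightarrow> nat \<Rightarrow> nat \<Rightarrow> nat \<Rightarrow> bool" where
  "step_acc t c s e b \<longleftrightarrow>
     (pfst c = 0 \<or> pfst c = 1 \<or> pfst c = 3 \<or> pfst c = 4) \<and> b = of_bool (s = 1)
   \<or> pfst c = 2 \<and> b = of_bool (psnd (psnd s) = 1)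
   \<or> pfst c = 5 \<and> b = 1
   \<or> pfst c = 6 \<and> b = 0
   \<or> pfst c = 7 \<and> (\<exists>z\<in>sd t. \<exists>y\<in>sd t. z = tup 2 (arg1 c) (pfst s) (pfst e) (lst z) \<and>
       y = tup 2 (arg2 c) (psnd s) (psnd e) (lst y) \<and> b = lst z * lst y)
   \<or> pfst c = 8 \<and> (\<exists>z\<in>sd t. z = tup 2 (psnd c) s e (lst z) \<and> b = 1 - lst z)
   \<or> pfst c = 9 \<and>
      (b = 1 \<and> (\<exists>a\<in>sd (psnd s). \<exists>z\<in>sd t. z = tup 1 (psnd c) a (pfst e) (lst z) \<and>
          tup 2 (psnd c) (lst z) (pfst e) 1 \<in> sd t)
     \<or> b = 0 \<and> (\<forall>a\<in>sd (psnd s). \<exists>z\<in>sd t. z = tup 1 (psnd c) a (pfst e) (lst z) \<and>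
          tup 2 (psnd c) (lst z) (pfst e) 0 \<in> sd t))
   \<or> pfst c = 10 \<and>
      (b = 1 \<and> (\<exists>a\<in>sd s. \<exists>f\<in>sd e. tup 1 (psnd c) a f a \<in> sd t \<and> tup 1 (psnd c) f f f \<in> sd t \<and>
          tup 2 (psnd c) a f 1 \<in> sd t)
     \<or> b = 0 \<and> (\<forall>a\<in>sd s. \<forall>f\<in>sd e.
          (\<exists>z\<in>sd t. z = tup 1 (psnd c) a f (lst z) \<and> lst z \<noteq> a) \<or>
          (\<exists>z\<in>sd t. z = tup 1 (psnd c) f f (lst z) \<and> lst z \<noteq> f) \<or> tup 2 (psnd c) a f 0 \<in> sd t))"

definition step_hpow :: "nat \<Rightarrow> nat \<Rightarrow> nat \<Rightarrow> nat \<Rightarrow> bool" where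
  "step_hpow t c k r \<longleftrightarrow>
     k = 0 \<and> tup 0 c 0 0 r \<in> sd t
   \<or> k \<noteq> 0 \<and> (\<exists>z\<in>sd t. \<exists>y\<in>sd t. z = tup 3 c (k - 1) 0 (lst z) \<and> y = tup 0 c 0 0 (lst y) \<and>
       tup 1 c (lst z) (lst y) r \<in> sd t)"

text \<open>Such an entry must also certify that \<open>c\<close> is a code at all, hence the exact
  \<open>pe 5 0\<close> and \<open>pe 6 0\<close>. In the clause for tag 9,
  \<open>pe 1 (pe 0 (Suc k))\<close> is the code of \<open>Le 0 (Suc k)\<close>.\<close>

definition step_bnd :: "nat \<Rightarrow> nat \<Rightarrow> nat \<Rightarrow> nat \<Rightarrow> bool" where
  "step_bnd t k m c \<longleftrightarrow>
     (pfst c = 0 \<or> pfst c = 1 \<or> pfst c = 2) \<and> arg1 c \<le> k \<and> arg2 c \<le> k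
   \<or> pfst c = 3 \<and> psnd c \<le> k
   \<or> pfst c = 4 \<and> arg1 c \<le> k \<and> arg2 c < m
   \<or> c = pe 5 0
   \<or> c = pe 6 0
   \<or> pfst c = 7 \<and> tup 4 k m 0 (arg1 c) \<in> sd t \<and> tup 4 k m 0 (arg2 c) \<in> sd t
   \<or> pfst c = 8 \<and> tup 4 k m 0 (psnd c) \<in> sd t
   \<or> pfst c = 9 \<and> pfst (psnd c) = 7 \<and> pfst (psnd (psnd c)) = pe 1 (pe 0 (Suc k)) \<and>
       tup 4 (Suc k) m 0 (psnd (psnd (psnd c))) \<in> sd t
   \<or> pfst c = 10 \<and> tup 4 k (Suc m) 0 (psnd c) \<in> sd t"

definition step_fvp :: "nat \<Rightarrow> nat \<Rightarrow> nat \<Rightarrow> bool" where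
  "step_fvp t j c \<longleftrightarrow>
     pfst c = 4 \<and> arg2 c = j
   \<or> pfst c = 7 \<and> (tup 5 j 0 0 (arg1 c) \<in> sd t \<or> tup 5 j 0 0 (arg2 c) \<in> sd t)
   \<or> (pfst c = 8 \<or> pfst c = 9) \<and> tup 5 j 0 0 (psnd c) \<in> sd t
   \<or> pfst c = 10 \<and> tup 5 (Suc j) 0 0 (psnd c) \<in> sd t"

definition step :: "nat \<Rightarrow> nat \<Rightarrow> bool" where
  "step t z \<longleftrightarrow>
     pfst z = 0 \<and> step_hval t (pfst (psnd z)) (pfst (psnd (psnd z))) (pfst (psnd (psnd (psnd z)))) (lst z)
   \<or> pfst z = 1 \<and> step_mul t (pfst (psnd z)) (pfst (psnd (psnd z))) (pfst (psnd (psnd (psnd z)))) (lst z)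
   \<or> pfst z = 2 \<and> step_acc t (pfst (psnd z)) (pfst (psnd (psnd z))) (pfst (psnd (psnd (psnd z)))) (lst z)
   \<or> pfst z = 3 \<and> step_hpow t (pfst (psnd z)) (pfst (psnd (psnd z))) (lst z)
   \<or> pfst z = 4 \<and> step_bnd t (pfst (psnd z)) (pfst (psnd (psnd z))) (lst z)
   \<or> pfst z = 5 \<and> step_fvp t (pfst (psnd z)) (lst z)"

definition table :: "nat \<Rightarrow> bool" where
  "table t \<longleftrightarrow> (\<forall>z\<in>sd t. step t z)"

lemma pos_mono:
  "A \<subseteq> B \<Longrightarrow> (\<And>x. Q x \<longrightarrow> R x) \<Longrightarrow> (\<exists>x\<in>A. Q x) \<longrightarrow> (\<exists>x\<in>B. R x)"
  "(\<And>x. Q x \<longrightarrow> R x) \<Longrightarrow> (\<forall>x\<in>A. Q x) \<longrightarrow> (\<forall>x\<in>A. R x)"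
  "A \<subseteq> B \<Longrightarrow> x \<in> A \<longrightarrow> x \<in> B"
  by blast+

text \<open>The presence of entries is consulted, never their absence; so tables can be enlarged and
  united.\<close>

lemma step_mono:
  assumes "sd t \<subseteq> sd t'"
  shows "step t z \<longrightarrow> step t' z"
  unfolding step_def step_hval_def step_mul_def step_acc_def step_hpow_def step_bnd_def step_fvp_def
  by (intro disj_mono conj_mono pos_mono imp_refl assms) simp_all

section \<open>Correct tables contain only true values\<close>

lemma table_entry:
  assumes "table t"
  shows "tup 0 c i j r \<in> sd t \<Longrightarrow> step_hval t c i j r" "tup 1 c i j r \<in> sd t \<Longrightarrow> step_mul t c i j r"
    "tup 2 c i j r \<in> sd t \<Longrightarrow> step_acc t c i j r" "tup 3 c i j r \<in> sd t \<Longrightarrow> step_hpow t c i r"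
    "tup 4 c i j r \<in> sd t \<Longrightarrow> step_bnd t c i r" "tup 5 c i j r \<in> sd t \<Longrightarrow> step_fvp t c r"
  using assms unfolding table_def step_def by (force dest!: bspec)+

text \<open>Entries are justified by entries of the same table, but only by those for immediate
  subformulae; induction on the formula therefore excludes circular support.\<close>

lemma table_hval:
  assumes "table t"
  shows "tup 0 (code \<phi>) i j r \<in> sd t \<Longrightarrow> r = hval \<phi> i j"
proof (induction \<phi> arbitrary: i j r)
  case (And \<phi> \<psi>)
  then show ?case using table_entry(1)[OF assms And.prems] by (force simp: step_hval_def pe_eq_iff)
next
  case (ExI \<phi>)
  from table_entry(1)[OF assms ExI.prems] obtain b
    where "tup 0 (code \<phi>) (2 * i) j (pfst r) \<in> sd t" "psnd r = 2 ^ b" "tup 0 (code \<phi>) (2 * i + 1) j b \<in> sd t"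
    by (auto simp: step_hval_def)
  then have "pfst r = hval \<phi> (2 * i) j" "psnd r = set_encode {hval \<phi> (2 * i + 1) j}"
    using ExI.IH by (auto simp: set_encode_def)
  then show ?case by (metis hval.simps(10) pe_eq_iff)
next
  case (ExP \<phi>)
  from table_entry(1)[OF assms ExP.prems] obtain a b
    where "a \<in> sd r" "b \<in> sd r" "tup 0 (code \<phi>) i (2 * j) a \<in> sd t" "tup 0 (code \<phi>) i (2 * j + 1) b \<in> sd t"
      "\<forall>v\<in>sd r. v = a \<or> v = b"
    by (auto simp: step_hval_def)
  moreover from this have "sd r = {a, b}" by blast
  ultimately show ?case using ExP.IH by (metis hval.simps(11) set_decode_inverse)
qed (use table_entry(1)[OF assms] in \<open>fastforce simp: step_hval_def\<close>)+

lemma table_mul: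
  assumes "table t"
  shows "tup 1 (code \<phi>) a b r \<in> sd t \<Longrightarrow> r = mul \<phi> a b"
proof (induction \<phi> arbitrary: a b r)
  case (And \<phi> \<psi>)
  then show ?case using table_entry(2)[OF assms And.prems] by (force simp: step_mul_def pe_eq_iff)
next
  case (ExI \<phi>)
  from table_entry(2)[OF assms ExI.prems]
  have *: "tup 1 (code \<phi>) (pfst a) (pfst b) (pfst r) \<in> sd t"
    "\<forall>v\<in>sd (psnd a). \<exists>w\<in>sd (psnd r). tup 1 (code \<phi>) v (pfst b) w \<in> sd t"
    "\<forall>v\<in>sd (psnd b). \<exists>w\<in>sd (psnd r). tup 1 (code \<phi>) (pfst a) v w \<in> sd t"
    "\<forall>w\<in>sd (psnd r). (\<exists>v\<in>sd (psnd a). tup 1 (code \<phi>) v (pfst b) w \<in> sd t) \<or>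
          (\<exists>v\<in>sd (psnd b). tup 1 (code \<phi>) (pfst a) v w \<in> sd t)"
    by (auto simp: step_mul_def)
  have "sd (psnd r) = (\<lambda>c. mul \<phi> c (pfst b)) ` sd (psnd a) \<union> (\<lambda>c. mul \<phi> (pfst a) c) ` sd (psnd b)"
    using *(2-4) ExI.IH by blast
  then have "psnd r = set_encode ((\<lambda>c. mul \<phi> c (pfst b)) ` sd (psnd a) \<union> (\<lambda>c. mul \<phi> (pfst a) c) ` sd (psnd b))"
    by (metis set_decode_inverse)
  then show ?case using ExI.IH[OF *(1)] by (metis mul.simps(10) pe_eq_iff)
next
  case (ExP \<phi>)
  from table_entry(2)[OF assms ExP.prems]
  have *: "\<forall>v\<in>sd a. \<forall>u\<in>sd b. \<exists>w\<in>sd r. tup 1 (code \<phi>) v u w \<in> sd t"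
    "\<forall>w\<in>sd r. \<exists>v\<in>sd a. \<exists>u\<in>sd b. tup 1 (code \<phi>) v u w \<in> sd t"
    by (auto simp: step_mul_def)
  have "sd r = (\<lambda>(c, d). mul \<phi> c d) ` (sd a \<times> sd b)"
    using * ExP.IH by (auto simp: image_iff) blast+
  then show ?case by (metis mul.simps(11) set_decode_inverse)
qed (use table_entry(2)[OF assms] in \<open>fastforce simp: step_mul_def\<close>)+

lemma table_acc:
  assumes "table t"
  shows "tup 2 (code \<phi>) s e b \<in> sd t \<Longrightarrow> b = of_bool (acc \<phi> s e)"
proof (induction \<phi> arbitrary: s e b)
  case (And \<phi> \<psi>)
  from table_entry(3)[OF assms And.prems] obtain x y
    where "tup 2 (code \<phi>) (pfst s) (pfst e) x \<in> sd t" "tup 2 (code \<psi>) (psnd s) (psnd e) y \<in> sd t" "b = x * y"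
    by (simp add: step_acc_def) metis
  then have "x = of_bool (acc \<phi> (pfst s) (pfst e))" "y = of_bool (acc \<psi> (psnd s) (psnd e))" "b = x * y"
    using And.IH by blast+
  then show ?case by simp
next
  case (Neg \<phi>)
  from table_entry(3)[OF assms Neg.prems] obtain x
    where "tup 2 (code \<phi>) s e x \<in> sd t" "b = 1 - x"
    by (simp add: step_acc_def) metis
  then have "x = of_bool (acc \<phi> s e)" "b = 1 - x" using Neg.IH by blast+
  then show ?case by simp
next
  case (ExI \<phi>)
  have v: "u = mul \<phi> a (pfst e)" if "tup 1 (code \<phi>) a (pfst e) u \<in> sd t" for a u
    using table_mul[OF assms that] .
  from table_entry(3)[OF assms ExI.prems] consider
    a u where "b = 1" "a \<in> sd (psnd s)" "tup 1 (code \<phi>) a (pfst e) u \<in> sd t" "tup 2 (code \<phi>) u (pfst e) 1 \<in> sd t"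
  | "b = 0" "\<forall>a\<in>sd (psnd s). \<exists>u. tup 1 (code \<phi>) a (pfst e) u \<in> sd t \<and> tup 2 (code \<phi>) u (pfst e) 0 \<in> sd t"
    by (simp add: step_acc_def) metis
  then show ?case
  proof cases
    case 1
    have "acc \<phi> (mul \<phi> a (pfst e)) (pfst e)" using ExI.IH[OF 1(4)] v[OF 1(3)] by (simp add: of_bool_def split: if_splits)
    then show ?thesis using 1(1,2) by auto
  next
    case 2
    have "\<not> acc \<phi> (mul \<phi> a (pfst e)) (pfst e)" if "a \<in> sd (psnd s)" for a
    proof -
      from 2(2)[rule_format, OF that] obtain u
        where u: "tup 1 (code \<phi>) a (pfst e) u \<in> sd t" "tup 2 (code \<phi>) u (pfst e) 0 \<in> sd t" by (elim exE conjE)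
      show ?thesis using v[OF u(1)] ExI.IH[OF u(2)] by simp
    qed
    then show ?thesis using 2(1) by auto
  qed
next
  case (ExP \<phi>)
  have v: "u = mul \<phi> a f" if "tup 1 (code \<phi>) a f u \<in> sd t" for a f u
    using table_mul[OF assms that] .
  from table_entry(3)[OF assms ExP.prems] consider
    a f where "b = 1" "a \<in> sd s" "f \<in> sd e" "tup 1 (code \<phi>) a f a \<in> sd t" "tup 1 (code \<phi>) f f f \<in> sd t"
      "tup 2 (code \<phi>) a f 1 \<in> sd t"
  | "b = 0" "\<forall>a\<in>sd s. \<forall>f\<in>sd e. (\<exists>u. tup 1 (code \<phi>) a f u \<in> sd t \<and> u \<noteq> a) \<or>
        (\<exists>u. tup 1 (code \<phi>) f f u \<in> sd t \<and> u \<noteq> f) \<or> tup 2 (code \<phi>) a f 0 \<in> sd t"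
    by (simp add: step_acc_def) metis
  then show ?case
  proof cases
    case 1
    have "acc \<phi> a f" using ExP.IH[OF 1(6)] by (simp add: of_bool_def split: if_splits)
    then show ?thesis using 1(1-3) v[OF 1(4), symmetric] v[OF 1(5), symmetric] by auto
  next
    case 2
    have "\<not> (mul \<phi> a f = a \<and> mul \<phi> f f = f \<and> acc \<phi> a f)" if "a \<in> sd s" "f \<in> sd e" for a f
    proof -
      from 2(2)[rule_format, OF that] show ?thesis
      proof (elim disjE exE conjE)
        fix u assume u: "tup 1 (code \<phi>) a f u \<in> sd t" "u \<noteq> a"
        show ?thesis using v[OF u(1)] u(2) by simp
      next
        fix u assume u: "tup 1 (code \<phi>) f f u \<in> sd t" "u \<noteq> f"
        show ?thesis using v[OF u(1)] u(2) by simp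
      next
        assume "tup 2 (code \<phi>) a f 0 \<in> sd t"
        then have "0 = (of_bool (acc \<phi> a f) :: nat)" by (rule ExP.IH)
        then show ?thesis by simp
      qed
    qed
    then show ?thesis using 2(1) by auto
  qed
qed (use table_entry(3)[OF assms] in \<open>fastforce simp: step_acc_def\<close>)+

lemma table_hpow:
  assumes "table t"
  shows "tup 3 (code \<phi>) k 0 r \<in> sd t \<Longrightarrow> r = hpow \<phi> k"
proof (induction k arbitrary: r)
  case 0
  then show ?case using table_entry(4)[OF assms 0] table_hval[OF assms] by (auto simp: step_hpow_def)
next
  case (Suc k)
  from table_entry(4)[OF assms Suc.prems] obtain w h
    where "tup 3 (code \<phi>) k 0 w \<in> sd t" "tup 0 (code \<phi>) 0 0 h \<in> sd t" "tup 1 (code \<phi>) w h r \<in> sd t"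
    by (simp add: step_hpow_def) metis
  then show ?case using Suc.IH table_hval[OF assms] table_mul[OF assms] by simp
qed

lemma psnd_less: "pfst c \<noteq> 0 \<Longrightarrow> psnd c < c"
proof -
  have tri: "n \<le> triangle n" for n by (induction n) auto
  have "d < pe a d" if "a \<noteq> 0" for a d using tri[of "a + d"] that by (simp add: prod_encode_def)
  from this[of "pfst c" "psnd c"] show "pfst c \<noteq> 0 \<Longrightarrow> psnd c < c" by simp
qed

lemma pfst_le: "pfst c \<le> c" and psnd_le: "psnd c \<le> c"
  using le_prod_encode_1[of "pfst c" "psnd c"] le_prod_encode_2[of "psnd c" "pfst c"] by simp_all

text \<open>The induction is on the number \<open>c\<close>, since that it codes a formula is part
  of the conclusion.\<close>

lemma table_bnd:
  assumes "table t"
  shows "tup 4 k m 0 c \<in> sd t \<Longrightarrow> \<exists>\<phi>. code \<phi> = c \<and> bnd k m \<phi>"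
proof (induction c arbitrary: k m rule: less_induct)
  case (less c)
  have c: "c = pe (pfst c) (psnd c)" "psnd c = pe (arg1 c) (arg2 c)" by simp_all
  \<comment> \<open>Components are strictly smaller only for a nonzero tag; tag 0 belongs to
    \<open>Eq\<close>, which has no subformula.\<close>
  have dec: "psnd c < c" "arg1 c < c" "arg2 c < c" "psnd (psnd (psnd c)) < c" if "pfst c \<noteq> 0"
    using psnd_less[OF that] pfst_le[of "psnd c"] psnd_le[of "psnd c"] psnd_le[of "arg2 c"] by linarith+
  from table_entry(5)[OF assms less.prems] show ?case
    unfolding step_bnd_def
  proof (elim disjE conjE)
    assume "pfst c = 0" "arg1 c \<le> k" "arg2 c \<le> k"
    then show ?thesis using c by (intro exI[of _ "Eq (arg1 c) (arg2 c)"]) (simp add: bnd.intros)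
  next
    assume "pfst c = 1" "arg1 c \<le> k" "arg2 c \<le> k"
    then show ?thesis using c by (intro exI[of _ "Le (arg1 c) (arg2 c)"]) (simp add: bnd.intros)
  next
    assume "pfst c = 2" "arg1 c \<le> k" "arg2 c \<le> k"
    then show ?thesis using c by (intro exI[of _ "Succ (arg1 c) (arg2 c)"]) (simp add: bnd.intros)
  next
    assume "pfst c = 3" "psnd c \<le> k"
    then show ?thesis using c by (intro exI[of _ "Zero (psnd c)"]) (simp add: bnd.intros)
  next
    assume "pfst c = 4" "arg1 c \<le> k" "arg2 c < m"
    then show ?thesis using c by (intro exI[of _ "Mem (arg1 c) (arg2 c)"]) (simp add: bnd.intros)
  next
    assume "c = pe 5 0"
    then show ?thesis by (intro exI[of _ Top]) (simp add: bnd.intros)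
  next
    assume "c = pe 6 0"
    then show ?thesis by (intro exI[of _ Bot]) (simp add: bnd.intros)
  next
    assume 7: "pfst c = 7" "tup 4 k m 0 (arg1 c) \<in> sd t" "tup 4 k m 0 (arg2 c) \<in> sd t"
    then obtain \<phi> \<psi> where "code \<phi> = arg1 c" "bnd k m \<phi>" "code \<psi> = arg2 c" "bnd k m \<psi>"
      using less.IH dec by (metis zero_neq_numeral)
    then show ?thesis using c 7(1) by (intro exI[of _ "And \<phi> \<psi>"]) (simp add: bnd.intros)
  next
    assume 8: "pfst c = 8" "tup 4 k m 0 (psnd c) \<in> sd t"
    then obtain \<phi> where "code \<phi> = psnd c" "bnd k m \<phi>"
      using less.IH dec by (metis zero_neq_numeral)
    then show ?thesis using c 8(1) by (intro exI[of _ "Neg \<phi>"]) (simp add: bnd.intros)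
  next
    assume 9: "pfst c = 9" "arg1 c = 7" "pfst (psnd (psnd c)) = pe 1 (pe 0 (Suc k))"
      "tup 4 (Suc k) m 0 (psnd (psnd (psnd c))) \<in> sd t"
    then obtain \<phi> where "code \<phi> = psnd (psnd (psnd c))" "bnd (Suc k) m \<phi>"
      using less.IH dec by (metis zero_neq_numeral)
    moreover have "c = pe 9 (pe 7 (pe (pe 1 (pe 0 (Suc k))) (psnd (psnd (psnd c)))))"
      using 9(1-3) by (metis prod.collapse prod_decode_inverse)
    ultimately show ?thesis
      by (intro exI[of _ "ExI (And (Le 0 (Suc k)) \<phi>)"]) (simp add: bnd.intros)
  next
    assume 10: "pfst c = 10" "tup 4 k (Suc m) 0 (psnd c) \<in> sd t"
    then obtain \<phi> where "code \<phi> = psnd c" "bnd k (Suc m) \<phi>"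
      using less.IH dec by (metis zero_neq_numeral)
    then show ?thesis using c 10(1) by (intro exI[of _ "ExP \<phi>"]) (simp add: bnd.intros)
  qed
qed

lemma table_fvp:
  assumes "table t"
  shows "tup 5 j 0 0 (code \<phi>) \<in> sd t \<Longrightarrow> j \<in> fvp \<phi>"
proof (induction \<phi> arbitrary: j)
qed (use table_entry(6)[OF assms] in \<open>fastforce simp: step_fvp_def\<close>)+


section \<open>Every true value occurs in some correct table\<close>

definition prov :: "nat \<Rightarrow> bool" where
  "prov z \<longleftrightarrow> (\<exists>t. table t \<and> z \<in> sd t)"

text \<open>A finite union of correct tables is correct, by monotonicity of
  \<open>step\<close>.\<close>

lemma prov_tables:
  assumes "finite S" "\<And>z. z \<in> S \<Longrightarrow> prov z"
  shows "\<exists>t. table t \<and> S \<subseteq> sd t"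
proof -
  have "\<forall>z\<in>S. \<exists>t. table t \<and> z \<in> sd t" using assms(2) by (simp add: prov_def)
  then obtain T where T: "\<And>z. z \<in> S \<Longrightarrow> table (T z) \<and> z \<in> sd (T z)" by metis
  define t where "t = set_encode (\<Union>z\<in>S. sd (T z))"
  have t: "sd t = (\<Union>z\<in>S. sd (T z))" unfolding t_def using assms(1) by (intro set_encode_inverse) simp
  have "step t y" if "y \<in> sd (T z)" "z \<in> S" for y z
  proof -
    have "step (T z) y" using T[OF that(2)] that(1) by (simp add: table_def)
    moreover have "sd (T z) \<subseteq> sd t" using t that(2) by blast
    ultimately show ?thesis using step_mono by blast
  qed
  then have "table t" unfolding table_def t by blast
  moreover have "S \<subseteq> sd t" using T t by blast
  ultimately show ?thesis by blast
qed

lemma prov_step: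
  assumes "finite S" "\<And>z. z \<in> S \<Longrightarrow> prov z" "\<And>t. S \<subseteq> sd t \<Longrightarrow> step t z"
  shows "prov z"
proof -
  obtain t where t: "table t" "S \<subseteq> sd t" using prov_tables[OF assms(1,2)] by blast
  define t' where "t' = set_encode (insert z (sd t))"
  have t': "sd t' = insert z (sd t)" unfolding t'_def by (intro set_encode_inverse) simp
  have "step t' y" if "y \<in> sd t" for y
    using step_mono[of t t' y] t(1) that t' by (auto simp: table_def)
  moreover have "step t' z" by (rule assms(3)) (use t(2) t' in auto)
  ultimately have "table t'" unfolding table_def t' by blast
  then show ?thesis using t' by (auto simp: prov_def)
qed

lemma set_encode_singleton: "set_encode {b} = 2 ^ b"
  by (simp add: set_encode_def)

lemma set_decode_power2: "sd (2 ^ b) = {b}"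
  using set_encode_inverse[of "{b}"] by (simp add: set_encode_singleton)

lemma prov_hval: "prov (tup 0 (code \<phi>) i j (hval \<phi> i j))"
proof (induction \<phi> arbitrary: i j)
  case (And \<phi> \<psi>)
  show ?case
    by (rule prov_step[where S = "{tup 0 (code \<phi>) i j (hval \<phi> i j), tup 0 (code \<psi>) i j (hval \<psi> i j)}"])
      (use And in \<open>auto simp: step_def step_hval_def\<close>)
next
  case (Neg \<phi>)
  show ?case
    by (rule prov_step[where S = "{tup 0 (code \<phi>) i j (hval \<phi> i j)}"])
      (use Neg in \<open>auto simp: step_def step_hval_def\<close>)
next
  case (ExI \<phi>)
  show ?case
    by (rule prov_step[where S = "{tup 0 (code \<phi>) (2 * i) j (hval \<phi> (2 * i) j),
          tup 0 (code \<phi>) (2 * i + 1) j (hval \<phi> (2 * i + 1) j)}"])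
      (use ExI in \<open>auto simp: step_def step_hval_def set_encode_singleton set_decode_power2\<close>)
next
  case (ExP \<phi>)
  show ?case
    by (rule prov_step[where S = "{tup 0 (code \<phi>) i (2 * j) (hval \<phi> i (2 * j)),
          tup 0 (code \<phi>) i (2 * j + 1) (hval \<phi> i (2 * j + 1))}"])
      (use ExP in \<open>auto simp: step_def step_hval_def set_encode_inverse\<close>)
qed (rule prov_step[where S = "{}"]; simp add: step_def step_hval_def)+

lemma prov_mul: "prov (tup 1 (code \<phi>) a b (mul \<phi> a b))"
proof (induction \<phi> arbitrary: a b)
  case (And \<phi> \<psi>)
  show ?case
    by (rule prov_step[where S = "{tup 1 (code \<phi>) (pfst a) (pfst b) (mul \<phi> (pfst a) (pfst b)),
          tup 1 (code \<psi>) (psnd a) (psnd b) (mul \<psi> (psnd a) (psnd b))}"])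
      (use And in \<open>auto simp: step_def step_mul_def\<close>)
next
  case (Neg \<phi>)
  show ?case
    by (rule prov_step[where S = "{tup 1 (code \<phi>) a b (mul \<phi> a b)}"])
      (use Neg in \<open>auto simp: step_def step_mul_def\<close>)
next
  case (ExI \<phi>)
  let ?S = "insert (tup 1 (code \<phi>) (pfst a) (pfst b) (mul \<phi> (pfst a) (pfst b)))
     ((\<lambda>v. tup 1 (code \<phi>) v (pfst b) (mul \<phi> v (pfst b))) ` sd (psnd a) \<union>
      (\<lambda>v. tup 1 (code \<phi>) (pfst a) v (mul \<phi> (pfst a) v)) ` sd (psnd b))"
  show ?case
  proof (rule prov_step[where S = ?S])
    show "prov z" if "z \<in> ?S" for z using that ExI.IH by auto
    fix t assume S: "?S \<subseteq> sd t"
    let ?R = "(\<lambda>c. mul \<phi> c (pfst b)) ` sd (psnd a) \<union> (\<lambda>c. mul \<phi> (pfst a) c) ` sd (psnd b)"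
    have m: "tup 1 (code \<phi>) v (pfst b) (mul \<phi> v (pfst b)) \<in> sd t" if "v \<in> sd (psnd a)" for v
      using S that by auto
    have m': "tup 1 (code \<phi>) (pfst a) v (mul \<phi> (pfst a) v) \<in> sd t" if "v \<in> sd (psnd b)" for v
      using S that by auto
    have "\<forall>v\<in>sd (psnd a). \<exists>w\<in>?R. tup 1 (code \<phi>) v (pfst b) w \<in> sd t"
      "\<forall>v\<in>sd (psnd b). \<exists>w\<in>?R. tup 1 (code \<phi>) (pfst a) v w \<in> sd t"
      "\<forall>w\<in>?R. (\<exists>v\<in>sd (psnd a). tup 1 (code \<phi>) v (pfst b) w \<in> sd t) \<or>
          (\<exists>v\<in>sd (psnd b). tup 1 (code \<phi>) (pfst a) v w \<in> sd t)"
      using m m' by blast+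
    then show "step t (tup 1 (code (ExI \<phi>)) a b (mul (ExI \<phi>) a b))"
      using S by (simp add: step_def step_mul_def set_encode_inverse)
  qed simp
next
  case (ExP \<phi>)
  let ?S = "(\<lambda>(v, u). tup 1 (code \<phi>) v u (mul \<phi> v u)) ` (sd a \<times> sd b)"
  show ?case
  proof (rule prov_step[where S = ?S])
    show "prov z" if "z \<in> ?S" for z using that ExP.IH by auto
    fix t assume S: "?S \<subseteq> sd t"
    have "tup 1 (code \<phi>) v u (mul \<phi> v u) \<in> sd t" if "v \<in> sd a" "u \<in> sd b" for v u using S that by auto
    then show "step t (tup 1 (code (ExP \<phi>)) a b (mul (ExP \<phi>) a b))"
      by (auto simp: step_def step_mul_def set_encode_inverse)
  qed simp
qed (rule prov_step[where S = "{}"]; simp add: step_def step_mul_def)+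

lemma prov_acc: "prov (tup 2 (code \<phi>) s e (of_bool (acc \<phi> s e)))"
proof (induction \<phi> arbitrary: s e)
  case (And \<phi> \<psi>)
  let ?x = "tup 2 (code \<phi>) (pfst s) (pfst e) (of_bool (acc \<phi> (pfst s) (pfst e)))"
  let ?y = "tup 2 (code \<psi>) (psnd s) (psnd e) (of_bool (acc \<psi> (psnd s) (psnd e)))"
  show ?case
  proof (rule prov_step[where S = "{?x, ?y}"])
    fix t assume "{?x, ?y} \<subseteq> sd t"
    then have "\<exists>z\<in>sd t. \<exists>y\<in>sd t. z = tup 2 (code \<phi>) (pfst s) (pfst e) (lst z) \<and>
       y = tup 2 (code \<psi>) (psnd s) (psnd e) (lst y) \<and> of_bool (acc (And \<phi> \<psi>) s e) = lst z * lst y"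
      by (intro bexI[of _ ?x] bexI[of _ ?y]) auto
    then show "step t (tup 2 (code (And \<phi> \<psi>)) s e (of_bool (acc (And \<phi> \<psi>) s e)))"
      by (simp add: step_def step_acc_def)
  qed (use And in auto)
next
  case (Neg \<phi>)
  let ?x = "tup 2 (code \<phi>) s e (of_bool (acc \<phi> s e))"
  show ?case
  proof (rule prov_step[where S = "{?x}"])
    fix t assume "{?x} \<subseteq> sd t"
    then have "\<exists>z\<in>sd t. z = tup 2 (code \<phi>) s e (lst z) \<and> of_bool (acc (Neg \<phi>) s e) = 1 - lst z"
      by (intro bexI[of _ ?x]) auto
    then show "step t (tup 2 (code (Neg \<phi>)) s e (of_bool (acc (Neg \<phi>) s e)))"
      by (simp add: step_def step_acc_def)
  qed (use Neg in auto)
next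
  case (ExI \<phi>)
  let ?f = "pfst e"
  let ?m = "\<lambda>a. tup 1 (code \<phi>) a ?f (mul \<phi> a ?f)"
  let ?a = "\<lambda>a. tup 2 (code \<phi>) (mul \<phi> a ?f) ?f (of_bool (acc \<phi> (mul \<phi> a ?f) ?f))"
  show ?case
  proof (rule prov_step[where S = "?m ` sd (psnd s) \<union> ?a ` sd (psnd s)"])
    show "prov z" if "z \<in> ?m ` sd (psnd s) \<union> ?a ` sd (psnd s)" for z using that ExI.IH prov_mul by auto
    fix t assume S: "?m ` sd (psnd s) \<union> ?a ` sd (psnd s) \<subseteq> sd t"
    have m: "\<exists>z\<in>sd t. z = tup 1 (code \<phi>) a ?f (lst z) \<and>
        tup 2 (code \<phi>) (lst z) ?f (of_bool (acc \<phi> (mul \<phi> a ?f) ?f)) \<in> sd t" if "a \<in> sd (psnd s)" for a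
      using S that by (intro bexI[of _ "?m a"]) auto
    show "step t (tup 2 (code (ExI \<phi>)) s e (of_bool (acc (ExI \<phi>) s e)))"
    proof (cases "acc (ExI \<phi>) s e")
      case True
      then obtain a where "a \<in> sd (psnd s)" "acc \<phi> (mul \<phi> a ?f) ?f" by auto
      then have "\<exists>a\<in>sd (psnd s). \<exists>z\<in>sd t. z = tup 1 (code \<phi>) a ?f (lst z) \<and> tup 2 (code \<phi>) (lst z) ?f 1 \<in> sd t"
        using m[of a] by auto
      with True show ?thesis by (simp add: step_def step_acc_def del: acc.simps)
    next
      case False
      then have "\<forall>a\<in>sd (psnd s). \<exists>z\<in>sd t. z = tup 1 (code \<phi>) a ?f (lst z) \<and> tup 2 (code \<phi>) (lst z) ?f 0 \<in> sd t"
        using m by auto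
      with False show ?thesis by (simp add: step_def step_acc_def del: acc.simps)
    qed
  qed simp
next
  case (ExP \<phi>)
  let ?m = "\<lambda>(a, f). tup 1 (code \<phi>) a f (mul \<phi> a f)"
  let ?a = "\<lambda>(a, f). tup 2 (code \<phi>) a f (of_bool (acc \<phi> a f))"
  let ?A = "sd s \<times> sd e" and ?E = "(\<lambda>f. (f, f)) ` sd e"
  show ?case
  proof (rule prov_step[where S = "?m ` (?A \<union> ?E) \<union> ?a ` ?A"])
    show "prov z" if "z \<in> ?m ` (?A \<union> ?E) \<union> ?a ` ?A" for z using that ExP.IH prov_mul by auto
    fix t assume S: "?m ` (?A \<union> ?E) \<union> ?a ` ?A \<subseteq> sd t"
    have m: "tup 1 (code \<phi>) a f (mul \<phi> a f) \<in> sd t" "tup 1 (code \<phi>) f f (mul \<phi> f f) \<in> sd t"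
      "tup 2 (code \<phi>) a f (of_bool (acc \<phi> a f)) \<in> sd t" if "a \<in> sd s" "f \<in> sd e" for a f
      using S that by auto
    show "step t (tup 2 (code (ExP \<phi>)) s e (of_bool (acc (ExP \<phi>) s e)))"
    proof (cases "acc (ExP \<phi>) s e")
      case True
      then obtain a f where "a \<in> sd s" "f \<in> sd e" "mul \<phi> a f = a" "mul \<phi> f f = f" "acc \<phi> a f" by auto
      then have "\<exists>a\<in>sd s. \<exists>f\<in>sd e. tup 1 (code \<phi>) a f a \<in> sd t \<and> tup 1 (code \<phi>) f f f \<in> sd t \<and>
          tup 2 (code \<phi>) a f 1 \<in> sd t"
        using m[of a f] by (intro bexI[of _ a] bexI[of _ f]) auto
      with True show ?thesis by (simp add: step_def step_acc_def del: acc.simps)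
    next
      case False
      have "(\<exists>z\<in>sd t. z = tup 1 (code \<phi>) a f (lst z) \<and> lst z \<noteq> a) \<or>
          (\<exists>z\<in>sd t. z = tup 1 (code \<phi>) f f (lst z) \<and> lst z \<noteq> f) \<or> tup 2 (code \<phi>) a f 0 \<in> sd t"
        if af: "a \<in> sd s" "f \<in> sd e" for a f
      proof -
        consider "mul \<phi> a f \<noteq> a" | "mul \<phi> f f \<noteq> f" | "\<not> acc \<phi> a f" using False af by auto
        then show ?thesis
        proof cases
          case 1
          then show ?thesis using m(1)[OF af] by (intro disjI1 bexI[of _ "?m (a, f)"]) auto
        next
          case 2
          then show ?thesis using m(2)[OF af] by (intro disjI2 disjI1 bexI[of _ "?m (f, f)"]) auto
        next
          case 3
          then show ?thesis using m(3)[OF af] by simp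
        qed
      qed
      with False show ?thesis by (simp add: step_def step_acc_def del: acc.simps)
    qed
  qed simp
qed (rule prov_step[where S = "{}"]; simp add: step_def step_acc_def)+

lemma prov_hpow: "prov (tup 3 (code \<phi>) k 0 (hpow \<phi> k))"
proof (induction k)
  case 0
  show ?case
    by (rule prov_step[where S = "{tup 0 (code \<phi>) 0 0 (hval \<phi> 0 0)}"])
      (use prov_hval in \<open>auto simp: step_def step_hpow_def\<close>)
next
  case (Suc k)
  let ?x = "tup 3 (code \<phi>) k 0 (hpow \<phi> k)" and ?y = "tup 0 (code \<phi>) 0 0 (hval \<phi> 0 0)"
  let ?m = "tup 1 (code \<phi>) (hpow \<phi> k) (hval \<phi> 0 0) (hpow \<phi> (Suc k))"
  show ?case
  proof (rule prov_step[where S = "{?x, ?y, ?m}"])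
    show "prov z" if "z \<in> {?x, ?y, ?m}" for z
      using that Suc.IH prov_hval prov_mul[of \<phi> "hpow \<phi> k" "hval \<phi> 0 0"] by auto
    fix t assume "{?x, ?y, ?m} \<subseteq> sd t"
    then have "\<exists>z\<in>sd t. \<exists>y\<in>sd t. z = tup 3 (code \<phi>) k 0 (lst z) \<and> y = tup 0 (code \<phi>) 0 0 (lst y) \<and>
       tup 1 (code \<phi>) (lst z) (lst y) (hpow \<phi> (Suc k)) \<in> sd t"
      by (intro bexI[of _ ?x] bexI[of _ ?y]) auto
    then show "step t (tup 3 (code \<phi>) (Suc k) 0 (hpow \<phi> (Suc k)))"
      by (simp add: step_def step_hpow_def)
  qed simp
qed

lemma prov_bnd: "bnd k m \<phi> \<Longrightarrow> prov (tup 4 k m 0 (code \<phi>))"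
proof (induction rule: bnd.induct)
  case (bnd_And k m \<phi> \<psi>)
  show ?case
    by (rule prov_step[where S = "{tup 4 k m 0 (code \<phi>), tup 4 k m 0 (code \<psi>)}"])
      (use bnd_And in \<open>auto simp: step_def step_bnd_def\<close>)
next
  case (bnd_Neg k m \<phi>)
  show ?case
    by (rule prov_step[where S = "{tup 4 k m 0 (code \<phi>)}"])
      (use bnd_Neg in \<open>auto simp: step_def step_bnd_def\<close>)
next
  case (bnd_ExI k m \<phi>)
  show ?case
    by (rule prov_step[where S = "{tup 4 (Suc k) m 0 (code \<phi>)}"])
      (use bnd_ExI in \<open>auto simp: step_def step_bnd_def\<close>)
next
  case (bnd_ExP k m \<phi>)
  show ?case
    by (rule prov_step[where S = "{tup 4 k (Suc m) 0 (code \<phi>)}"])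
      (use bnd_ExP in \<open>auto simp: step_def step_bnd_def\<close>)
qed (rule prov_step[where S = "{}"]; simp add: step_def step_bnd_def)+

lemma prov_fvp: "j \<in> fvp \<phi> \<Longrightarrow> prov (tup 5 j 0 0 (code \<phi>))"
proof (induction \<phi> arbitrary: j)
  case (Mem x X)
  show ?case by (rule prov_step[where S = "{}"]) (use Mem in \<open>simp_all add: step_def step_fvp_def\<close>)
next
  case (And \<phi> \<psi>)
  then consider "prov (tup 5 j 0 0 (code \<phi>))" | "prov (tup 5 j 0 0 (code \<psi>))" by auto
  then show ?case
  proof cases
    case 1
    show ?thesis
      by (rule prov_step[where S = "{tup 5 j 0 0 (code \<phi>)}"]) (use 1 in \<open>auto simp: step_def step_fvp_def\<close>)
  next
    case 2
    show ?thesis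
      by (rule prov_step[where S = "{tup 5 j 0 0 (code \<psi>)}"]) (use 2 in \<open>auto simp: step_def step_fvp_def\<close>)
  qed
next
  case (Neg \<phi>)
  show ?case
    by (rule prov_step[where S = "{tup 5 j 0 0 (code \<phi>)}"]) (use Neg in \<open>auto simp: step_def step_fvp_def\<close>)
next
  case (ExI \<phi>)
  show ?case
    by (rule prov_step[where S = "{tup 5 j 0 0 (code \<phi>)}"]) (use ExI in \<open>auto simp: step_def step_fvp_def\<close>)
next
  case (ExP \<phi>)
  show ?case
    by (rule prov_step[where S = "{tup 5 (Suc j) 0 0 (code \<phi>)}"]) (use ExP in \<open>auto simp: step_def step_fvp_def\<close>)
qed simp_all

text \<open>All quantifiers range over coded sets, so decidability follows from the shape of the
  definitions.\<close>

lemma cd_table [cf_intros]: "cd (\<lambda>e. table (e i))"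
  unfolding table_def step_def step_hval_def step_mul_def step_acc_def step_hpow_def step_bnd_def step_fvp_def
  by (intro cf_intros)

subsection \<open>The search for a bounded equivalent\<close>

text \<open>The derived connectives on codes; 7 to 10 are the tags of \<open>And\<close>,
  \<open>Neg\<close>, \<open>ExI\<close> and \<open>ExP\<close>.\<close>

definition cAllP :: "nat \<Rightarrow> nat" where "cAllP c = pe 8 (pe 10 (pe 8 c))"
definition cAllI :: "nat \<Rightarrow> nat" where "cAllI c = pe 8 (pe 9 (pe 8 c))"
definition cImp :: "nat \<Rightarrow> nat \<Rightarrow> nat" where "cImp a b = pe 8 (pe 7 (pe a (pe 8 b)))"
definition cIff :: "nat \<Rightarrow> nat \<Rightarrow> nat" where "cIff a b = pe 7 (pe (cImp a b) (cImp b a))"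

text \<open>The number \<open>code \<psi>\<close> of quantifiers bounds the free predicate variables of \<open>\<psi>\<close>.\<close>

definition closure :: "nat \<Rightarrow> nat \<Rightarrow> nat" where
  "closure c d = (cAllP ^^ c) (cAllI (cIff c d))"

lemma closure_code: "closure (code \<psi>) (code \<phi>) = code ((AllP ^^ code \<psi>) (AllI (Iff \<psi> \<phi>)))"
proof -
  have "code ((AllP ^^ n) \<chi>) = (cAllP ^^ n) (code \<chi>)" for n \<chi>
    by (induction n) (simp_all add: cAllP_def)
  then show ?thesis by (simp add: closure_def cAllI_def cIff_def cImp_def)
qed

lemma cf_closure [cf_intros]: "cf a \<Longrightarrow> cf b \<Longrightarrow> cf (\<lambda>e. closure (a e) (b e))"
proof -
  assume a: "cf a" and b: "cf b"
  have "cf (\<lambda>e. cAllP (e 0))" unfolding cAllP_def by (intro cf_intros)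
  then show ?thesis unfolding closure_def cAllI_def cIff_def cImp_def by (intro cf_funpow cf_intros a b)
qed

lemma cd_table_comp [cf_intros]: "cf a \<Longrightarrow> cd (\<lambda>e. table (a e))"
  using cf_let[of a "\<lambda>x e. of_bool (table x)"] cd_table[of 0] by (simp add: cd_def)

text \<open>A certificate \<open>n\<close> is a tuple of a candidate code, a bound \<open>m\<close>
  on its set variables, an exponent \<open>k\<close>, a value \<open>v\<close> and a table. Asking
  that \<open>m\<close> be 0 or \<open>m - 1\<close> be free in \<psi> keeps \<open>m\<close> at
  most \<open>q\<close> without knowing \<open>q\<close>. Tag 7 with \<open>pe 0 (pe 0 0)\<close>
  demands the first conjunct \<open>Eq 0 0\<close>. The last three entries say that \<open>v\<close>
  is the power with exponent \<open>k\<close>, idempotent and accepting for the closure, that is,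
  they certify \<open>truth\<close>.\<close>

definition check :: "nat \<Rightarrow> nat \<Rightarrow> bool" where
  "check n c \<longleftrightarrow> table (lst n)
     \<and> tup 4 0 (pfst (psnd n)) 0 (pfst n) \<in> sd (lst n)
     \<and> (pfst (psnd n) = 0 \<or> tup 5 (pfst (psnd n) - 1) 0 0 c \<in> sd (lst n))
     \<and> pfst (pfst n) = 7 \<and> arg1 (pfst n) = pe 0 (pe 0 0)
     \<and> tup 3 (closure c (pfst n)) (pfst (psnd (psnd n))) 0 (pfst (psnd (psnd (psnd n)))) \<in> sd (lst n)
     \<and> tup 1 (closure c (pfst n)) (pfst (psnd (psnd (psnd n)))) (pfst (psnd (psnd (psnd n))))
         (pfst (psnd (psnd (psnd n)))) \<in> sd (lst n)
     \<and> tup 2 (closure c (pfst n)) (pfst (psnd (psnd (psnd n)))) (pfst (psnd (psnd (psnd n)))) 1 \<in> sd (lst n)"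

lemma cd_check: "cd (\<lambda>e. check (e 0) (e 1))"
  unfolding check_def by (intro cf_intros)

lemma cf_imp_computes:
  assumes "cf f"
  shows "\<exists>F. \<forall>xs. length xs = k \<longrightarrow> computes F xs (f (\<lambda>i. if i < k then xs ! i else 0))"
proof -
  obtain n F where F: "\<And>e. computes F (map e [0..<n]) (f e)" using assms unfolding cf_def by blast
  have "computes (Comp F (map (\<lambda>i. if i < k then Proj i else Const0) [0..<n])) xs (f (\<lambda>i. if i < k then xs ! i else 0))"
    if "length xs = k" for xs
    by (rule computes.intros(4)[where ys = "map (\<lambda>i. if i < k then xs ! i else 0) [0..<n]"])
      (use F that in \<open>auto intro: computes.intros\<close>)
  then show ?thesis by blast
qed

lemma search_computable:
  "\<exists>F. \<forall>c. (\<exists>n. check n c) \<longrightarrow> computes F [c] (pfst (LEAST n. check n c))"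
proof -
  \<comment> \<open>\<open>Mu\<close> looks for the value 0, hence the negated test.\<close>
  obtain G where G: "\<And>xs. length xs = 2 \<Longrightarrow> computes G xs (of_bool (\<not> check (xs ! 0) (xs ! 1)))"
    using cf_imp_computes[OF cf_of_bool[OF cd_not[OF cd_check]], of 2] by auto
  obtain F where F: "\<And>xs. length xs = 1 \<Longrightarrow> computes F xs (pfst (xs ! 0))"
    using cf_imp_computes[OF cf_pfst[OF cf_var[of 0]], of 1] by auto
  have "computes (Comp F [Mu G]) [c] (pfst (LEAST n. check n c))" if ex: "\<exists>n. check n c" for c
  proof (rule computes.intros(4)[where ys = "[LEAST n. check n c]"])
    have "computes (Mu G) [c] (LEAST n. check n c)"
    proof (rule computes.intros(7))
      show "computes G [LEAST n. check n c, c] 0"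
        using G[of "[LEAST n. check n c, c]"] LeastI_ex[OF ex] by simp
      show "\<forall>m<LEAST n. check n c. \<exists>k. computes G [m, c] (Suc k)"
      proof (intro allI impI)
        fix m assume "m < (LEAST n. check n c)"
        then have "\<not> check m c" by (rule not_less_Least)
        then have "computes G [m, c] (Suc 0)" using G[of "[m, c]"] by simp
        then show "\<exists>k. computes G [m, c] (Suc k)" by blast
      qed
    qed
    then show "\<forall>i<length [Mu G]. computes ([Mu G] ! i) [c] ([LEAST n. check n c] ! i)" by simp
    show "computes F [LEAST n. check n c] (pfst (LEAST n. check n c))"
      using F[of "[LEAST n. check n c]"] by simp
  qed simp
  then show ?thesis by blast
qed

section \<open>Adequacy of the search\<close>

lemma fvp_less_code: "j \<in> fvp \<phi> \<Longrightarrow> j < code \<phi>"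
proof (induction \<phi> arbitrary: j)
  case (Mem x X)
  then show ?case using psnd_less[of "code (Mem x X)"] le_prod_encode_2[of X x] by simp
next
  case (And \<phi> \<psi>)
  then have "j < code \<phi> \<or> j < code \<psi>" by auto
  then show ?case
    using psnd_less[of "code (And \<phi> \<psi>)"] le_prod_encode_1[of "code \<phi>" "code \<psi>"] le_prod_encode_2[of "code \<psi>" "code \<phi>"]
    by auto
next
  case (Neg \<phi>)
  then show ?case using psnd_less[of "code (Neg \<phi>)"] by fastforce
next
  case (ExI \<phi>)
  then show ?case using psnd_less[of "code (ExI \<phi>)"] by fastforce
next
  case (ExP \<phi>)
  then show ?case using psnd_less[of "code (ExP \<phi>)"] by fastforce
qed simp_all

lemma closure_closed:
  assumes "fvi \<psi> \<subseteq> {0}" "fvi \<phi> \<subseteq> {0}" "fvp \<psi> \<subseteq> {..<q}" "fvp \<phi> \<subseteq> {..<q}"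
  shows "fvi ((AllP ^^ q) (AllI (Iff \<psi> \<phi>))) = {}" "fvp ((AllP ^^ q) (AllI (Iff \<psi> \<phi>))) = {}"
  using assms by (auto simp: funpow_AllP_fv)

text \<open>Any number of set quantifiers that covers the free variables gives the same meaning;
  this trades the \<open>code \<psi>\<close> quantifiers of the search for the \<open>q\<close> of
  the theorem.\<close>

lemma std_sat_closure:
  assumes "fvp \<psi> \<subseteq> {..<q}" "fvp \<phi> \<subseteq> {..<q}"
  shows "std.sat ei ep ((AllP ^^ q) (AllI (Iff \<psi> \<phi>))) \<longleftrightarrow>
    (\<forall>x Z. std.sat (x ## ei) Z \<psi> \<longleftrightarrow> std.sat (x ## ei) Z \<phi>)"
proof -
  have cong: "std.sat ei' (\<lambda>n. if n < q then Z n else ep (n - q)) \<chi> \<longleftrightarrow> std.sat ei' Z \<chi>"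
    if "fvp \<chi> \<subseteq> {..<q}" for \<chi> Z ei'
    by (rule std.sat_cong) (use that in auto)
  show ?thesis unfolding std_sat_AllP by (simp add: cong assms) blast
qed

lemma check_ex:
  assumes "fvi \<psi> \<subseteq> {0}" "fvp \<psi> \<subseteq> {..<q}" "MSO (causal q \<psi>)"
  shows "\<exists>n. check n (code \<psi>)"
proof -
  \<comment> \<open>The least bound on the free set variables of \<psi>; unless it is 0, its
    predecessor is free in \<psi>, which makes it at most every admissible \<open>q\<close>.\<close>
  define m where "m = (if fvp \<psi> = {} then 0 else Suc (Max (fvp \<psi>)))"
  have m: "fvp \<psi> \<subseteq> {..<m}" "m = 0 \<or> m - 1 \<in> fvp \<psi>"
    using finite_fvp[of \<psi>] Max_in[of "fvp \<psi>"] by (auto simp: m_def less_Suc_eq_le)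
  obtain \<phi>' where \<phi>': "bnd 0 m \<phi>'" "\<And>ei ep. std.sat ei ep \<psi> \<longleftrightarrow> std.sat ei ep \<phi>'"
    using bounded_equivalent_ex[OF assms(3,2,1) m(1)] by blast
  \<comment> \<open>The trivial conjunct makes variable 0 free even if it does not occur in
    \<phi>'.\<close>
  define \<phi> where "\<phi> = And (Eq 0 0) \<phi>'"
  have \<phi>: "bnd 0 m \<phi>" unfolding \<phi>_def using \<phi>'(1) by (intro bnd.intros) simp_all
  have le: "m \<le> code \<psi>" using m(2) fvp_less_code[of "m - 1" \<psi>] by auto
  let ?\<rho> = "(AllP ^^ code \<psi>) (AllI (Iff \<psi> \<phi>))"
  have fv: "fvp \<psi> \<subseteq> {..<code \<psi>}" "fvp \<phi> \<subseteq> {..<code \<psi>}" "fvi \<phi> \<subseteq> {0}"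
    using fvp_less_code bnd_imp_fv[OF \<phi>] le by auto
  have "std.sat (\<lambda>_. 0) (\<lambda>_. {}) ?\<rho>"
    unfolding std_sat_closure[OF fv(1,2)] by (simp add: \<phi>_def \<phi>'(2))
  then have "truth ?\<rho>" using std_sat_iff_truth closure_closed[OF assms(1) fv(3,1,2)] by blast
  then obtain k where k: "mul ?\<rho> (hpow ?\<rho> k) (hpow ?\<rho> k) = hpow ?\<rho> k" "acc ?\<rho> (hpow ?\<rho> k) (hpow ?\<rho> k)"
    by (auto simp: truth_def)
  let ?v = "hpow ?\<rho> k"
  let ?S = "{tup 4 0 m 0 (code \<phi>), tup 3 (code ?\<rho>) k 0 ?v, tup 1 (code ?\<rho>) ?v ?v ?v, tup 2 (code ?\<rho>) ?v ?v 1} \<union>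
    (if m = 0 then {} else {tup 5 (m - 1) 0 0 (code \<psi>)})"
  have "prov (tup 1 (code ?\<rho>) ?v ?v ?v)" using prov_mul[of ?\<rho> ?v ?v] k(1) by simp
  moreover have "prov (tup 2 (code ?\<rho>) ?v ?v 1)" using prov_acc[of ?\<rho> ?v ?v] k(2) by simp
  ultimately have p: "prov z" if "z \<in> ?S" for z
    using that prov_bnd[OF \<phi>] prov_hpow[of ?\<rho> k] prov_fvp[of "m - 1" \<psi>] m(2) by (auto split: if_splits)
  have "finite ?S" by simp
  from prov_tables[OF this p] obtain t where t: "table t" "?S \<subseteq> sd t" by blast
  have "pfst (code \<phi>) = 7" "arg1 (code \<phi>) = pe 0 (pe 0 0)" by (simp_all add: \<phi>_def)
  then have "check (tup (code \<phi>) m k ?v t) (code \<psi>)"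
    using t by (simp add: check_def closure_code del: One_nat_def split: if_splits)
  then show ?thesis by blast
qed

lemma check_sound:
  assumes "fvi \<psi> \<subseteq> {0}" "fvp \<psi> \<subseteq> {..<q}" "check n (code \<psi>)"
  obtains \<phi> where "code \<phi> = pfst n" "uniformly_bounded 0 \<phi>" "fvp \<phi> \<subseteq> {..<q}"
    "MSO ((AllP ^^ q) (AllI (Iff \<psi> \<phi>)))"
proof -
  define m t k v where "m = pfst (psnd n)" and "t = lst n" and "k = pfst (psnd (psnd n))"
    and "v = pfst (psnd (psnd (psnd n)))"
  have c: "table t" "tup 4 0 m 0 (pfst n) \<in> sd t" "m = 0 \<or> tup 5 (m - 1) 0 0 (code \<psi>) \<in> sd t"
    "pfst (pfst n) = 7" "arg1 (pfst n) = pe 0 (pe 0 0)"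
    "tup 3 (closure (code \<psi>) (pfst n)) k 0 v \<in> sd t" "tup 1 (closure (code \<psi>) (pfst n)) v v v \<in> sd t"
    "tup 2 (closure (code \<psi>) (pfst n)) v v 1 \<in> sd t"
    using assms(3) unfolding check_def m_def t_def k_def v_def by blast+
  obtain \<phi> where \<phi>: "code \<phi> = pfst n" "bnd 0 m \<phi>" using table_bnd[OF c(1,2)] by blast
  have m: "m = 0 \<or> m - 1 \<in> fvp \<psi>" using c(3) table_fvp[OF c(1)] by blast
  have "m \<le> q" "m \<le> code \<psi>" using m assms(2) fvp_less_code[of "m - 1" \<psi>] by auto
  then have fvp: "fvp \<phi> \<subseteq> {..<q}" "fvp \<phi> \<subseteq> {..<code \<psi>}" "fvi \<phi> \<subseteq> {0}" using bnd_imp_fv[OF \<phi>(2)] by auto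
  obtain \<phi>1 \<phi>2 where and': "\<phi> = And \<phi>1 \<phi>2" using c(4) unfolding \<phi>(1)[symmetric] by (cases \<phi>) auto
  have "code \<phi>1 = code (Eq 0 0)" using c(5) unfolding \<phi>(1)[symmetric] and' by simp
  then have "0 \<in> fvi \<phi>" using code_inject[of \<phi>1 "Eq 0 0"] and' by auto
  then have ub: "uniformly_bounded 0 \<phi>"
    unfolding uniformly_bounded_def using fvp(3) bnd_imp_relativize[OF \<phi>(2)] by auto
  let ?\<rho> = "(AllP ^^ code \<psi>) (AllI (Iff \<psi> \<phi>))"
  have \<rho>: "closure (code \<psi>) (pfst n) = code ?\<rho>" using closure_code[of \<psi> \<phi>] \<phi>(1) by simp
  have "v = hpow ?\<rho> k" using table_hpow[OF c(1), of ?\<rho> k v] c(6) \<rho> by simp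
  moreover have "v = mul ?\<rho> v v" using table_mul[OF c(1), of ?\<rho> v v v] c(7) \<rho> by simp
  moreover have "1 = (of_bool (acc ?\<rho> v v) :: nat)" using table_acc[OF c(1), of ?\<rho> v v 1] c(8) \<rho> by simp
  then have "acc ?\<rho> v v" by (cases "acc ?\<rho> v v") simp_all
  ultimately have "truth ?\<rho>" unfolding truth_def by metis
  moreover have psi: "fvp \<psi> \<subseteq> {..<code \<psi>}" using fvp_less_code by auto
  ultimately have "std.sat (\<lambda>_. 0) (\<lambda>_. {}) ?\<rho>"
    using std_sat_iff_truth closure_closed[OF assms(1) fvp(3) psi fvp(2)] by blast
  then have std: "std.sat (\<lambda>_. 0) (\<lambda>_. {}) ((AllP ^^ q) (AllI (Iff \<psi> \<phi>)))"
    unfolding std_sat_closure[OF psi fvp(2)] std_sat_closure[OF assms(2) fvp(1)] .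
  \<comment> \<open>A sentence true in the standard model holds in every Henkin model and is
    therefore derivable.\<close>
  have "MSO ((AllP ^^ q) (AllI (Iff \<psi> \<phi>)))"
  proof (rule henkin_completeness)
    fix le :: "nat \<Rightarrow> nat \<Rightarrow> bool" and zero suc P ei and ep :: "nat \<Rightarrow> nat set"
    assume "henkin le zero suc P" "range ep \<subseteq> P"
    then show "mstruct.sat le zero suc P ei ep ((AllP ^^ q) (AllI (Iff \<psi> \<phi>)))"
      using iffD2[OF henkin.sat_iff_std_sat std] closure_closed[OF assms(1) fvp(3) assms(2) fvp(1)] by metis
  qed
  with \<phi>(1) ub fvp(1) show ?thesis by (rule that)
qed

theorem theorem4p11:
  "\<exists>F. \<forall>q \<psi>. fvi \<psi> \<subseteq> {0} \<longrightarrow> fvp \<psi> \<subseteq> {..<q} \<longrightarrow> MSO (causal q \<psi>) \<longrightarrow>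
     (\<exists>\<phi>. computes F [code \<psi>] (code \<phi>) \<and>
          uniformly_bounded 0 \<phi> \<and> fvp \<phi> \<subseteq> {..<q} \<and>
          MSO ((AllP ^^ q) (AllI (Iff \<psi> \<phi>))))"
proof -
  obtain F where F: "\<And>c. \<exists>n. check n c \<Longrightarrow> computes F [c] (pfst (LEAST n. check n c))"
    using search_computable by blast
  have "\<exists>\<phi>. computes F [code \<psi>] (code \<phi>) \<and> uniformly_bounded 0 \<phi> \<and> fvp \<phi> \<subseteq> {..<q} \<and>
      MSO ((AllP ^^ q) (AllI (Iff \<psi> \<phi>)))"
    if \<psi>: "fvi \<psi> \<subseteq> {0}" "fvp \<psi> \<subseteq> {..<q}" "MSO (causal q \<psi>)" for q \<psi>
  proof -
    have ex: "\<exists>n. check n (code \<psi>)" using check_ex[OF \<psi>] .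
    from check_sound[OF \<psi>(1,2) LeastI_ex[OF ex]] obtain \<phi>
      where "code \<phi> = pfst (LEAST n. check n (code \<psi>))" "uniformly_bounded 0 \<phi>" "fvp \<phi> \<subseteq> {..<q}"
        "MSO ((AllP ^^ q) (AllI (Iff \<psi> \<phi>)))" .
    then show ?thesis using F[OF ex] by (intro exI[of _ \<phi>]) simp
  qed
  then show ?thesis by blast
qed

end
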